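(* There are at least sixteen countably infinite minimal prime graphs such that none of them embeds in another, and there are at least twenty-two countably infinite minimal prime posets such that none of them embeds in another. Furthermore, for every uncountable cardinal $\kappa$, there are at least fourteen minimal prime graphs of size $\kappa$ such that none of them embeds in another, and at least nineteen minimal prime posets of size $\kappa$ such that none of them embeds in another.
   Context: Graphs are undirected, simple and without loops. A graph (resp. poset) $G$ embeds a graph (resp. poset) $G'$ if $G'$ is isomorphic to an induced subgraph (resp. induced subposet) of $G$. A subset $A$ of the vertex set $V$ of a graph is autonomous if every $v\in V\setminus A$ is either adjacent to all vertices of $A$ or to none of them. A subset $A$ of a poset $P=(V,\le)$ is autonomous if for all $v\in V\setminus A$ and all $a,a'\in A$: $v<a$ implies $v<a'$, and $a<v$ implies $a'<v$. In both cases the empty set, the singletons and $V$ are the trivial autonomous sets. A graph (resp. poset) is prime if it has more than three elements and all its autonomous sets are trivial. A graph (resp. poset) $G$ is minimal prime if it is prime and every prime induced subgraph (resp. induced subposet) of $G$ with the same cardinality as $G$ embeds $G$. *)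

theory Defs
  imports Main
begin

unbundle cardinal_syntax

text \<open>
  Graphs and posets share one carrier type: a vertex set with a binary relation on it, which is
  the (symmetric, irreflexive) adjacency relation of a graph or the reflexive order of a poset.
\<close>

record 'a rel_struct =
  verts :: "'a set"
  rel :: "'a rel"

definition simple_graph :: "'a rel_struct \<Rightarrow> bool" where
  "simple_graph G \<longleftrightarrow> rel G \<subseteq> verts G \<times> verts G \<and> sym (rel G) \<and> irrefl (rel G)"

definition poset :: "'a rel_struct \<Rightarrow> bool" where
  "poset P \<longleftrightarrow> partial_order_on (verts P) (rel P)"

definition induced :: "'a rel_struct \<Rightarrow> 'a set \<Rightarrow> 'a rel_struct" where
  "induced G A = \<lparr>verts = A, rel = Restr (rel G) A\<rparr>"

definition isomorphic :: "'a rel_struct \<Rightarrow> 'b rel_struct \<Rightarrow> bool" where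
  "isomorphic G H \<longleftrightarrow>
    (\<exists>f. bij_betw f (verts G) (verts H) \<and>
         (\<forall>x\<in>verts G. \<forall>y\<in>verts G. (x, y) \<in> rel G \<longleftrightarrow> (f x, f y) \<in> rel H))"

text \<open>\<open>embeds G H\<close> reads ``\<open>G\<close> embeds \<open>H\<close>'': a copy of \<open>H\<close> sits inside \<open>G\<close>.\<close>

definition embeds :: "'a rel_struct \<Rightarrow> 'b rel_struct \<Rightarrow> bool" where
  "embeds G H \<longleftrightarrow> (\<exists>A\<subseteq>verts G. isomorphic H (induced G A))"

definition graph_autonomous :: "'a rel_struct \<Rightarrow> 'a set \<Rightarrow> bool" where
  "graph_autonomous G A \<longleftrightarrow> A \<subseteq> verts G \<and>
    (\<forall>v\<in>verts G - A. (\<forall>a\<in>A. (v, a) \<in> rel G) \<or> (\<forall>a\<in>A. (v, a) \<notin> rel G))"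

definition poset_autonomous :: "'a rel_struct \<Rightarrow> 'a set \<Rightarrow> bool" where
  "poset_autonomous P A \<longleftrightarrow> A \<subseteq> verts P \<and>
    (\<forall>v\<in>verts P - A. \<forall>a\<in>A. \<forall>a'\<in>A.
      ((v, a) \<in> rel P - Id \<longrightarrow> (v, a') \<in> rel P - Id) \<and>
      ((a, v) \<in> rel P - Id \<longrightarrow> (a', v) \<in> rel P - Id))"

definition trivial_subset :: "'a rel_struct \<Rightarrow> 'a set \<Rightarrow> bool" where
  "trivial_subset G A \<longleftrightarrow> A = {} \<or> (\<exists>x\<in>verts G. A = {x}) \<or> A = verts G"

text \<open>Since \<^const>\<open>card\<close> is 0 on infinite sets, ``more than three elements'' needs two cases.\<close>

definition more_than_three :: "'a set \<Rightarrow> bool" where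
  "more_than_three V \<longleftrightarrow> infinite V \<or> card V > 3"

definition prime_graph :: "'a rel_struct \<Rightarrow> bool" where
  "prime_graph G \<longleftrightarrow> simple_graph G \<and> more_than_three (verts G) \<and>
    (\<forall>A. graph_autonomous G A \<longrightarrow> trivial_subset G A)"

definition prime_poset :: "'a rel_struct \<Rightarrow> bool" where
  "prime_poset P \<longleftrightarrow> poset P \<and> more_than_three (verts P) \<and>
    (\<forall>A. poset_autonomous P A \<longrightarrow> trivial_subset P A)"

definition minimal_prime_graph :: "'a rel_struct \<Rightarrow> bool" where
  "minimal_prime_graph G \<longleftrightarrow> prime_graph G \<and>
    (\<forall>A\<subseteq>verts G. |A| =o |verts G| \<and> prime_graph (induced G A) \<longrightarrow> embeds (induced G A) G)"

definition minimal_prime_poset :: "'a rel_struct \<Rightarrow> bool" where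
  "minimal_prime_poset P \<longleftrightarrow> prime_poset P \<and>
    (\<forall>A\<subseteq>verts P. |A| =o |verts P| \<and> prime_poset (induced P A) \<longrightarrow> embeds (induced P A) P)"

end

theory Submission
  imports Defs
begin

text \<open>
  Every structure has vertices \<open>a i\<close>, \<open>b i\<close> for \<open>i < \<kappa>\<close> and at most two further points, and its relation
  between two vertices depends only on their rows and on whether they have the same index (three
  structures) or on how they compare in the order \<open>a 0 < b 0 < a 1 < b 1 < \<dots>\<close> (eight structures).
  In a prime substructure of full size, primality forces \<open>\<kappa>\<close> complete pairs \<open>a i\<close>, \<open>b i\<close> in the first case,
  a strict alternation between the two rows in the second case, and the presence of the further points.
  Such a substructure contains a copy of the whole. Complements and transitive orientations inherit
  minimality, which yields 14 graphs and 19 posets; in the countable case the infinite path, its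
  complement and their orientations add two graphs and three posets.

  An embedding between minimal prime structures of equal size can be reversed. It therefore suffices
  to separate them by monotone properties: containing a triangle, a square, a claw, a path on four
  vertices plus an isolated vertex, their complements, or an infinite threshold graph; and for a poset
  and its dual containing an ascending chain, an ascending half graph, or three points above one.
\<close>

section \<open>Indecomposable relations and their embeddings\<close>

text \<open>The counts arise as follows. Eight graphs and their complements would be sixteen; but
  each of the two hub graphs embeds in its own complement, by sending \<open>VA i\<close> to
  \<open>VB i\<close> and \<open>VB i\<close> to the vertex of row \<open>VA\<close> at the next
  index, so these two count once and fourteen remain. Ten relations are orders: star, crown, half,
  both hubs, both tails, and the complements of half and of both tails. Duals double all but the
  crown, which gives nineteen. The indices must form an initial ordinal: a set of indices of full
  size then has at least the order type of the whole, so an order-preserving copy exists at every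
  cardinal and not just in the countable case. Properties are recorded in finite lists with truth
  values. Pairwise incomparability of a whole family then becomes one finite computation on lists,
  and each structure is examined only once instead of once per pair.\<close>

definition auton :: "('a \<Rightarrow> 'a \<Rightarrow> bool) \<Rightarrow> 'a set \<Rightarrow> 'a set \<Rightarrow> bool" where
  "auton R X S \<longleftrightarrow> S \<subseteq> X \<and> (\<forall>v\<in>X - S. \<forall>x\<in>S. \<forall>y\<in>S. R v x = R v y \<and> R x v = R y v)"

text \<open>No size bound appears because all structures considered are infinite, which settles
  \<open>more_than_three\<close>.\<close>

definition indec :: "('a \<Rightarrow> 'a \<Rightarrow> bool) \<Rightarrow> 'a set \<Rightarrow> bool" where
  "indec R X \<longleftrightarrow> (\<forall>S. auton R X S \<longrightarrow> S = {} \<or> (\<exists>x. S = {x}) \<or> S = X)"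

lemma indecD: "indec R X \<Longrightarrow> auton R X S \<Longrightarrow> x \<in> S \<Longrightarrow> y \<in> S \<Longrightarrow> x \<noteq> y \<Longrightarrow> S = X"
  unfolding indec_def by blast

lemma indecI:
  assumes "\<And>S x y. auton R X S \<Longrightarrow> x \<in> S \<Longrightarrow> y \<in> S \<Longrightarrow> x \<noteq> y \<Longrightarrow> X \<subseteq> S"
  shows "indec R X"
  unfolding indec_def
proof (intro allI impI)
  fix S assume a: "auton R X S"
  then have "X \<subseteq> S \<Longrightarrow> S = X" by (auto simp: auton_def)
  then show "S = {} \<or> (\<exists>x. S = {x}) \<or> S = X" using assms[OF a] by blast
qed

definition struct :: "'a set \<Rightarrow> ('a \<Rightarrow> 'a \<Rightarrow> bool) \<Rightarrow> 'a rel_struct" where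
  "struct X R = \<lparr>verts = X, rel = {(x, y). x \<in> X \<and> y \<in> X \<and> R x y}\<rparr>"

definition emb :: "('a \<Rightarrow> 'a \<Rightarrow> bool) \<Rightarrow> 'a set \<Rightarrow> ('b \<Rightarrow> 'b \<Rightarrow> bool) \<Rightarrow> 'b set \<Rightarrow> bool" where
  "emb R V Q W \<longleftrightarrow> (\<exists>f. inj_on f W \<and> f ` W \<subseteq> V \<and> (\<forall>x\<in>W. \<forall>y\<in>W. Q x y = R (f x) (f y)))"

definition minimal :: "('a \<Rightarrow> 'a \<Rightarrow> bool) \<Rightarrow> 'a set \<Rightarrow> bool" where
  "minimal R V \<longleftrightarrow> indec R V \<and> (\<forall>X\<subseteq>V. |X| =o |V| \<longrightarrow> indec R X \<longrightarrow> emb R X R V)"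

lemma verts_struct [simp]: "verts (struct X R) = X"
  and rel_struct [simp]: "rel (struct X R) = {(x, y). x \<in> X \<and> y \<in> X \<and> R x y}"
  by (simp_all add: struct_def)

lemma induced_struct: "X \<subseteq> V \<Longrightarrow> induced (struct V R) X = struct X R"
  by (auto simp: induced_def struct_def)

lemma embeds_struct: "embeds (struct V R) (struct W Q) \<longleftrightarrow> emb R V Q W"
proof
  assume "embeds (struct V R) (struct W Q)"
  then show "emb R V Q W"
    by (fastforce simp: embeds_def isomorphic_def emb_def induced_struct bij_betw_def)
next
  assume "emb R V Q W"
  then obtain f where f: "inj_on f W" "f ` W \<subseteq> V" "\<And>x y. x\<in>W \<Longrightarrow> y\<in>W \<Longrightarrow> Q x y = R (f x) (f y)"
    by (auto simp: emb_def)
  then have "isomorphic (struct W Q) (induced (struct V R) (f ` W))"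
    by (auto simp: isomorphic_def induced_struct bij_betw_def intro!: exI[of _ f])
  then show "embeds (struct V R) (struct W Q)"
    using f(2) by (auto simp: embeds_def)
qed

lemma emb_trans: "emb R V Q W \<Longrightarrow> emb Q W P U \<Longrightarrow> emb R V P U"
  unfolding emb_def
proof (elim exE conjE)
  fix f g
  assume "inj_on f W" "f ` W \<subseteq> V" "\<forall>x\<in>W. \<forall>y\<in>W. Q x y = R (f x) (f y)"
    "inj_on g U" "g ` U \<subseteq> W" "\<forall>x\<in>U. \<forall>y\<in>U. P x y = Q (g x) (g y)"
  then show "\<exists>h. inj_on h U \<and> h ` U \<subseteq> V \<and> (\<forall>x\<in>U. \<forall>y\<in>U. P x y = R (h x) (h y))"
    by (intro exI[of _ "f \<circ> g"]) (auto intro!: comp_inj_on intro: inj_on_subset simp: image_subset_iff)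
qed

lemma emb_refl: "emb R V R V"
  unfolding emb_def by (intro exI[of _ id]) auto

lemma graph_autonomous_struct:
  assumes "\<And>x y. R x y = R y x"
  shows "graph_autonomous (struct V R) S \<longleftrightarrow> auton R V S"
proof
  assume "graph_autonomous (struct V R) S"
  then have "S \<subseteq> V" and "\<forall>v\<in>V - S. (\<forall>a\<in>S. R v a) \<or> (\<forall>a\<in>S. \<not> R v a)"
    unfolding graph_autonomous_def by auto
  then show "auton R V S" unfolding auton_def using assms by metis
next
  assume "auton R V S"
  then have "S \<subseteq> V" and "\<forall>v\<in>V - S. (\<forall>a\<in>S. R v a) \<or> (\<forall>a\<in>S. \<not> R v a)"
    unfolding auton_def by blast+
  then show "graph_autonomous (struct V R) S" unfolding graph_autonomous_def by auto
qed

text \<open>The vertex \<open>v\<close> lies outside \<open>S\<close>, so the diagonal that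
  \<open>poset_autonomous\<close> removes is never met; one notion serves reflexive and irreflexive
  relations.\<close>

lemma poset_autonomous_struct: "poset_autonomous (struct V R) S \<longleftrightarrow> auton R V S"
  unfolding poset_autonomous_def auton_def by auto

lemma prime_graph_struct:
  assumes "\<And>x y. R x y = R y x" "\<And>x. \<not> R x x" "infinite V"
  shows "prime_graph (struct V R) \<longleftrightarrow> indec R V"
proof -
  have "simple_graph (struct V R)"
    using assms by (auto simp: simple_graph_def sym_def irrefl_def)
  moreover have "auton R V S \<Longrightarrow> trivial_subset (struct V R) S = (S = {} \<or> (\<exists>x. S = {x}) \<or> S = V)" for S
    by (auto simp: trivial_subset_def auton_def)
  ultimately show ?thesis
    using assms by (auto simp: prime_graph_def more_than_three_def graph_autonomous_struct indec_def)
qed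

text \<open>Antisymmetry is asked on \<open>V\<close> only: a relation moved by \<open>pull\<close>
  takes arbitrary values off the image and need not be antisymmetric there.\<close>

lemma prime_poset_struct:
  assumes "\<And>x. R x x" "\<And>x y z. R x y \<Longrightarrow> R y z \<Longrightarrow> R x z" "\<And>x y. x \<in> V \<Longrightarrow> y \<in> V \<Longrightarrow> R x y \<Longrightarrow> R y x \<Longrightarrow> x = y" "infinite V"
  shows "prime_poset (struct V R) \<longleftrightarrow> indec R V"
proof -
  have "poset (struct V R)"
    using assms(1-3)
    by (auto simp: poset_def partial_order_on_def preorder_on_def refl_on_def trans_def antisym_def)
  moreover have "auton R V S \<Longrightarrow> trivial_subset (struct V R) S = (S = {} \<or> (\<exists>x. S = {x}) \<or> S = V)" for S
    by (auto simp: trivial_subset_def auton_def)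
  ultimately show ?thesis
    using assms by (auto simp: prime_poset_def more_than_three_def poset_autonomous_struct indec_def)
qed

lemma card_eq_infinite: "|X| =o |V| \<Longrightarrow> infinite V \<Longrightarrow> infinite X"
  by (simp add: card_of_ordIso_finite)

lemma minimal_prime_graph_struct:
  assumes "\<And>x y. R x y = R y x" "\<And>x. \<not> R x x" "infinite V" "minimal R V"
  shows "minimal_prime_graph (struct V R)"
proof -
  have "prime_graph (struct X R) = indec R X" if "infinite X" for X
    by (rule prime_graph_struct[OF assms(1,2) that])
  then show ?thesis
    using assms(3,4) card_eq_infinite[of _ V] unfolding minimal_prime_graph_def minimal_def
    by (auto simp: induced_struct embeds_struct)
qed

lemma minimal_prime_poset_struct:
  assumes "\<And>x. R x x" "\<And>x y z. R x y \<Longrightarrow> R y z \<Longrightarrow> R x z" "\<And>x y. x \<in> V \<Longrightarrow> y \<in> V \<Longrightarrow> R x y \<Longrightarrow> R y x \<Longrightarrow> x = y" "infinite V"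
    "minimal R V"
  shows "minimal_prime_poset (struct V R)"
proof -
  have "prime_poset (struct X R) = indec R X" if "infinite X" "X \<subseteq> V" for X
    by (rule prime_poset_struct[OF assms(1,2) _ that(1)]) (use assms(3) that(2) in blast)+
  then show ?thesis
  using assms(4,5) card_eq_infinite[of _ V] unfolding minimal_prime_poset_def minimal_def
  by (auto simp: induced_struct embeds_struct)
qed

section \<open>Transport of a relation along an injection\<close>

definition pull :: "('a \<Rightarrow> 'b) \<Rightarrow> 'a set \<Rightarrow> ('a \<Rightarrow> 'a \<Rightarrow> bool) \<Rightarrow> 'b \<Rightarrow> 'b \<Rightarrow> bool" where
  "pull h V R x y = R (inv_into V h x) (inv_into V h y)"

lemma auton_cong:
  assumes "\<And>x y. x \<in> X \<Longrightarrow> y \<in> X \<Longrightarrow> R x y = Q x y"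
  shows "auton R X S = auton Q X S"
  unfolding auton_def
proof (rule conj_cong[OF refl], intro ball_cong refl)
  fix v x y assume "S \<subseteq> X" "v \<in> X - S" "x \<in> S" "y \<in> S"
  then have "v \<in> X" "x \<in> X" "y \<in> X" by auto
  then show "(R v x = R v y \<and> R x v = R y v) = (Q v x = Q v y \<and> Q x v = Q y v)"
    using assms by simp
qed

lemma emb_pull: "inj_on h V \<Longrightarrow> X \<subseteq> V \<Longrightarrow> emb (pull h V R) (h ` X) R X"
  unfolding emb_def pull_def
  by (rule exI[of _ h]) (auto simp: inv_into_f_f inj_on_subset subset_eq)

lemma emb_pull': "inj_on h V \<Longrightarrow> X \<subseteq> V \<Longrightarrow> emb R X (pull h V R) (h ` X)"
  unfolding emb_def pull_def
  by (rule exI[of _ "inv_into V h"]) (auto simp: inv_into_f_f inj_on_inv_into image_mono subset_eq)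

text \<open>The image of an autonomous set is autonomous for the transported relation, and
  injectivity reflects triviality.\<close>

lemma indec_pull:
  assumes "inj_on h V" "X \<subseteq> V" "indec (pull h V R) (h ` X)"
  shows "indec R X"
  unfolding indec_def
proof (intro allI impI)
  fix S assume S: "auton R X S"
  have SX: "S \<subseteq> X" using S by (simp add: auton_def)
  have "auton (pull h V R) (h ` X) (h ` S)"
    unfolding auton_def
  proof (intro conjI ballI)
    show "h ` S \<subseteq> h ` X" using SX by auto
    fix v x y assume v: "v \<in> h ` X - h ` S" and x: "x \<in> h ` S" and y: "y \<in> h ` S"
    then obtain v' x' y' where *: "v = h v'" "x = h x'" "y = h y'" "v' \<in> X - S" "x' \<in> S" "y' \<in> S" by auto
    then have "inv_into V h v = v'" "inv_into V h x = x'" "inv_into V h y = y'"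
      using assms(1,2) SX by (auto simp: inv_into_f_f subset_eq)
    moreover have "R v' x' = R v' y' \<and> R x' v' = R y' v'"
      using S *(4-6) unfolding auton_def by blast
    ultimately show "pull h V R v x = pull h V R v y" "pull h V R x v = pull h V R y v"
      by (simp_all add: pull_def)
  qed
  then consider "h ` S = {}" | x where "h ` S = {x}" | "h ` S = h ` X"
    using assms(3) by (auto simp: indec_def)
  then show "S = {} \<or> (\<exists>x. S = {x}) \<or> S = X"
  proof cases
    case 2
    have "S = inv_into V h ` (h ` S)" using assms(1,2) SX by (simp add: inv_into_image_cancel)
    then have "S = {inv_into V h x}" using 2 by simp
    then show ?thesis by blast
  next
    case 3
    then show ?thesis using inj_on_image_eq_iff[OF assms(1), of S X] assms(2) SX by blast
  qed auto
qed

text \<open>Transporting back along \<open>inv_into V h\<close> recovers \<open>R\<close> on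
  \<open>V\<close>, so \<open>indec_pull\<close> applies to the inverse map.\<close>

lemma indec_pull':
  assumes "inj_on h V" "indec R V"
  shows "indec (pull h V R) (h ` V)"
proof -
  let ?g = "inv_into V h"
  have g: "inj_on ?g (h ` V)" by (rule inj_on_inv_into) simp
  have gi: "?g ` (h ` V) = V" using assms(1) by (simp add: inv_into_image_cancel)
  have "pull ?g (h ` V) (pull h V R) x y = R x y" if "x \<in> V" "y \<in> V" for x y
  proof -
    have "inv_into (h ` V) ?g z = h z" if "z \<in> V" for z
      using inv_into_f_f[OF g, of "h z"] that assms(1) by simp
    then show ?thesis using that assms(1) by (simp add: pull_def)
  qed
  then have "auton (pull ?g (h ` V) (pull h V R)) V S = auton R V S" for S
    by (rule auton_cong)
  then have "indec (pull ?g (h ` V) (pull h V R)) (?g ` (h ` V))"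
    using assms(2) by (simp add: indec_def gi)
  then show ?thesis by (rule indec_pull[OF g subset_refl])
qed

text \<open>This will move a minimal structure from the vertex type \<open>vx\<close> to the type of
  the given cardinal.\<close>

lemma minimal_pull:
  assumes h: "inj_on h V" and m: "minimal R V"
  shows "minimal (pull h V R) (h ` V)"
  unfolding minimal_def
proof (intro conjI allI impI)
  show "indec (pull h V R) (h ` V)" using h m by (simp add: indec_pull' minimal_def)
  fix Y assume Y: "Y \<subseteq> h ` V" "|Y| =o |h ` V|" "indec (pull h V R) Y"
  then obtain X where X: "Y = h ` X" "X \<subseteq> V" by (meson subset_imageE)
  have "|Z| =o |h ` Z|" if "Z \<subseteq> V" for Z
    using that h by (meson bij_betw_imageI card_of_ordIsoI inj_on_subset)
  then have "|X| =o |V|" using X Y(2) by (meson ordIso_symmetric ordIso_transitive subset_refl)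
  moreover have "indec R X" using indec_pull[OF h X(2)] Y(3) X(1) by simp
  ultimately have "emb R X R V" using m X(2) by (simp add: minimal_def)
  then show "emb (pull h V R) Y (pull h V R) (h ` V)"
    using emb_trans emb_pull[OF h X(2)] emb_pull'[OF h subset_refl] X(1) by metis
qed

lemma indec_emb:
  assumes "inj_on f W" "\<forall>x\<in>W. \<forall>y\<in>W. Q x y = R (f x) (f y)" "indec Q W"
  shows "indec R (f ` W)"
proof -
  have "indec (pull f W Q) (f ` W)" using assms by (simp add: indec_pull')
  moreover have "pull f W Q x y = R x y" if "x \<in> f ` W" "y \<in> f ` W" for x y
    using that assms by (auto simp: pull_def)
  then have "auton (pull f W Q) (f ` W) S = auton R (f ` W) S" for S
    by (rule auton_cong)
  ultimately show ?thesis by (simp add: indec_def)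
qed

text \<open>Hence non-embeddability of minimal structures of equal size follows from any monotone property
  that separates them, in either direction.\<close>

lemma emb_sym_if_minimal:
  assumes "minimal R V" "minimal Q W" "|V| =o |W|" "emb R V Q W"
  shows "emb Q W R V"
proof -
  obtain f where f: "inj_on f W" "f ` W \<subseteq> V" "\<forall>x\<in>W. \<forall>y\<in>W. Q x y = R (f x) (f y)"
    using assms(4) by (auto simp: emb_def)
  have "|f ` W| =o |V|"
    using f(1) assms(3)
    by (meson bij_betw_imageI card_of_ordIsoI ordIso_symmetric ordIso_transitive)
  moreover have "indec R (f ` W)" using indec_emb f assms(2) by (auto simp: minimal_def)
  ultimately have "emb R (f ` W) R V" using assms(1) f(2) by (simp add: minimal_def)
  moreover have "emb Q W R (f ` W)"
    unfolding emb_def using f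
    by (intro exI[of _ "inv_into W f"]) (auto simp: inv_into_f_f inj_on_inv_into)
  ultimately show ?thesis by (rule emb_trans[rotated])
qed

text \<open>A graph, its complement, the poset it comes from and the dual poset are all read off one
  irreflexive relation \<open>R\<close>. Sets autonomous for \<open>R\<close> are autonomous for each of the four, and sets
  autonomous for any of the four are autonomous for the graph; so primality is only needed for the
  graph, and self-embeddings are only needed for \<open>R\<close>.\<close>

definition sym_of :: "('a \<Rightarrow> 'a \<Rightarrow> bool) \<Rightarrow> 'a \<Rightarrow> 'a \<Rightarrow> bool" where
  "sym_of R x y \<longleftrightarrow> x \<noteq> y \<and> (R x y \<or> R y x)"

definition co_of :: "('a \<Rightarrow> 'a \<Rightarrow> bool) \<Rightarrow> 'a \<Rightarrow> 'a \<Rightarrow> bool" where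
  "co_of R x y \<longleftrightarrow> x \<noteq> y \<and> \<not> R x y \<and> \<not> R y x"

definition po_of :: "('a \<Rightarrow> 'a \<Rightarrow> bool) \<Rightarrow> 'a \<Rightarrow> 'a \<Rightarrow> bool" where
  "po_of R x y \<longleftrightarrow> x = y \<or> R x y"

definition od_of :: "('a \<Rightarrow> 'a \<Rightarrow> bool) \<Rightarrow> 'a \<Rightarrow> 'a \<Rightarrow> bool" where
  "od_of R x y \<longleftrightarrow> x = y \<or> R y x"

definition self_embedding :: "('a \<Rightarrow> 'a \<Rightarrow> bool) \<Rightarrow> 'a set \<Rightarrow> bool" where
  "self_embedding R V \<longleftrightarrow> (\<forall>X\<subseteq>V. |X| =o |V| \<longrightarrow> indec R X \<longrightarrow> emb R X R V)"

lemma auton_mono: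
  assumes "\<And>v x y. v \<noteq> x \<Longrightarrow> v \<noteq> y \<Longrightarrow> R v x = R v y \<Longrightarrow> R x v = R y v \<Longrightarrow> Q v x = Q v y \<and> Q x v = Q y v"
  shows "auton R X S \<Longrightarrow> auton Q X S"
  unfolding auton_def using assms by (metis Diff_iff)

lemma indec_mono:
  assumes "\<And>v x y. v \<noteq> x \<Longrightarrow> v \<noteq> y \<Longrightarrow> R v x = R v y \<Longrightarrow> R x v = R y v \<Longrightarrow> Q v x = Q v y \<and> Q x v = Q y v"
  shows "indec Q X \<Longrightarrow> indec R X"
  unfolding indec_def using auton_mono[of R Q X, OF assms] by blast

text \<open>The third assumption makes \<open>Q\<close>-indecomposable parts
  \<open>R\<close>-indecomposable, so that \<open>R\<close> embeds in them. The fourth lets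
  \<open>Q\<close> inherit primality from the graph. The last says that \<open>Q\<close> is
  determined by \<open>R\<close> and equality, so that every \<open>R\<close>-embedding is a
  \<open>Q\<close>-embedding.\<close>

lemma minimal_derived:
  assumes "self_embedding R V" "indec (sym_of R) V"
    "\<And>v x y. v \<noteq> x \<Longrightarrow> v \<noteq> y \<Longrightarrow> R v x = R v y \<Longrightarrow> R x v = R y v \<Longrightarrow> Q v x = Q v y \<and> Q x v = Q y v"
    "\<And>v x y. v \<noteq> x \<Longrightarrow> v \<noteq> y \<Longrightarrow> Q v x = Q v y \<Longrightarrow> Q x v = Q y v \<Longrightarrow> sym_of R v x = sym_of R v y \<and> sym_of R x v = sym_of R y v"
    "\<And>x y x' y'. R x y = R x' y' \<Longrightarrow> R y x = R y' x' \<Longrightarrow> x = y \<longleftrightarrow> x' = y' \<Longrightarrow> Q x y = Q x' y'"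
  shows "minimal Q V"
  unfolding minimal_def
proof (intro conjI allI impI)
  show "indec Q V" using indec_mono[of Q "sym_of R", OF assms(4) assms(2)] by blast
  fix X assume X: "X \<subseteq> V" "|X| =o |V|" "indec Q X"
  have "indec R X" using indec_mono[of R Q, OF assms(3) X(3)] by blast
  then have "emb R X R V" using assms(1) X by (simp add: self_embedding_def)
  then obtain f where f: "inj_on f V" "f ` V \<subseteq> X" "\<forall>x\<in>V. \<forall>y\<in>V. R x y = R (f x) (f y)" by (auto simp: emb_def)
  have "Q x y = Q (f x) (f y)" if "x \<in> V" "y \<in> V" for x y
    by (rule assms(5)) (use f that in \<open>simp_all add: inj_on_eq_iff\<close>)
  then show "emb Q X Q V"
    unfolding emb_def using f(1,2) by (intro exI[of _ f]) simp
qed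

lemma minimal_sym_of: "self_embedding R V \<Longrightarrow> indec (sym_of R) V \<Longrightarrow> minimal (sym_of R) V"
  and minimal_co_of: "self_embedding R V \<Longrightarrow> indec (sym_of R) V \<Longrightarrow> minimal (co_of R) V"
  and minimal_po_of: "self_embedding R V \<Longrightarrow> indec (sym_of R) V \<Longrightarrow> minimal (po_of R) V"
  and minimal_od_of: "self_embedding R V \<Longrightarrow> indec (sym_of R) V \<Longrightarrow> minimal (od_of R) V"
  by (rule minimal_derived[of R V]; auto simp: sym_of_def co_of_def po_of_def od_of_def)+

section \<open>Two rows of vertices and at most two extra points\<close>

datatype 'k vx = VA 'k | VB 'k | VC | VD

datatype row_tag = RA | RB | RC | RD

fun row :: "'k vx \<Rightarrow> row_tag" where
  "row (VA i) = RA"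
| "row (VB i) = RB"
| "row VC = RC"
| "row VD = RD"

text \<open>The linear order \<open>VD < VA 0 < VB 0 < VA 1 < VB 1 < \<dots> < VC\<close>.\<close>

fun before :: "('k \<Rightarrow> 'k \<Rightarrow> bool) \<Rightarrow> 'k vx \<Rightarrow> 'k vx \<Rightarrow> bool" where
  "before ls (VA i) (VA j) = ls i j"
| "before ls (VB i) (VB j) = ls i j"
| "before ls (VA i) (VB j) = (\<not> ls j i)"
| "before ls (VB i) (VA j) = ls i j"
| "before ls (VA i) VC = True"
| "before ls (VB i) VC = True"
| "before ls VD (VA i) = True"
| "before ls VD (VB i) = True"
| "before ls VD VC = True"
| "before ls x VD = False"
| "before ls VC x = False"

fun mate :: "'k vx \<Rightarrow> 'k vx \<Rightarrow> bool" where
  "mate (VA i) (VB j) = (i = j)"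
| "mate (VB i) (VA j) = (i = j)"
| "mate x y = False"

text \<open>Since \<open>ori \<rho> T x y\<close> depends only on the rows and on \<open>\<rho> x y\<close>, a map preserving rows and \<open>\<rho>\<close> is
  an embedding for every table \<open>T\<close> at once.\<close>

definition ori :: "('k vx \<Rightarrow> 'k vx \<Rightarrow> bool) \<Rightarrow> (row_tag \<times> row_tag \<times> bool) set \<Rightarrow> 'k vx \<Rightarrow> 'k vx \<Rightarrow> bool" where
  "ori \<rho> T x y \<longleftrightarrow> x \<noteq> y \<and> (row x, row y, \<rho> x y) \<in> T"

definition vset :: "'k set \<Rightarrow> 'k vx set \<Rightarrow> 'k vx set" where
  "vset K E = VA ` K \<union> VB ` K \<union> E"

lemma self_embedding_oriI:
  assumes "\<And>X. X \<subseteq> V \<Longrightarrow> |X| =o |V| \<Longrightarrow> indec (ori \<rho> T) X \<Longrightarrow>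
     \<exists>f. inj_on f V \<and> f ` V \<subseteq> X \<and> (\<forall>x\<in>V. row (f x) = row x) \<and> (\<forall>x\<in>V. \<forall>y\<in>V. x \<noteq> y \<longrightarrow> \<rho> (f x) (f y) = \<rho> x y)"
  shows "self_embedding (ori \<rho> T) V"
  unfolding self_embedding_def
proof (intro allI impI)
  fix X assume "X \<subseteq> V" "|X| =o |V|" "indec (ori \<rho> T) X"
  then obtain f where f: "inj_on f V" "f ` V \<subseteq> X" "\<And>x. x \<in> V \<Longrightarrow> row (f x) = row x"
    "\<And>x y. x \<in> V \<Longrightarrow> y \<in> V \<Longrightarrow> x \<noteq> y \<Longrightarrow> \<rho> (f x) (f y) = \<rho> x y"
    using assms by metis
  have "ori \<rho> T x y = ori \<rho> T (f x) (f y)" if "x \<in> V" "y \<in> V" for x y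
    using f(1) f(3)[OF that(1)] f(3)[OF that(2)] f(4)[OF that] that
    by (auto simp: ori_def inj_on_eq_iff)
  then show "emb (ori \<rho> T) X (ori \<rho> T) V"
    unfolding emb_def using f(1,2) by blast
qed

text \<open>A copy of the cardinal \<open>|K|\<close> as an initial ordinal inside a well-ordered type.\<close>

locale index_set = wellorder le ls for le :: "'k \<Rightarrow> 'k \<Rightarrow> bool" (infix "\<sqsubseteq>" 50) and ls (infix "\<sqsubset>" 50) +
  fixes K :: "'k set"
  assumes inf: "infinite K"
    and small: "i \<in> K \<Longrightarrow> |{j\<in>K. j \<sqsubset> i}| <o |K|"
begin

lemma finite_less: "finite E \<Longrightarrow> |E| <o |K|"
  using inf finite_ordLess_infinite[OF card_of_Well_order card_of_Well_order, of E K]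
  by (simp add: Field_card_of)

lemma small_le: "i \<in> K \<Longrightarrow> |{j\<in>K. j \<sqsubseteq> i}| <o |K|"
proof -
  assume i: "i \<in> K"
  have "|{i}| <o |K|" by (rule finite_less) simp
  then have "|{j\<in>K. j \<sqsubset> i} \<union> {i}| <o |K|"
    using inf small[OF i] card_of_Un_ordLess_infinite by blast
  moreover have "{j\<in>K. j \<sqsubseteq> i} \<subseteq> {j\<in>K. j \<sqsubset> i} \<union> {i}" by auto
  ultimately show ?thesis using card_of_mono1 ordLeq_ordLess_trans by blast
qed

text \<open>Otherwise \<open>J\<close> would lie in an initial segment, which has smaller
  cardinality.\<close>

lemma unbounded:
  assumes "J \<subseteq> K" "|J| =o |K|" "i \<in> K"
  shows "\<exists>j\<in>J. i \<sqsubset> j"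
proof (rule ccontr)
  assume "\<not> ?thesis"
  then have "J \<subseteq> {j\<in>K. j \<sqsubseteq> i}" using assms(1) by (auto simp: not_less)
  then have "|J| <o |K|" using small_le[OF assms(3)] card_of_mono1 ordLeq_ordLess_trans by blast
  then show False using assms(2) not_ordLess_ordIso by blast
qed

lemma no_max: "i \<in> K \<Longrightarrow> \<exists>j\<in>K. i \<sqsubset> j"
  using unbounded[of K] card_of_refl by blast

lemma above2: "i \<in> K \<Longrightarrow> j \<in> K \<Longrightarrow> \<exists>k\<in>K. i \<sqsubset> k \<and> j \<sqsubset> k"
  by (metis no_max le_cases order.strict_trans1)

lemma card_vset: "finite E \<Longrightarrow> |vset K E| =o |K|"
proof -
  assume E: "finite E"
  have "|VA ` K| \<le>o |K|" "|VB ` K| \<le>o |K|" by (rule card_of_image)+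
  moreover have "|E| \<le>o |K|"
    using E finite_less ordLess_imp_ordLeq by blast
  ultimately have "|vset K E| \<le>o |K|"
    unfolding vset_def using inf
    by (intro card_of_Un_ordLeq_infinite_Field[where r = "|K|"]) (simp_all add: Field_card_of card_of_card_order_on)
  moreover have "|K| \<le>o |vset K E|"
    using card_of_ordLeq[of K "vset K E"] by (auto simp: vset_def intro!: exI[of _ VA] inj_onI)
  ultimately show ?thesis by (simp add: ordIso_iff_ordLeq)
qed

lemma infinite_vset: "finite E \<Longrightarrow> infinite (vset K E)"
  using card_vset inf card_of_ordIso_finite by blast

section \<open>Increasing maps into full-size sets of indices\<close>

definition wo :: "'k set \<Rightarrow> 'k rel" where
  "wo J = {(x, y). x \<in> J \<and> y \<in> J \<and> x \<sqsubseteq> y}"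

lemma Field_wo: "Field (wo J) = J"
  by (auto simp: wo_def Field_def)

lemma Well_order_wo: "Well_order (wo J)"
proof -
  have "wf (wo J - Id)"
  proof (rule wf_subset)
    show "wf {(x, y). x \<sqsubset> y}" by (rule wf)
    show "wo J - Id \<subseteq> {(x, y). x \<sqsubset> y}" by (auto simp: wo_def)
  qed
  moreover have "Linear_order (wo J)"
    unfolding linear_order_on_def partial_order_on_def preorder_on_def Field_wo
    by (auto simp: wo_def refl_on_def trans_def antisym_def total_on_def)
  ultimately show ?thesis by (simp add: well_order_on_def)
qed

text \<open>Compare the well-orders of \<open>J\<close> and \<open>K\<close>: were \<open>J\<close>
  shorter, it would be isomorphic to a proper initial segment of \<open>K\<close> and hence too
  small. So \<open>K\<close> embeds in \<open>J\<close>.\<close>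

lemma obtain_monotone:
  assumes "J \<subseteq> K" "|J| =o |K|"
  obtains g where "\<And>i. i \<in> K \<Longrightarrow> g i \<in> J" "\<And>i j. i \<in> K \<Longrightarrow> j \<in> K \<Longrightarrow> i \<sqsubset> j \<Longrightarrow> g i \<sqsubset> g j"
proof -
  have "\<not> wo J <o wo K"
  proof
    assume "wo J <o wo K"
    then obtain a where a: "a \<in> K" "wo J =o Restr (wo K) (underS (wo K) a)"
      using ordLess_iff_ordIso_Restr[OF Well_order_wo Well_order_wo] Field_wo by blast
    have "|J| =o |Field (Restr (wo K) (underS (wo K) a))|"
      using card_of_cong[OF a(2)] by (simp add: Field_wo)
    moreover have "|Field (Restr (wo K) (underS (wo K) a))| \<le>o |{j\<in>K. j \<sqsubset> a}|"
      by (rule card_of_mono1) (auto simp: Field_def wo_def underS_def)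
    ultimately have "|J| <o |K|"
      using small[OF a(1)] ordLeq_ordLess_trans ordIso_ordLess_trans by blast
    then show False using assms(2) not_ordLess_ordIso by blast
  qed
  then have "wo K \<le>o wo J" using ordLess_or_ordLeq[OF Well_order_wo Well_order_wo] by blast
  then obtain g where g: "embed (wo K) (wo J) g" by (auto simp: ordLeq_def)
  have c: "compat (wo K) (wo J) g" using embed_compat[OF g] .
  have i: "inj_on g K" using embed_inj_on[OF Well_order_wo g] by (simp add: Field_wo)
  show thesis
  proof
    show "g i \<in> J" if "i \<in> K" for i
      using embed_in_Field[OF g] that by (simp add: Field_wo)
    show "g i \<sqsubset> g j" if "i \<in> K" "j \<in> K" "i \<sqsubset> j" for i j
    proof -
      have "(i, j) \<in> wo K" using that by (auto simp: wo_def)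
      then have "(g i, g j) \<in> wo J" using c by (auto simp: compat_def)
      moreover have "g i \<noteq> g j" using i that by (auto simp: inj_on_eq_iff)
      ultimately show ?thesis by (auto simp: wo_def)
    qed
  qed
qed

text \<open>Choose an increasing family \<open>g\<close> of full size in row \<open>VA\<close> of
  \<open>X\<close>, and give each \<open>VA (g i)\<close> as partner the first member of row
  \<open>VB\<close> after it. Alternation places this partner before every later selected vertex of
  row \<open>VA\<close>, so all comparisons survive.\<close>

lemma half_map:
  assumes X: "X \<subseteq> vset K E" "|X| =o |K|" and E: "E \<subseteq> {VC, VD}" "E \<subseteq> X"
    and AB: "\<And>i j. VA i \<in> X \<Longrightarrow> VA j \<in> X \<Longrightarrow> i \<sqsubset> j \<Longrightarrow> \<exists>k. VB k \<in> X \<and> i \<sqsubseteq> k \<and> k \<sqsubset> j"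
    and BA: "\<And>i j. VB i \<in> X \<Longrightarrow> VB j \<in> X \<Longrightarrow> i \<sqsubset> j \<Longrightarrow> \<exists>k. VA k \<in> X \<and> i \<sqsubset> k \<and> k \<sqsubseteq> j"
  shows "\<exists>f. inj_on f (vset K E) \<and> f ` vset K E \<subseteq> X \<and> (\<forall>x\<in>vset K E. row (f x) = row x) \<and>
    (\<forall>x\<in>vset K E. \<forall>y\<in>vset K E. x \<noteq> y \<longrightarrow> before ls (f x) (f y) = before ls x y)"
proof -
  define I where "I = {i. VA i \<in> X}"
  define J where "J = {i. VB i \<in> X}"
  have IJ: "I \<subseteq> K" "J \<subseteq> K" using X(1) E(1) by (auto simp: I_def J_def vset_def)
  have Xsub: "X \<subseteq> VA ` I \<union> VB ` J \<union> E" using X(1) by (auto simp: I_def J_def vset_def)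
  have EK: "|E| <o |K|" using E(1) finite_less[of E] finite_subset by fastforce
  have "|I| =o |K|"
  proof (rule ccontr)
    assume n: "\<not> |I| =o |K|"
    then have I: "|I| <o |K|" using IJ(1) using card_of_mono1 ordLeq_iff_ordLess_or_ordIso by blast
    have J: "|J| =o |K|"
    proof (rule ccontr)
      assume "\<not> |J| =o |K|"
      then have J: "|J| <o |K|" using IJ(2) using card_of_mono1 ordLeq_iff_ordLess_or_ordIso by blast
      have "|VA ` I| <o |K|" "|VB ` J| <o |K|"
        using I J card_of_image ordLeq_ordLess_trans by blast+
      then have "|VA ` I \<union> VB ` J \<union> E| <o |K|"
        using EK inf card_of_Un_ordLess_infinite by blast
      then have "|X| <o |K|" using Xsub card_of_mono1 ordLeq_ordLess_trans by blast
      then show False using X(2) not_ordLess_ordIso by blast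
    qed
    \<comment> \<open>\<open>n j\<close> is the next index of row \<open>VA\<close> after
      \<open>VB j\<close>. Between two members of row \<open>VB\<close> there is one of row
      \<open>VA\<close>, so \<open>n\<close> is injective and \<open>J\<close> is no larger than
      \<open>I\<close>.\<close>
    define n where "n j = ord.Least (\<sqsubseteq>) (\<lambda>i. i \<in> I \<and> j \<sqsubset> i)" for j
    have n: "n j \<in> I \<and> j \<sqsubset> n j \<and> (\<forall>i\<in>I. j \<sqsubset> i \<longrightarrow> n j \<sqsubseteq> i)" if "j \<in> J" for j
    proof -
      have "j \<in> K" using \<open>j \<in> J\<close> IJ(2) by blast
      then obtain j' where "j' \<in> J" "j \<sqsubset> j'" using unbounded[OF IJ(2) J] by blast
      then obtain i where "i \<in> I" "j \<sqsubset> i" using BA[of j j'] \<open>j \<in> J\<close> by (auto simp: I_def J_def)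
      then have "n j \<in> I \<and> j \<sqsubset> n j"
        unfolding n_def by (intro LeastI[of "\<lambda>i. i \<in> I \<and> j \<sqsubset> i"]) simp
      moreover have "n j \<sqsubseteq> i" if "i \<in> I" "j \<sqsubset> i" for i
        unfolding n_def using that by (intro Least_le) simp
      ultimately show ?thesis by blast
    qed
    have lt: "n j \<sqsubset> n j'" if "j \<in> J" "j' \<in> J" "j \<sqsubset> j'" for j j'
    proof -
      obtain i where "i \<in> I" "j \<sqsubset> i" "i \<sqsubseteq> j'" using BA[of j j'] \<open>j \<in> J\<close> \<open>j' \<in> J\<close> \<open>j \<sqsubset> j'\<close> by (auto simp: I_def J_def)
      then show ?thesis using n[OF that(1)] n[OF that(2)] by (meson le_less_trans)
    qed
    have "inj_on n J" by (rule inj_onI) (metis lt less_irrefl neqE)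
    moreover have "n ` J \<subseteq> I" using n by blast
    ultimately have "|J| \<le>o |I|" using card_of_ordLeq by blast
    then show False using I J by (meson not_ordLess_ordIso ordIso_ordLeq_trans ordIso_symmetric ordLeq_ordLess_trans not_ordLess_ordLeq)
  qed
  then obtain g where g: "\<And>i. i \<in> K \<Longrightarrow> g i \<in> I" "\<And>i j. i \<in> K \<Longrightarrow> j \<in> K \<Longrightarrow> i \<sqsubset> j \<Longrightarrow> g i \<sqsubset> g j"
    using obtain_monotone[OF IJ(1)] by blast
  define h where "h i = ord.Least (\<sqsubseteq>) (\<lambda>k. k \<in> J \<and> g i \<sqsubseteq> k)" for i
  have h: "h i \<in> J \<and> g i \<sqsubseteq> h i \<and> (\<forall>k\<in>J. g i \<sqsubseteq> k \<longrightarrow> h i \<sqsubseteq> k)" if "i \<in> K" for i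
  proof -
    obtain i' where "i' \<in> K" "i \<sqsubset> i'" using no_max \<open>i \<in> K\<close> by blast
    then have "g i' \<in> I" "g i \<in> I" "g i \<sqsubset> g i'" using g that by auto
    then obtain k where "k \<in> J" "g i \<sqsubseteq> k" using AB[of "g i" "g i'"] by (auto simp: I_def J_def)
    then have "h i \<in> J \<and> g i \<sqsubseteq> h i"
      unfolding h_def by (intro LeastI[of "\<lambda>k. k \<in> J \<and> g i \<sqsubseteq> k"]) simp
    moreover have "h i \<sqsubseteq> k" if "k \<in> J" "g i \<sqsubseteq> k" for k
      unfolding h_def using that by (intro Least_le) simp
    ultimately show ?thesis by blast
  qed
  \<comment> \<open>Alternation yields a member of row \<open>VB\<close> at or after
    \<open>g i\<close> and before \<open>g j\<close>; the least candidate \<open>h i\<close> is no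
    later.\<close>
  have hg: "h i \<sqsubset> g j" if "i \<in> K" "j \<in> K" "i \<sqsubset> j" for i j
  proof -
    obtain k where "k \<in> J" "g i \<sqsubseteq> k" "k \<sqsubset> g j"
      using AB[of "g i" "g j"] g(1)[of i] g(1)[of j] g(2)[of i j] \<open>i \<in> K\<close> \<open>j \<in> K\<close> \<open>i \<sqsubset> j\<close> by (auto simp: I_def J_def)
    then show ?thesis using h[OF that(1)] by (meson le_less_trans)
  qed
  have gg: "g i \<sqsubset> g j \<longleftrightarrow> i \<sqsubset> j" if "i \<in> K" "j \<in> K" for i j
    using g(2) that by (metis less_asym neqE)
  have hh: "h i \<sqsubset> h j \<longleftrightarrow> i \<sqsubset> j" if "i \<in> K" "j \<in> K" for i j
    using h hg that by (metis less_asym neqE less_le_trans)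
  have hg': "h i \<sqsubset> g j \<longleftrightarrow> i \<sqsubset> j" if "i \<in> K" "j \<in> K" for i j
    using h hg gg that by (metis le_less_trans)
  define f where "f x = (case x of VA i \<Rightarrow> VA (g i) | VB i \<Rightarrow> VB (h i) | VC \<Rightarrow> VC | VD \<Rightarrow> VD)" for x
  have fs [simp]: "f (VA i) = VA (g i)" "f (VB i) = VB (h i)" "f VC = VC" "f VD = VD" for i
    by (simp_all add: f_def)
  have ginj: "g i = g j \<longleftrightarrow> i = j" "h i = h j \<longleftrightarrow> i = j" if "i \<in> K" "j \<in> K" for i j
    using gg[OF that] gg[OF that(2,1)] hh[OF that] hh[OF that(2,1)] by (metis neqE less_irrefl)+
  show ?thesis
  proof (intro exI conjI ballI impI)
    show "inj_on f (vset K E)"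
    proof (rule inj_onI)
      fix x y assume "x \<in> vset K E" "y \<in> vset K E" "f x = f y"
      then show "x = y" using E by (cases x; cases y) (auto simp: vset_def ginj)
    qed
    show "f ` vset K E \<subseteq> X"
    proof (rule image_subsetI)
      fix x assume "x \<in> vset K E"
      then show "f x \<in> X" using E g(1) h by (cases x) (auto simp: vset_def I_def J_def)
    qed
    show "row (f x) = row x" for x by (cases x) auto
    fix x y assume "x \<in> vset K E" "y \<in> vset K E" "x \<noteq> y"
    then show "before ls (f x) (f y) = before ls x y"
      using E(1) by (cases x; cases y) (auto simp: vset_def gg hh hg')
  qed
qed

lemma interval_auton:
  assumes "\<And>x y v. x \<in> S \<Longrightarrow> y \<in> S \<Longrightarrow> v \<in> X - S \<Longrightarrow> row x = row y \<and> before ls x v = before ls y v \<and> before ls v x = before ls v y"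
    "S \<subseteq> X"
  shows "auton (ori (before ls) T) X S"
  unfolding auton_def ori_def
proof (intro conjI ballI)
  fix v x y assume *: "v \<in> X - S" "x \<in> S" "y \<in> S"
  then have "v \<noteq> x" "v \<noteq> y" by auto
  then show "(v \<noteq> x \<and> (row v, row x, before ls v x) \<in> T) = (v \<noteq> y \<and> (row v, row y, before ls v y) \<in> T)"
    "(x \<noteq> v \<and> (row x, row v, before ls x v) \<in> T) = (y \<noteq> v \<and> (row y, row v, before ls y v) \<in> T)"
    using assms(1)[OF *(2,3,1)] by auto
qed (rule assms(2))

text \<open>If no vertex of the other row lies between two members of one row, the members of that
  row from the first to the second form an interval that nothing outside splits. It has two elements
  and is bounded, contradicting primality.\<close>

lemma alternating:
  assumes X: "X \<subseteq> vset K E" "|X| =o |K|" and E: "E \<subseteq> {VC, VD}"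
    and ind: "indec (ori (before ls) T) X"
  shows "VA i \<in> X \<Longrightarrow> VA j \<in> X \<Longrightarrow> i \<sqsubset> j \<Longrightarrow> \<exists>k. VB k \<in> X \<and> i \<sqsubseteq> k \<and> k \<sqsubset> j"
    and "VB i \<in> X \<Longrightarrow> VB j \<in> X \<Longrightarrow> i \<sqsubset> j \<Longrightarrow> \<exists>k. VA k \<in> X \<and> i \<sqsubset> k \<and> k \<sqsubseteq> j"
proof -
  have XK: "k \<in> K" if "VA k \<in> X \<or> VB k \<in> X" for k using X(1) E that by (auto simp: vset_def)
  \<comment> \<open>A bounded part of a single row has fewer than \<open>|K|\<close> elements and
    cannot be all of \<open>X\<close>.\<close>
  have ne: "S \<noteq> X" if "S \<subseteq> R ` {k\<in>K. k \<sqsubseteq> j}" "j \<in> K" for S j and R :: "'k \<Rightarrow> 'k vx"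
  proof -
    have "|S| \<le>o |R ` {k\<in>K. k \<sqsubseteq> j}|" using that(1) by (rule card_of_mono1)
    then have "|S| <o |K|"
      using small_le[OF that(2)] card_of_image ordLeq_transitive ordLeq_ordLess_trans by blast
    then show ?thesis using X(2) not_ordLess_ordIso by blast
  qed
  \<comment> \<open>The two facts differ at the ends because \<open>VA k\<close> precedes
    \<open>VB k\<close>: \<open>VB j\<close> is already later than a run of row \<open>VA\<close>
    ending at \<open>j\<close>, and \<open>VA i\<close> is already earlier than a run of row
    \<open>VB\<close> starting at \<open>i\<close>.\<close>
  have lo: "k \<sqsubset> a \<longleftrightarrow> k \<sqsubset> b" if "k \<sqsubset> i \<or> j \<sqsubseteq> k" "i \<sqsubseteq> a" "a \<sqsubseteq> j" "i \<sqsubseteq> b" "b \<sqsubseteq> j" for k a b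
    using that by (meson less_le_trans le_less_trans leD)
  have hi: "a \<sqsubset> k \<longleftrightarrow> b \<sqsubset> k" if "k \<sqsubseteq> i \<or> j \<sqsubset> k" "i \<sqsubseteq> a" "a \<sqsubseteq> j" "i \<sqsubseteq> b" "b \<sqsubseteq> j" for k a b
    using that by (meson less_le_trans le_less_trans leD)
  {
    assume ij: "VA i \<in> X" "VA j \<in> X" "i \<sqsubset> j"
    show "\<exists>k. VB k \<in> X \<and> i \<sqsubseteq> k \<and> k \<sqsubset> j"
    proof (rule ccontr)
      assume n: "\<not> ?thesis"
      let ?S = "X \<inter> VA ` {k. i \<sqsubseteq> k \<and> k \<sqsubseteq> j}"
      have "auton (ori (before ls) T) X ?S"
      proof (rule interval_auton)
        fix x y v assume "x \<in> ?S" "y \<in> ?S" "v \<in> X - ?S"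
        then obtain a b where ab: "x = VA a" "i \<sqsubseteq> a" "a \<sqsubseteq> j" "y = VA b" "i \<sqsubseteq> b" "b \<sqsubseteq> j"
          and v: "v \<in> X" "v \<notin> VA ` {k. i \<sqsubseteq> k \<and> k \<sqsubseteq> j}" by auto
        show "row x = row y \<and> before ls x v = before ls y v \<and> before ls v x = before ls v y"
        proof (cases v)
          case (VA k)
          then have "k \<sqsubset> i \<or> j \<sqsubset> k" using n v by (auto simp: image_iff not_le not_less)
          then have "k \<sqsubset> i \<or> j \<sqsubseteq> k" "k \<sqsubseteq> i \<or> j \<sqsubset> k" by (blast intro: less_imp_le)+
          then show ?thesis using lo[OF _ ab(2,3,5,6), of k] hi[OF _ ab(2,3,5,6), of k] VA ab(1,4) by simp
        next
          case (VB k)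
          then have "k \<sqsubset> i \<or> j \<sqsubseteq> k" using n v by (auto simp: image_iff not_le not_less)
          then show ?thesis using lo[OF _ ab(2,3,5,6), of k] VB ab(1,4) by simp
        qed (use ab in auto)
      qed simp
      moreover have "VA i \<in> ?S" "VA j \<in> ?S" "VA i \<noteq> VA j" using ij by auto
      ultimately have "?S = X" using indecD[OF ind] by blast
      moreover have "?S \<subseteq> VA ` {k\<in>K. k \<sqsubseteq> j}" using XK by auto
      ultimately show False using ne[of ?S VA j] XK ij by blast
    qed
  }
  {
    assume ij: "VB i \<in> X" "VB j \<in> X" "i \<sqsubset> j"
    show "\<exists>k. VA k \<in> X \<and> i \<sqsubset> k \<and> k \<sqsubseteq> j"
    proof (rule ccontr)
      assume n: "\<not> ?thesis"
      let ?S = "X \<inter> VB ` {k. i \<sqsubseteq> k \<and> k \<sqsubseteq> j}"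
      have "auton (ori (before ls) T) X ?S"
      proof (rule interval_auton)
        fix x y v assume "x \<in> ?S" "y \<in> ?S" "v \<in> X - ?S"
        then obtain a b where ab: "x = VB a" "i \<sqsubseteq> a" "a \<sqsubseteq> j" "y = VB b" "i \<sqsubseteq> b" "b \<sqsubseteq> j"
          and v: "v \<in> X" "v \<notin> VB ` {k. i \<sqsubseteq> k \<and> k \<sqsubseteq> j}" by auto
        show "row x = row y \<and> before ls x v = before ls y v \<and> before ls v x = before ls v y"
        proof (cases v)
          case (VA k)
          then have "k \<sqsubseteq> i \<or> j \<sqsubset> k" using n v by (auto simp: image_iff not_le not_less)
          then show ?thesis using hi[OF _ ab(2,3,5,6), of k] VA ab(1,4) by simp
        next
          case (VB k)
          then have "k \<sqsubset> i \<or> j \<sqsubset> k" using n v by (auto simp: image_iff not_le not_less)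
          then have "k \<sqsubset> i \<or> j \<sqsubseteq> k" "k \<sqsubseteq> i \<or> j \<sqsubset> k" by (blast intro: less_imp_le)+
          then show ?thesis using lo[OF _ ab(2,3,5,6), of k] hi[OF _ ab(2,3,5,6), of k] VB ab(1,4) by simp
        qed (use ab in auto)
      qed simp
      moreover have "VB i \<in> ?S" "VB j \<in> ?S" "VB i \<noteq> VB j" using ij by auto
      ultimately have "?S = X" using indecD[OF ind] by blast
      moreover have "?S \<subseteq> VB ` {k\<in>K. k \<sqsubseteq> j}" using XK by auto
      ultimately show False using ne[of ?S VB j] XK ij by blast
    qed
  }
qed

text \<open>Alternation holds for every table; what depends on the table is only that a full-size
  indecomposable part cannot omit an extra point.\<close>

lemma self_embedding_half:
  assumes E: "E \<subseteq> {VC, VD}"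
    and EX: "\<And>X. X \<subseteq> vset K E \<Longrightarrow> |X| =o |K| \<Longrightarrow> indec (ori (before ls) T) X \<Longrightarrow> E \<subseteq> X"
  shows "self_embedding (ori (before ls) T) (vset K E)"
proof (rule self_embedding_oriI)
  fix X assume X: "X \<subseteq> vset K E" "|X| =o |vset K E|" "indec (ori (before ls) T) X"
  have "finite E" using E finite_subset by fastforce
  then have XK: "|X| =o |K|" using X(2) card_vset ordIso_transitive by blast
  show "\<exists>f. inj_on f (vset K E) \<and> f ` vset K E \<subseteq> X \<and> (\<forall>x\<in>vset K E. row (f x) = row x) \<and>
    (\<forall>x\<in>vset K E. \<forall>y\<in>vset K E. x \<noteq> y \<longrightarrow> before ls (f x) (f y) = before ls x y)"
    by (rule half_map[OF X(1) XK E EX[OF X(1) XK X(3)]]) (rule alternating[OF X(1) XK E X(3)]; assumption)+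
qed

section \<open>Initial and final segments of the order on the vertices\<close>

lemma before_trans: "before ls x y \<Longrightarrow> before ls y z \<Longrightarrow> before ls x z"
  by (cases x; cases y; cases z) (auto simp: not_less)

lemma before_asym: "before ls x y \<Longrightarrow> \<not> before ls y x"
  by (cases x; cases y) (auto simp: not_less)

lemma before_total: "x \<noteq> y \<Longrightarrow> before ls x y \<or> before ls y x"
  by (cases x; cases y) (auto simp: not_less)

text \<open>Cutting at the middle one of three points leaves an initial and a final segment, each
  with at least two points and missing another, hence nontrivial.\<close>

lemma obtain_chain3:
  assumes "infinite X"
  obtains x y z where "x \<in> X" "y \<in> X" "z \<in> X" "before ls x y" "before ls y z"
proof -
  obtain Y where "Y \<subseteq> X" "card Y = 3" using infinite_arbitrarily_large[OF assms] by blast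
  then obtain a b c where "a \<in> X" "b \<in> X" "c \<in> X" "a \<noteq> b" "a \<noteq> c" "b \<noteq> c" by (auto simp: card_3_iff)
  then show thesis using that before_total by metis
qed

text \<open>If a table is blind on the rows of \<open>X\<close>, all initial (final) segments of \<open>X\<close> are autonomous; this
  is why the extra points cannot be dropped.\<close>

definition prefix_blind :: "(row_tag \<times> row_tag \<times> bool) set \<Rightarrow> row_tag set \<Rightarrow> bool" where
  "prefix_blind T R \<longleftrightarrow> (\<forall>a\<in>R - {RC}. \<forall>a'\<in>R - {RC}. \<forall>b\<in>R - {RD}.
     ((a, b, True) \<in> T \<longleftrightarrow> (a', b, True) \<in> T) \<and> ((b, a, False) \<in> T \<longleftrightarrow> (b, a', False) \<in> T))"

definition suffix_blind :: "(row_tag \<times> row_tag \<times> bool) set \<Rightarrow> row_tag set \<Rightarrow> bool" where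
  "suffix_blind T R \<longleftrightarrow> (\<forall>a\<in>R - {RC}. \<forall>b\<in>R - {RD}. \<forall>b'\<in>R - {RD}.
     ((a, b, True) \<in> T \<longleftrightarrow> (a, b', True) \<in> T) \<and> ((b, a, False) \<in> T \<longleftrightarrow> (b', a, False) \<in> T))"

text \<open>\<open>VC\<close> is last and \<open>VD\<close> is first in the order. This is why rows
  of earlier points range over \<open>R - {RC}\<close> and rows of later points over
  \<open>R - {RD}\<close> in the two notions of blindness.\<close>

lemma ori_before:
  assumes "before ls x y"
  shows "ori (before ls) T x y \<longleftrightarrow> (row x, row y, True) \<in> T"
    and "ori (before ls) T y x \<longleftrightarrow> (row y, row x, False) \<in> T"
    and "row x \<noteq> RC" "row y \<noteq> RD"
  using assms before_asym[OF assms] by (auto simp: ori_def) (cases x; cases y; simp)+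

lemma not_prefix_blind:
  assumes "infinite X" "indec (ori (before ls) T) X"
  shows "\<not> prefix_blind T (row ` X)"
proof
  assume pb: "prefix_blind T (row ` X)"
  obtain x y z where xyz: "x \<in> X" "y \<in> X" "z \<in> X" "before ls x y" "before ls y z"
    using obtain_chain3[OF assms(1)] .
  let ?S = "{w\<in>X. w = y \<or> before ls w y}"
  have "auton (ori (before ls) T) X ?S"
    unfolding auton_def
  proof (intro conjI ballI)
    fix v p q assume v: "v \<in> X - ?S" and p: "p \<in> ?S" and q: "q \<in> ?S"
    have "before ls y v" using v before_total by blast
    then have b: "before ls p v" "before ls q v" using p q before_trans by blast+
    then show "ori (before ls) T v p = ori (before ls) T v q" "ori (before ls) T p v = ori (before ls) T q v"
      using v p q pb ori_before[OF b(1)] ori_before[OF b(2)] by (auto simp: prefix_blind_def)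
  qed simp
  then have "?S = X" using indecD[OF assms(2), of ?S x y] xyz before_asym by blast
  then have "z = y \<or> before ls z y" using xyz(3) by blast
  then show False using before_asym[OF xyz(5)] xyz(5) by blast
qed

lemma not_suffix_blind:
  assumes "infinite X" "indec (ori (before ls) T) X"
  shows "\<not> suffix_blind T (row ` X)"
proof
  assume pb: "suffix_blind T (row ` X)"
  obtain x y z where xyz: "x \<in> X" "y \<in> X" "z \<in> X" "before ls x y" "before ls y z"
    using obtain_chain3[OF assms(1)] .
  let ?S = "{w\<in>X. w = y \<or> before ls y w}"
  have "auton (ori (before ls) T) X ?S"
    unfolding auton_def
  proof (intro conjI ballI)
    fix v p q assume v: "v \<in> X - ?S" and p: "p \<in> ?S" and q: "q \<in> ?S"
    have "before ls v y" using v before_total by blast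
    then have b: "before ls v p" "before ls v q" using p q before_trans by blast+
    then show "ori (before ls) T v p = ori (before ls) T v q" "ori (before ls) T p v = ori (before ls) T q v"
      using v p q pb ori_before[OF b(1)] ori_before[OF b(2)] by (auto simp: suffix_blind_def)
  qed simp
  then have "?S = X" using indecD[OF assms(2), of ?S y z] xyz before_asym by blast
  then have "x = y \<or> before ls y x" using xyz(1) by blast
  then show False using before_asym[OF xyz(4)] xyz(4) by blast
qed

lemma blind_mono:
  "prefix_blind T R \<Longrightarrow> R' \<subseteq> R \<Longrightarrow> prefix_blind T R'" "suffix_blind T R \<Longrightarrow> R' \<subseteq> R \<Longrightarrow> suffix_blind T R'"
  unfolding prefix_blind_def suffix_blind_def by blast+

text \<open>A part omitting \<open>c\<close> uses only the remaining rows, and blindness passes to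
  fewer rows; then its segments would be autonomous.\<close>

lemma self_embedding_blind:
  assumes E: "E \<subseteq> {VC, VD}"
    and b: "\<And>c. c \<in> E \<Longrightarrow> prefix_blind T ({RA, RB} \<union> row ` (E - {c})) \<or> suffix_blind T ({RA, RB} \<union> row ` (E - {c}))"
  shows "self_embedding (ori (before ls) T) (vset K E)"
proof (rule self_embedding_half[OF E], rule subsetI, rule ccontr)
  fix X c assume X: "X \<subseteq> vset K E" "|X| =o |K|" "indec (ori (before ls) T) X" and c: "c \<in> E" "c \<notin> X"
  have "infinite X" using X(2) inf by (simp add: card_of_ordIso_finite)
  then have n: "\<not> prefix_blind T (row ` X)" "\<not> suffix_blind T (row ` X)"
    using X(3) by (rule not_prefix_blind, rule not_suffix_blind)
  have sub: "row ` X \<subseteq> {RA, RB} \<union> row ` (E - {c})"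
  proof (rule image_subsetI)
    fix x assume "x \<in> X"
    then have "x \<in> VA ` K \<union> VB ` K \<union> (E - {c})" using X(1) c by (auto simp: vset_def)
    then show "row x \<in> {RA, RB} \<union> row ` (E - {c})" by auto
  qed
  show False
    using n b[OF c(1)] blind_mono(1)[OF _ sub] blind_mono(2)[OF _ sub] by metis
qed

text \<open>Two vertices of one row whose partners are both absent are twins, so unpaired vertices
  are finite in number. The extra points are finite as well, so the pairs must account for the size
  of \<open>X\<close>.\<close>

lemma mate_pairs:
  assumes X: "X \<subseteq> vset K E" "|X| =o |K|" and E: "finite E" "E \<subseteq> {VC, VD}"
    and ind: "indec (ori mate T) X"
  shows "|{i. VA i \<in> X \<and> VB i \<in> X}| =o |K|"
proof (rule ccontr)
  define I where "I = {i. VA i \<in> X \<and> VB i \<in> X}"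
  define J where "J = {i. VA i \<in> X \<and> VB i \<notin> X}"
  define J' where "J' = {i. VB i \<in> X \<and> VA i \<notin> X}"
  have IK: "I \<subseteq> K" using X(1) E(2) by (auto simp: vset_def I_def)
  assume "\<not> |{i. VA i \<in> X \<and> VB i \<in> X}| =o |K|"
  then have I: "|I| <o |K|"
    using IK card_of_mono1 ordLeq_iff_ordLess_or_ordIso unfolding I_def by blast
  have infX: "infinite X" using X(2) inf by (simp add: card_of_ordIso_finite)
  have J: "finite J"
  proof (rule ccontr)
    assume J: "infinite J"
    then obtain i where i: "i \<in> J" by (metis ex_in_conv finite.emptyI)
    obtain j where j: "j \<in> J" "j \<noteq> i" using J by (metis finite.emptyI finite.insertI finite_subset insertI1 subsetI)
    have "auton (ori mate T) X {VA i, VA j}"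
      unfolding auton_def
    proof (intro conjI ballI)
      fix v x y assume *: "v \<in> X - {VA i, VA j}" "x \<in> {VA i, VA j}" "y \<in> {VA i, VA j}"
      have "row x = row y" "mate v x = mate v y" "mate x v = mate y v" "v \<noteq> x" "v \<noteq> y"
        using * i j by (cases v; auto simp: J_def)+
      then show "ori mate T v x = ori mate T v y" "ori mate T x v = ori mate T y v" by (auto simp: ori_def)
    qed (use i j in \<open>auto simp: J_def\<close>)
    then have "{VA i, VA j} = X" using indecD[OF ind] j(2) by blast
    then show False using infX by (metis finite.emptyI finite.insertI)
  qed
  have J': "finite J'"
  proof (rule ccontr)
    assume J: "infinite J'"
    then obtain i where i: "i \<in> J'" by (metis ex_in_conv finite.emptyI)
    obtain j where j: "j \<in> J'" "j \<noteq> i" using J by (metis finite.emptyI finite.insertI finite_subset insertI1 subsetI)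
    have "auton (ori mate T) X {VB i, VB j}"
      unfolding auton_def
    proof (intro conjI ballI)
      fix v x y assume *: "v \<in> X - {VB i, VB j}" "x \<in> {VB i, VB j}" "y \<in> {VB i, VB j}"
      have "row x = row y" "mate v x = mate v y" "mate x v = mate y v" "v \<noteq> x" "v \<noteq> y"
        using * i j by (cases v; auto simp: J'_def)+
      then show "ori mate T v x = ori mate T v y" "ori mate T x v = ori mate T y v" by (auto simp: ori_def)
    qed (use i j in \<open>auto simp: J'_def\<close>)
    then have "{VB i, VB j} = X" using indecD[OF ind] j(2) by blast
    then show False using infX by (metis finite.emptyI finite.insertI)
  qed
  have sub: "X \<subseteq> VA ` I \<union> VB ` I \<union> (VA ` J \<union> VB ` J' \<union> E)"
  proof
    fix x assume "x \<in> X"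
    then show "x \<in> VA ` I \<union> VB ` I \<union> (VA ` J \<union> VB ` J' \<union> E)"
      using X(1) by (cases x) (auto simp: vset_def I_def J_def J'_def)
  qed
  have "|VA ` I| <o |K|" "|VB ` I| <o |K|" using I card_of_image ordLeq_ordLess_trans by blast+
  moreover have "|VA ` J \<union> VB ` J' \<union> E| <o |K|" using J J' E(1) by (intro finite_less) simp
  ultimately have "|VA ` I \<union> VB ` I \<union> (VA ` J \<union> VB ` J' \<union> E)| <o |K|"
    using inf card_of_Un_ordLess_infinite by blast
  then have "|X| <o |K|" using sub card_of_mono1 ordLeq_ordLess_trans by blast
  then show False using X(2) not_ordLess_ordIso by blast
qed

text \<open>No order is involved, so any bijection onto the indices of complete pairs gives a copy.
  The condition on \<open>T\<close> says that non-partners cannot distinguish the two rows; if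
  \<open>VC\<close> were missing, every complete pair would be autonomous.\<close>

lemma self_embedding_mate:
  assumes E: "E \<subseteq> {VC}"
    and b: "E = {} \<or> (\<forall>a\<in>{RA, RB}. ((a, RA, False) \<in> T \<longleftrightarrow> (a, RB, False) \<in> T) \<and> ((RA, a, False) \<in> T \<longleftrightarrow> (RB, a, False) \<in> T))"
  shows "self_embedding (ori mate T) (vset K E)"
proof (rule self_embedding_oriI)
  fix X assume X: "X \<subseteq> vset K E" "|X| =o |vset K E|" "indec (ori mate T) X"
  have fE: "finite E" "E \<subseteq> {VC, VD}" using E finite_subset by fastforce+
  then have XK: "|X| =o |K|" using X(2) card_vset ordIso_transitive by blast
  have infX: "infinite X" using XK inf by (simp add: card_of_ordIso_finite)
  define I where "I = {i. VA i \<in> X \<and> VB i \<in> X}"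
  have I: "|K| =o |I|" using mate_pairs[OF X(1) XK fE X(3)] ordIso_symmetric I_def by blast
  then obtain g where g: "bij_betw g K I" using card_of_ordIso by blast
  have gI: "g i \<in> I" if "i \<in> K" for i using g that by (auto simp: bij_betw_def)
  have ginj: "g i = g j \<longleftrightarrow> i = j" if "i \<in> K" "j \<in> K" for i j
    using g that by (auto simp: bij_betw_def inj_on_eq_iff)
  have EX: "E \<subseteq> X"
  proof (rule subsetI, rule ccontr)
    fix c assume c: "c \<in> E" "c \<notin> X"
    \<comment> \<open>A member of \<open>X\<close> outside both rows could only be the omitted
      point, so the assumptions are contradictory and the conclusion is free.\<close>
    then have nE: "x = VA k \<or> x = VB k" if "x \<in> X" "\<And>k. x \<noteq> VA k \<and> x \<noteq> VB k" for x k
      using that X(1) E by (cases x) (auto simp: vset_def)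
    obtain i where i: "i \<in> I"
      using I inf by (metis card_of_ordIso_finite ex_in_conv finite.emptyI)
    have "auton (ori mate T) X {VA i, VB i}"
      unfolding auton_def
    proof (intro conjI ballI)
      fix v x y assume *: "v \<in> X - {VA i, VB i}" "x \<in> {VA i, VB i}" "y \<in> {VA i, VB i}"
      have "row v \<in> {RA, RB}" using * nE[of v] X(1) E c by (cases v) (auto simp: vset_def)
      moreover have "\<not> mate v x" "\<not> mate v y" "\<not> mate x v" "\<not> mate y v" "v \<noteq> x" "v \<noteq> y"
        using * by (cases v; auto)+
      moreover have "row x \<in> {RA, RB}" "row y \<in> {RA, RB}" using * by auto
      ultimately show "ori mate T v x = ori mate T v y" "ori mate T x v = ori mate T y v"
        using b c by (auto simp: ori_def)
    qed (use i in \<open>auto simp: I_def\<close>)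
    then have "{VA i, VB i} = X" using indecD[OF X(3), of _ "VA i" "VB i"] by blast
    then show False using infX by (metis finite.emptyI finite.insertI)
  qed
  define f where "f x = (case x of VA i \<Rightarrow> VA (g i) | VB i \<Rightarrow> VB (g i) | VC \<Rightarrow> VC | VD \<Rightarrow> VD)" for x
  have fs [simp]: "f (VA i) = VA (g i)" "f (VB i) = VB (g i)" "f VC = VC" "f VD = VD" for i
    by (simp_all add: f_def)
  show "\<exists>f. inj_on f (vset K E) \<and> f ` vset K E \<subseteq> X \<and> (\<forall>x\<in>vset K E. row (f x) = row x) \<and>
    (\<forall>x\<in>vset K E. \<forall>y\<in>vset K E. x \<noteq> y \<longrightarrow> mate (f x) (f y) = mate x y)"
  proof (intro exI conjI ballI impI)
    show "inj_on f (vset K E)"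
    proof (rule inj_onI)
      fix x y assume "x \<in> vset K E" "y \<in> vset K E" "f x = f y"
      then show "x = y" using E by (cases x; cases y) (auto simp: vset_def ginj)
    qed
    show "f ` vset K E \<subseteq> X"
    proof (rule image_subsetI)
      fix x assume "x \<in> vset K E"
      then show "f x \<in> X" using E EX gI by (cases x) (auto simp: vset_def I_def)
    qed
    show "row (f x) = row x" for x by (cases x) auto
    fix x y assume "x \<in> vset K E" "y \<in> vset K E" "x \<noteq> y"
    then show "mate (f x) (f y) = mate x y"
      using E(1) by (cases x; cases y) (auto simp: vset_def ginj)
  qed
qed

end

section \<open>The graphs and their transitive orientations\<close>

text \<open>With \<open>mate\<close>: the subdivided star, the complement of a perfect matching in a complete bipartite
  graph, and the thin spider (a clique with a pendant vertex at each of its points; its table is only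
  an encoding, as this graph has no transitive orientation). With \<open>before\<close>: \<open>T_half\<close> is the bipartite
  half graph. In \<open>T_hub\<close>, \<open>T_tail\<close> the row \<open>VB\<close> is made a clique; then all initial segments are autonomous
  until a vertex adjacent to exactly the row \<open>VA\<close>, or a pendant edge \<open>VC VD\<close> with \<open>VD\<close> adjacent to the
  row \<open>VB\<close>, is added. In the primed tables the row \<open>VA\<close> is the clique, and final segments play this role.
  The tables \<open>_co\<close> orient the complements.\<close>

definition "T_star = {(RC, RA, False), (RB, RA, True)}"
definition "T_crown = {(RA, RB, False)}"
definition "T_spider = {(RB, RB, False), (RA, RB, True)}"
definition "T_half = {(RA, RB, True)}"
definition "T_half_co = {(RA, RA, True), (RB, RB, True), (RB, RA, True)}"
definition "T_hub = {(RC, RA, False), (RB, RA, False), (RB, RB, False)}"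
definition "T_hub' = {(RC, RB, False), (RA, RB, True), (RA, RA, True)}"
definition "T_tail = {(RC, RD, False), (RB, RD, False), (RB, RA, False), (RB, RB, False)}"
definition "T_tail_co = {(RA, RD, False), (RA, RC, True), (RA, RB, False), (RA, RA, False), (RB, RC, True)}"
definition "T_tail' = {(RA, RA, True), (RA, RB, True), (RA, RC, True), (RD, RC, True)}"
definition "T_tail'_co = {(RB, RA, True), (RB, RC, True), (RB, RB, True), (RB, RD, False), (RA, RD, False)}"

lemmas T_defs = T_star_def T_crown_def T_spider_def T_half_def T_half_co_def T_hub_def T_hub'_def
  T_tail_def T_tail_co_def T_tail'_def T_tail'_co_def

lemmas adj = sym_of_def ori_def T_defs

text \<open>This is the growth rule of all primality proofs: a vertex that separates two members
  must itself be a member.\<close>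

lemma autonD: "auton R X S \<Longrightarrow> v \<in> X \<Longrightarrow> x \<in> S \<Longrightarrow> y \<in> S \<Longrightarrow> R v x \<Longrightarrow> \<not> R v y \<Longrightarrow> v \<in> S"
  unfolding auton_def by blast

section \<open>Primality of the eight graphs\<close>

context index_set
begin

lemma mem_vset [simp]: "VA i \<in> vset K E \<longleftrightarrow> i \<in> K \<or> VA i \<in> E" "VB i \<in> vset K E \<longleftrightarrow> i \<in> K \<or> VB i \<in> E"
  "VC \<in> vset K E \<longleftrightarrow> VC \<in> E" "VD \<in> vset K E \<longleftrightarrow> VD \<in> E"
  by (auto simp: vset_def)

lemma obtain_other:
  obtains k where "k \<in> K" "k \<noteq> i" "k \<noteq> j"
proof -
  have "infinite (K - {i, j})" using inf by simp
  then obtain k where "k \<in> K - {i, j}" by (metis ex_in_conv finite.emptyI)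
  then show thesis using that by blast
qed

text \<open>Two members of one row are separated by a vertex of the other, so \<open>S\<close> meets
  both rows. Then \<open>VA i\<close> attracts all later vertices of row \<open>VB\<close>; a
  sufficiently late one of these attracts any given vertex of row \<open>VA\<close>, and these
  attract their partners.\<close>

lemma indec_half: "indec (sym_of (ori (before ls) T_half)) (vset K {})" (is "indec ?g ?V")
proof (rule indecI)
  fix S x y assume S: "auton ?g ?V S" and xy: "x \<in> S" "y \<in> S" "x \<noteq> y"
  note cl = autonD[OF S]
  have V: "z \<in> ?V" if "z \<in> S" for z using S that by (auto simp: auton_def)
  have aa: "\<exists>i j. VA i \<in> S \<and> VB j \<in> S" if "VA i \<in> S" "VA j \<in> S" "i \<sqsubset> j" for i j
    using cl[of "VB i" "VA i" "VA j"] that V[OF that(1)] by (auto simp: adj)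
  have bb: "\<exists>i j. VA i \<in> S \<and> VB j \<in> S" if "VB i \<in> S" "VB j \<in> S" "i \<sqsubset> j" for i j
    using cl[of "VA j" "VB j" "VB i"] that V[OF that(2)] by (auto simp: adj)
  obtain i j where i: "VA i \<in> S" and j: "VB j \<in> S"
    using xy V[OF xy(1)] V[OF xy(2)] aa bb by (cases x; cases y) (auto, (metis neqE)+)
  have K: "i \<in> K" "j \<in> K" using V[OF i] V[OF j] by auto
  have b: "VB k \<in> S" if "k \<in> K" "i \<sqsubseteq> k" for k
    using cl[of "VB k" "VA i" "VB j"] that i j by (auto simp: adj not_less)
  have a: "VA k \<in> S" if "k \<in> K" for k
  proof -
    obtain m where "m \<in> K" "i \<sqsubset> m" "k \<sqsubset> m" using above2[OF K(1) \<open>k \<in> K\<close>] by blast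
    then show ?thesis using cl[of "VA k" "VB m" "VA i"] b[of m] i that by (auto simp: adj)
  qed
  have "VB k \<in> S" if "k \<in> K" for k
    using cl[of "VB k" "VA k" "VB j"] a[OF that] j that by (auto simp: adj)
  then show "?V \<subseteq> S" using a by (auto simp: vset_def)
qed

text \<open>Any two members lead to one vertex in each row. The hub separates them and so enters;
  next it attracts row \<open>VA\<close>, whose vertices attract their partners.\<close>

lemma indec_hub: "indec (sym_of (ori (before ls) T_hub)) (vset K {VC})" (is "indec ?g ?V")
proof (rule indecI)
  fix S x y assume S: "auton ?g ?V S" and xy: "x \<in> S" "y \<in> S" "x \<noteq> y"
  note cl = autonD[OF S]
  have V: "z \<in> ?V" if "z \<in> S" for z using S that by (auto simp: auton_def)
  let ?P = "\<exists>i j. VA i \<in> S \<and> VB j \<in> S"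
  have aa: ?P if "VA i \<in> S" "VA j \<in> S" "i \<sqsubset> j" for i j
    using cl[of "VB i" "VA i" "VA j"] that V[OF that(1)] by (auto simp: adj)
  have bb: ?P if "VB i \<in> S" "VB j \<in> S" "i \<sqsubset> j" for i j
    using cl[of "VA j" "VB j" "VB i"] that V[OF that(2)] by (auto simp: adj)
  have ca: ?P if "VC \<in> S" "VA i \<in> S" for i
    using cl[of "VB i" "VA i" VC] that V[OF that(2)] by (auto simp: adj)
  have cb: ?P if "VC \<in> S" "VB j \<in> S" for j
  proof -
    \<comment> \<open>An index beyond \<open>j\<close> is needed: \<open>VA k\<close> sees the hub
      always, but \<open>VB j\<close> only when \<open>k\<close> is at most
      \<open>j\<close>.\<close>
    obtain k where "k \<in> K" "j \<sqsubset> k" using no_max V[OF \<open>VB j \<in> S\<close>] by auto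
    then show ?thesis using cl[of "VA k" VC "VB j"] that by (auto simp: adj)
  qed
  obtain i j where i: "VA i \<in> S" and j: "VB j \<in> S"
    using xy V[OF xy(1)] V[OF xy(2)] aa bb ca cb by (cases x; cases y) (auto, (metis neqE)+)
  have c: "VC \<in> S" using cl[of VC "VA i" "VB j"] i j by (auto simp: adj)
  have a: "VA k \<in> S" if "k \<in> K" for k
    using cl[of "VA k" VC "VA i"] c i that by (cases "k = i") (auto simp: adj)
  have "VB k \<in> S" if "k \<in> K" for k
    using cl[of "VB k" "VA k" VC] a[OF that] c that by (auto simp: adj)
  then show "?V \<subseteq> S" using a c by (auto simp: vset_def)
qed

lemma indec_hub': "indec (sym_of (ori (before ls) T_hub')) (vset K {VC})" (is "indec ?g ?V")
proof (rule indecI)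
  fix S x y assume S: "auton ?g ?V S" and xy: "x \<in> S" "y \<in> S" "x \<noteq> y"
  note cl = autonD[OF S]
  have V: "z \<in> ?V" if "z \<in> S" for z using S that by (auto simp: auton_def)
  let ?P = "\<exists>i j. VA i \<in> S \<and> VB j \<in> S"
  have aa: ?P if "VA i \<in> S" "VA j \<in> S" "i \<sqsubset> j" for i j
    using cl[of "VB i" "VA i" "VA j"] that V[OF that(1)] by (auto simp: adj)
  have bb: ?P if "VB i \<in> S" "VB j \<in> S" "i \<sqsubset> j" for i j
    using cl[of "VA j" "VB j" "VB i"] that V[OF that(2)] by (auto simp: adj)
  have ca: ?P if "VC \<in> S" "VA i \<in> S" for i
  proof -
    obtain k where "k \<in> K" "i \<sqsubset> k" using no_max V[OF \<open>VA i \<in> S\<close>] by auto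
    then show ?thesis using cl[of "VA k" "VA i" VC] that aa[of i k] by (auto simp: adj)
  qed
  have cb: ?P if "VC \<in> S" "VB j \<in> S" for j
    using cl[of "VA j" "VB j" VC] that V[OF that(2)] by (auto simp: adj)
  obtain i j where i: "VA i \<in> S" and j: "VB j \<in> S"
    using xy V[OF xy(1)] V[OF xy(2)] aa bb ca cb by (cases x; cases y) (auto, (metis neqE)+)
  have c: "VC \<in> S" using cl[of VC "VB j" "VA i"] i j by (auto simp: adj)
  have a: "VA k \<in> S" if "k \<in> K" for k
    using cl[of "VA k" "VA i" VC] c i that by (cases "k = i") (auto simp: adj neq_iff)
  have "VB k \<in> S" if "k \<in> K" for k
  proof -
    \<comment> \<open>\<open>VB k\<close> sees the hub but no vertex of row \<open>VA\<close> with a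
      larger index.\<close>
    obtain m where "m \<in> K" "k \<sqsubset> m" using no_max \<open>k \<in> K\<close> by blast
    then show ?thesis using cl[of "VB k" VC "VA m"] a[of m] c that by (auto simp: adj)
  qed
  then show "?V \<subseteq> S" using a c by (auto simp: vset_def)
qed

text \<open>A mixed pair is separated by \<open>VD\<close>, and \<open>VD\<close> is separated from
  row \<open>VA\<close> by its pendant neighbour \<open>VC\<close>. With both extra points inside,
  row \<open>VB\<close> follows because it sees \<open>VD\<close> and not \<open>VC\<close>, and
  then row \<open>VA\<close>.\<close>

lemma indec_tail: "indec (sym_of (ori (before ls) T_tail)) (vset K {VC, VD})" (is "indec ?g ?V")
proof (rule indecI)
  fix S x y assume S: "auton ?g ?V S" and xy: "x \<in> S" "y \<in> S" "x \<noteq> y"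
  note cl = autonD[OF S]
  have V: "z \<in> ?V" if "z \<in> S" for z using S that by (auto simp: auton_def)
  let ?P = "\<exists>i j. VA i \<in> S \<and> VB j \<in> S"
  have aa: ?P if "VA i \<in> S" "VA j \<in> S" "i \<sqsubset> j" for i j
    using cl[of "VB i" "VA i" "VA j"] that V[OF that(1)] by (auto simp: adj)
  have bb: ?P if "VB i \<in> S" "VB j \<in> S" "i \<sqsubset> j" for i j
    using cl[of "VA j" "VB j" "VB i"] that V[OF that(2)] by (auto simp: adj)
  have ca: ?P if "VC \<in> S" "VA i \<in> S" for i
    using cl[of "VB i" "VA i" VC] that V[OF that(2)] by (auto simp: adj)
  have cb: ?P if "VC \<in> S" "VB j \<in> S" for j
    using cl[of "VA j" "VB j" VC] that V[OF that(2)] by (auto simp: adj)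
  have da: ?P if "VD \<in> S" "VA i \<in> S" for i
    using cl[of VC VD "VA i"] that ca by (auto simp: adj)
  have db: ?P if "VD \<in> S" "VB i \<in> S" for i
    using cl[of VC VD "VB i"] that cb by (auto simp: adj)
  have cd: ?P if "VC \<in> S" "VD \<in> S"
  proof -
    obtain k where "k \<in> K" using obtain_other .
    then show ?thesis using cl[of "VB k" VD VC] that cb by (auto simp: adj)
  qed
  obtain i j where i: "VA i \<in> S" and j: "VB j \<in> S"
    using xy V[OF xy(1)] V[OF xy(2)] aa bb ca cb da db cd by (cases x; cases y) (auto, (metis neqE)+)
  have d: "VD \<in> S" using cl[of VD "VB j" "VA i"] i j by (auto simp: adj)
  have c: "VC \<in> S" using cl[of VC VD "VA i"] i d by (auto simp: adj)
  have b: "VB k \<in> S" if "k \<in> K" for k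
    using cl[of "VB k" VD VC] c d that by (auto simp: adj)
  have "VA k \<in> S" if "k \<in> K" for k
    using cl[of "VA k" "VB k" VC] b[OF that] c that by (auto simp: adj)
  then show "?V \<subseteq> S" using b c d by (auto simp: vset_def)
qed

text \<open>The same growth as for \<open>indec_tail\<close> with the rows exchanged and the extra
  points exchanged: here \<open>VD\<close> is the pendant vertex.\<close>

lemma indec_tail': "indec (sym_of (ori (before ls) T_tail')) (vset K {VC, VD})" (is "indec ?g ?V")
proof (rule indecI)
  fix S x y assume S: "auton ?g ?V S" and xy: "x \<in> S" "y \<in> S" "x \<noteq> y"
  note cl = autonD[OF S]
  have V: "z \<in> ?V" if "z \<in> S" for z using S that by (auto simp: auton_def)
  let ?P = "\<exists>i j. VA i \<in> S \<and> VB j \<in> S"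
  have aa: ?P if "VA i \<in> S" "VA j \<in> S" "i \<sqsubset> j" for i j
    using cl[of "VB i" "VA i" "VA j"] that V[OF that(1)] by (auto simp: adj)
  have bb: ?P if "VB i \<in> S" "VB j \<in> S" "i \<sqsubset> j" for i j
    using cl[of "VA j" "VB j" "VB i"] that V[OF that(2)] by (auto simp: adj)
  have da: ?P if "VD \<in> S" "VA i \<in> S" for i
    using cl[of "VB i" "VA i" VD] that V[OF that(2)] by (auto simp: adj)
  have db: ?P if "VD \<in> S" "VB i \<in> S" for i
    using cl[of "VA i" "VB i" VD] that V[OF that(2)] by (auto simp: adj)
  have ca: ?P if "VC \<in> S" "VA i \<in> S" for i
    using cl[of VD VC "VA i"] that da by (auto simp: adj)
  have cb: ?P if "VC \<in> S" "VB i \<in> S" for i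
    using cl[of VD VC "VB i"] that db by (auto simp: adj)
  have cd: ?P if "VC \<in> S" "VD \<in> S"
  proof -
    obtain k where "k \<in> K" using obtain_other .
    then show ?thesis using cl[of "VA k" VC VD] that da by (auto simp: adj)
  qed
  obtain i j where i: "VA i \<in> S" and j: "VB j \<in> S"
    using xy V[OF xy(1)] V[OF xy(2)] aa bb ca cb da db cd by (cases x; cases y) (auto, (metis neqE)+)
  have c: "VC \<in> S" using cl[of VC "VA i" "VB j"] i j by (auto simp: adj)
  have d: "VD \<in> S" using cl[of VD VC "VA i"] i c by (auto simp: adj)
  have a: "VA k \<in> S" if "k \<in> K" for k
    using cl[of "VA k" VC VD] c d that by (auto simp: adj)
  have "VB k \<in> S" if "k \<in> K" for k
    using cl[of "VB k" "VA k" VD] a[OF that] d that by (auto simp: adj)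
  then show "?V \<subseteq> S" using a c d by (auto simp: vset_def)
qed

text \<open>Everything leads to the centre \<open>VC\<close> together with one of its neighbours;
  from there all neighbours and then all leaves are attracted.\<close>

lemma indec_star: "indec (sym_of (ori mate T_star)) (vset K {VC})" (is "indec ?g ?V")
proof (rule indecI)
  fix S x y assume S: "auton ?g ?V S" and xy: "x \<in> S" "y \<in> S" "x \<noteq> y"
  note cl = autonD[OF S]
  have V: "z \<in> ?V" if "z \<in> S" for z using S that by (auto simp: auton_def)
  let ?P = "\<exists>i. VA i \<in> S \<and> VC \<in> S"
  have ab: ?P if "VA i \<in> S" "VB j \<in> S" for i j
    using cl[of VC "VA i" "VB j"] that by (auto simp: adj)
  have aa: ?P if "VA i \<in> S" "VA j \<in> S" "i \<noteq> j" for i j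
    using cl[of "VB i" "VA i" "VA j"] that V[OF that(1)] ab by (auto simp: adj)
  have bb: ?P if "VB i \<in> S" "VB j \<in> S" "i \<noteq> j" for i j
    using cl[of "VA i" "VB i" "VB j"] that V[OF that(1)] ab by (auto simp: adj)
  have cb: ?P if "VC \<in> S" "VB j \<in> S" for j
  proof -
    obtain k where "k \<in> K" "k \<noteq> j" using obtain_other .
    then show ?thesis using cl[of "VA k" VC "VB j"] that by (auto simp: adj)
  qed
  obtain i where i: "VA i \<in> S" and c: "VC \<in> S"
    using xy V[OF xy(1)] V[OF xy(2)] aa bb ab cb by (cases x; cases y) auto
  have a: "VA k \<in> S" if "k \<in> K" for k
    using cl[of "VA k" VC "VA i"] c i that by (cases "k = i") (auto simp: adj)
  have "VB k \<in> S" if "k \<in> K" for k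
    using cl[of "VB k" "VA k" VC] a[OF that] c that by (auto simp: adj)
  then show "?V \<subseteq> S" using a c by (auto simp: vset_def)
qed

lemma indec_crown: "indec (sym_of (ori mate T_crown)) (vset K {})" (is "indec ?g ?V")
proof (rule indecI)
  fix S x y assume S: "auton ?g ?V S" and xy: "x \<in> S" "y \<in> S" "x \<noteq> y"
  note cl = autonD[OF S]
  have V: "z \<in> ?V" if "z \<in> S" for z using S that by (auto simp: auton_def)
  have aa: "\<exists>i j. VA i \<in> S \<and> VB j \<in> S" if "VA i \<in> S" "VA j \<in> S" "i \<noteq> j" for i j
    using cl[of "VB j" "VA i" "VA j"] that V[OF that(2)] by (auto simp: adj)
  have bb: "\<exists>i j. VA i \<in> S \<and> VB j \<in> S" if "VB i \<in> S" "VB j \<in> S" "i \<noteq> j" for i j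
    using cl[of "VA j" "VB i" "VB j"] that V[OF that(2)] by (auto simp: adj)
  obtain i j where i: "VA i \<in> S" and j: "VB j \<in> S"
    using xy V[OF xy(1)] V[OF xy(2)] aa bb by (cases x; cases y) (auto, blast+)
  have b: "VB k \<in> S" if "k \<in> K" "k \<noteq> i" for k
    using cl[of "VB k" "VA i" "VB j"] that i j by (auto simp: adj)
  have a: "VA k \<in> S" if "k \<in> K" for k
  proof -
    \<comment> \<open>A third index avoids both missing matching edges: \<open>VB m\<close> is
      already in \<open>S\<close> and sees \<open>VA k\<close>.\<close>
    obtain m where "m \<in> K" "m \<noteq> i" "m \<noteq> k" using obtain_other .
    then show ?thesis using cl[of "VA k" "VB m" "VA i"] b[of m] i that by (auto simp: adj)
  qed
  have "VB k \<in> S" if "k \<in> K" for k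
  proof -
    obtain m where "m \<in> K" "m \<noteq> k" using obtain_other .
    then show ?thesis using cl[of "VB k" "VA m" "VB j"] a[of m] j that by (auto simp: adj)
  qed
  then show "?V \<subseteq> S" using a by (auto simp: vset_def)
qed

lemma indec_spider: "indec (sym_of (ori mate T_spider)) (vset K {})" (is "indec ?g ?V")
proof (rule indecI)
  fix S x y assume S: "auton ?g ?V S" and xy: "x \<in> S" "y \<in> S" "x \<noteq> y"
  note cl = autonD[OF S]
  have V: "z \<in> ?V" if "z \<in> S" for z using S that by (auto simp: auton_def)
  have aa: "\<exists>i j. VA i \<in> S \<and> VB j \<in> S" if "VA i \<in> S" "VA j \<in> S" "i \<noteq> j" for i j
    using cl[of "VB i" "VA i" "VA j"] that V[OF that(1)] by (auto simp: adj)
  have bb: "\<exists>i j. VA i \<in> S \<and> VB j \<in> S" if "VB i \<in> S" "VB j \<in> S" "i \<noteq> j" for i j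
    using cl[of "VA i" "VB i" "VB j"] that V[OF that(1)] by (auto simp: adj)
  obtain i j where i: "VA i \<in> S" and j: "VB j \<in> S"
    using xy V[OF xy(1)] V[OF xy(2)] aa bb by (cases x; cases y) (auto, blast+)
  have b: "VB k \<in> S" if "k \<in> K" "k \<noteq> i" for k
    using cl[of "VB k" "VB j" "VA i"] that i j by (cases "k = j") (auto simp: adj)
  have a: "VA k \<in> S" if "k \<in> K" for k
    using cl[of "VA k" "VB k" "VA i"] b[of k] i that by (cases "k = i") (auto simp: adj)
  \<comment> \<open>\<open>VB i\<close> is the only vertex still missing; it separates the members
    \<open>VB k\<close> and \<open>VA k\<close> of another pair.\<close>
  obtain k where k: "k \<in> K" "k \<noteq> i" using obtain_other .
  have "VB i \<in> S"
    using cl[of "VB i" "VB k" "VA k"] b[of k] a[of k] k V[OF i] by (auto simp: adj)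
  then have "VB k \<in> S" if "k \<in> K" for k using b that by blast
  then show "?V \<subseteq> S" using a by (auto simp: vset_def)
qed

section \<open>Self-embeddings of all eleven relations\<close>

lemmas blind_simps = prefix_blind_def suffix_blind_def T_defs

text \<open>For the half graph and its complement there is no extra point and the condition is void.
  For a tail, omitting either one of the two extra points already makes the table blind.\<close>

lemma self_embeddings:
  "self_embedding (ori mate T_star) (vset K {VC})"
  "self_embedding (ori mate T_crown) (vset K {})"
  "self_embedding (ori mate T_spider) (vset K {})"
  "self_embedding (ori (before ls) T_half) (vset K {})"
  "self_embedding (ori (before ls) T_half_co) (vset K {})"
  "self_embedding (ori (before ls) T_hub) (vset K {VC})"
  "self_embedding (ori (before ls) T_hub') (vset K {VC})"
  "self_embedding (ori (before ls) T_tail) (vset K {VC, VD})"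
  "self_embedding (ori (before ls) T_tail_co) (vset K {VC, VD})"
  "self_embedding (ori (before ls) T_tail') (vset K {VC, VD})"
  "self_embedding (ori (before ls) T_tail'_co) (vset K {VC, VD})"
  by (rule self_embedding_mate self_embedding_blind;
      force simp: blind_simps insert_Diff_if split: if_splits)+

text \<open>The restriction to \<open>E = {}\<close> matters: the table gives \<open>VC\<close> and
  \<open>VD\<close> no neighbours, whereas the complement joins them to all vertices of the
  rows.\<close>

lemma sym_of_half_co:
  "x \<in> vset K E \<Longrightarrow> y \<in> vset K E \<Longrightarrow> E = {} \<Longrightarrow> sym_of (ori (before ls) T_half_co) x y = co_of (ori (before ls) T_half) x y"
  by (cases x; cases y) (auto simp: adj co_of_def not_less)

lemma sym_of_tail_co: "sym_of (ori (before ls) T_tail_co) x y = co_of (ori (before ls) T_tail) x y"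
  by (cases x; cases y) (auto simp: adj co_of_def not_less)

lemma sym_of_tail'_co: "sym_of (ori (before ls) T_tail'_co) x y = co_of (ori (before ls) T_tail') x y"
  by (cases x; cases y) (auto simp: adj co_of_def not_less)

end

lemma sym_of_idem [simp]:
  "sym_of (sym_of R) = sym_of R" "sym_of (co_of R) = co_of R" "sym_of (po_of R) = sym_of R" "sym_of (od_of R) = sym_of R"
  by (auto simp: fun_eq_iff sym_of_def co_of_def po_of_def od_of_def)

lemma sym_of_commute: "sym_of R x y = sym_of R y x"
  and co_of_commute: "co_of R x y = co_of R y x"
  and sym_of_irrefl: "\<not> sym_of R x x"
  and co_of_irrefl: "\<not> co_of R x x"
  by (auto simp: sym_of_def co_of_def)

lemma emb_sym_of: "emb R V Q W \<Longrightarrow> emb (sym_of R) V (sym_of Q) W"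
  unfolding emb_def by (elim exE, rule exI) (auto simp: sym_of_def inj_on_eq_iff)

lemma emb_co_of_iff: "emb (co_of R) V (co_of Q) W \<longleftrightarrow> emb (sym_of R) V (sym_of Q) W"
  unfolding emb_def by (intro ex_cong1 conj_cong refl ball_cong) (auto simp: sym_of_def co_of_def inj_on_eq_iff)

section \<open>Monotone features\<close>

datatype shape = Triangle | Square | Claw | Path_Dot | Threshold

text \<open>Only \<open>sym_of\<close> and \<open>co_of\<close> of these relations are used, so one
  direction per edge suffices and the diagonal is harmless. In \<open>Threshold\<close> an even
  vertex sees all later vertices and an odd vertex sees none of them.\<close>

fun edges :: "shape \<Rightarrow> nat \<Rightarrow> nat \<Rightarrow> bool" where
  "edges Triangle i j = True"
| "edges Square i j = ((i, j) \<in> {(0, 1), (1, 2), (2, 3), (3, 0)})"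
| "edges Claw i j = (i = 0)"
| "edges Path_Dot i j = (i < 3 \<and> j = Suc i)"
| "edges Threshold i j = (i < j \<and> even i)"

fun nodes :: "shape \<Rightarrow> nat set" where
  "nodes Triangle = {..<3}"
| "nodes Square = {..<4}"
| "nodes Claw = {..<4}"
| "nodes Path_Dot = {..<5}"
| "nodes Threshold = UNIV"

datatype feature = Has shape | Has_Co shape | Three_Above | Ascending | Half_Up

text \<open>Shapes are looked for in \<open>sym_of R\<close>, so they take the same value on a graph
  and on any order orienting it. The last three patterns are reflexive and are meant for orders;
  \<open>Half_Up\<close> is the half graph with its even points as minimal elements.\<close>

fun holds :: "feature \<Rightarrow> ('a \<Rightarrow> 'a \<Rightarrow> bool) \<Rightarrow> 'a set \<Rightarrow> bool" where
  "holds (Has s) R V = emb (sym_of R) V (sym_of (edges s)) (nodes s)"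
| "holds (Has_Co s) R V = emb (sym_of R) V (co_of (edges s)) (nodes s)"
| "holds Three_Above R V = emb R V (\<lambda>i j. i = j \<or> i = 0) {..<4::nat}"
| "holds Ascending R V = emb R V ((\<le>) :: nat \<Rightarrow> nat \<Rightarrow> bool) UNIV"
| "holds Half_Up R V = emb R V (\<lambda>i j :: nat. i = j \<or> even i \<and> odd j \<and> i < j) UNIV"

lemma holds_mono: "emb R V Q W \<Longrightarrow> holds p Q W \<Longrightarrow> holds p R V"
  by (cases p) (auto intro: emb_trans emb_sym_of)

type_synonym profile = "(feature \<times> bool) list"

text \<open>A profile prescribes the presence (\<open>True\<close>) or absence (\<open>False\<close>) of some features.\<close>

definition has_profile :: "profile \<Rightarrow> ('a \<Rightarrow> 'a \<Rightarrow> bool) \<Rightarrow> 'a set \<Rightarrow> bool" where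
  "has_profile ps R V \<longleftrightarrow> (\<forall>(p, b)\<in>set ps. holds p R V = b)"

lemma has_profile_Nil [simp]: "has_profile [] R V"
  and has_profile_Cons [simp]: "has_profile ((p, b) # ps) R V \<longleftrightarrow> holds p R V = b \<and> has_profile ps R V"
  and has_profile_append [simp]: "has_profile (ps @ qs) R V \<longleftrightarrow> has_profile ps R V \<and> has_profile qs R V"
  by (auto simp: has_profile_def)

section \<open>Small induced patterns with explicit vertices\<close>

lemma emb_listI:
  assumes "\<And>x y. R x y = R y x" "\<And>x. \<not> R x x" "\<And>x y. Q x y = Q y x" "\<And>x. \<not> Q x x"
    "set xs \<subseteq> V" "distinct xs" "\<And>j. j < length xs \<Longrightarrow> \<forall>i<j. R (xs ! i) (xs ! j) = Q i j"
  shows "emb R V Q {..<length xs}"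
  unfolding emb_def
proof (intro exI conjI ballI)
  show "inj_on ((!) xs) {..<length xs}" using assms(6) by (simp add: inj_on_nth)
  show "(!) xs ` {..<length xs} \<subseteq> V" using assms(5) by auto
  fix i j assume "i \<in> {..<length xs}" "j \<in> {..<length xs}"
  then show "Q i j = R (xs ! i) (xs ! j)"
    using assms(1,3) assms(2,4,7) by (cases i j rule: linorder_cases) (auto, metis+)
qed

lemma emb_fin3I:
  assumes "\<And>x y. R x y = R y x" "\<And>x. \<not> R x x" "\<And>x y. Q x y = Q y x" "\<And>x. \<not> Q x x"
    "a \<in> V" "b \<in> V" "c \<in> V" "a \<noteq> b" "a \<noteq> c" "b \<noteq> c"
    "R a b = Q 0 1" "R a c = Q 0 2" "R b c = Q 1 2"
  shows "emb R V Q {..<3::nat}"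
proof -
  have c: "\<forall>j<3. \<forall>i<j. R ([a, b, c] ! i) ([a, b, c] ! j) = Q i j"
    using assms(11-) by (simp add: All_less_Suc eval_nat_numeral)
  have d: "distinct [a, b, c]" "set [a, b, c] \<subseteq> V" using assms(5-10) by simp_all
  have "emb R V Q {..<length [a, b, c]}"
    by (rule emb_listI[OF assms(1-4) d(2,1)]) (use c in simp)
  then show ?thesis by (simp add: eval_nat_numeral)
qed

lemma emb_fin4I:
  assumes "\<And>x y. R x y = R y x" "\<And>x. \<not> R x x" "\<And>x y. Q x y = Q y x" "\<And>x. \<not> Q x x"
    "a \<in> V" "b \<in> V" "c \<in> V" "d \<in> V" "distinct [a, b, c, d]"
    "R a b = Q 0 1" "R a c = Q 0 2" "R a d = Q 0 3" "R b c = Q 1 2" "R b d = Q 1 3" "R c d = Q 2 3"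
  shows "emb R V Q {..<4::nat}"
proof -
  have c: "\<forall>j<4. \<forall>i<j. R ([a, b, c, d] ! i) ([a, b, c, d] ! j) = Q i j"
    using assms(10-) by (simp add: All_less_Suc eval_nat_numeral)
  have d: "distinct [a, b, c, d]" "set [a, b, c, d] \<subseteq> V" using assms(5-9) by simp_all
  have "emb R V Q {..<length [a, b, c, d]}"
    by (rule emb_listI[OF assms(1-4) d(2,1)]) (use c in simp)
  then show ?thesis by (simp add: eval_nat_numeral)
qed

lemma emb_fin5I:
  assumes "\<And>x y. R x y = R y x" "\<And>x. \<not> R x x" "\<And>x y. Q x y = Q y x" "\<And>x. \<not> Q x x"
    "a \<in> V" "b \<in> V" "c \<in> V" "d \<in> V" "e \<in> V" "distinct [a, b, c, d, e]"
    "R a b = Q 0 1" "R a c = Q 0 2" "R a d = Q 0 3" "R a e = Q 0 4" "R b c = Q 1 2" "R b d = Q 1 3" "R b e = Q 1 4"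
    "R c d = Q 2 3" "R c e = Q 2 4" "R d e = Q 3 4"
  shows "emb R V Q {..<5::nat}"
proof -
  have c: "\<forall>j<5. \<forall>i<j. R ([a, b, c, d, e] ! i) ([a, b, c, d, e] ! j) = Q i j"
    using assms(11-) by (simp add: All_less_Suc eval_nat_numeral)
  have d: "distinct [a, b, c, d, e]" "set [a, b, c, d, e] \<subseteq> V" using assms(5-10) by simp_all
  have "emb R V Q {..<length [a, b, c, d, e]}"
    by (rule emb_listI[OF assms(1-4) d(2,1)]) (use c in simp)
  then show ?thesis by (simp add: eval_nat_numeral)
qed

lemma emb_fin3E:
  assumes "emb R V Q {..<3::nat}"
  obtains a b c where "a \<in> V" "b \<in> V" "c \<in> V" "a \<noteq> b" "a \<noteq> c" "b \<noteq> c"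
    "R a b = Q 0 1" "R a c = Q 0 2" "R b c = Q 1 2"
proof -
  obtain f where f: "inj_on f {..<3::nat}" "f ` {..<3} \<subseteq> V" "\<And>i j. i < 3 \<Longrightarrow> j < 3 \<Longrightarrow> Q i j = R (f i) (f j)"
    using assms by (auto simp: emb_def)
  show thesis by (rule that[of "f 0" "f 1" "f 2"]) (use f in \<open>auto simp: inj_on_eq_iff\<close>)
qed

lemma emb_fin4E:
  assumes "emb R V Q {..<4::nat}"
  obtains a b c d where "a \<in> V" "b \<in> V" "c \<in> V" "d \<in> V" "a \<noteq> b" "a \<noteq> c" "a \<noteq> d" "b \<noteq> c" "b \<noteq> d" "c \<noteq> d"
    "R a b = Q 0 1" "R a c = Q 0 2" "R a d = Q 0 3" "R b c = Q 1 2" "R b d = Q 1 3" "R c d = Q 2 3"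
proof -
  obtain f where f: "inj_on f {..<4::nat}" "f ` {..<4} \<subseteq> V" "\<And>i j. i < 4 \<Longrightarrow> j < 4 \<Longrightarrow> Q i j = R (f i) (f j)"
    using assms by (auto simp: emb_def)
  show thesis by (rule that[of "f 0" "f 1" "f 2" "f 3"]) (use f in \<open>auto simp: inj_on_eq_iff\<close>)
qed

lemma emb_fin5E:
  assumes "emb R V Q {..<5::nat}"
  obtains a b c d e where "a \<in> V" "b \<in> V" "c \<in> V" "d \<in> V" "e \<in> V"
    "a \<noteq> b" "a \<noteq> c" "a \<noteq> d" "b \<noteq> c" "b \<noteq> d" "c \<noteq> d" "a \<noteq> e" "b \<noteq> e" "c \<noteq> e" "d \<noteq> e"
    "R a b = Q 0 1" "R a c = Q 0 2" "R a d = Q 0 3" "R a e = Q 0 4" "R b c = Q 1 2" "R b d = Q 1 3" "R b e = Q 1 4"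
    "R c d = Q 2 3" "R c e = Q 2 4" "R d e = Q 3 4"
proof -
  obtain f where f: "inj_on f {..<5::nat}" "f ` {..<5} \<subseteq> V" "\<And>i j. i < 5 \<Longrightarrow> j < 5 \<Longrightarrow> Q i j = R (f i) (f j)"
    using assms by (auto simp: emb_def)
  show thesis by (rule that[of "f 0" "f 1" "f 2" "f 3" "f 4"]) (use f in \<open>auto simp: inj_on_eq_iff\<close>)
qed

lemma has_TriangleI:
  assumes "a \<in> V" "b \<in> V" "c \<in> V" "sym_of R a b" "sym_of R a c" "sym_of R b c"
  shows "holds (Has Triangle) R V"
proof -
  have "a \<noteq> b" "a \<noteq> c" "b \<noteq> c" using assms(4-6) by (auto simp: sym_of_def)
  then show ?thesis using assms
    by simp (rule emb_fin3I[OF sym_of_commute sym_of_irrefl sym_of_commute sym_of_irrefl, where a=a and b=b and c=c], auto simp: sym_of_def)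
qed

lemma has_co_TriangleI:
  assumes "a \<in> V" "b \<in> V" "c \<in> V" "a \<noteq> b" "a \<noteq> c" "b \<noteq> c" "\<not> sym_of R a b" "\<not> sym_of R a c" "\<not> sym_of R b c"
  shows "holds (Has_Co Triangle) R V"
  using assms
  by simp (rule emb_fin3I[OF sym_of_commute sym_of_irrefl co_of_commute co_of_irrefl, where a=a and b=b and c=c], auto simp: co_of_def)

lemma has_SquareI:
  assumes "a \<in> V" "b \<in> V" "c \<in> V" "d \<in> V" "a \<noteq> c" "b \<noteq> d"
    "sym_of R a b" "sym_of R b c" "sym_of R c d" "sym_of R d a" "\<not> sym_of R a c" "\<not> sym_of R b d"
  shows "holds (Has Square) R V"
proof -
  have "distinct [a, b, c, d]" using assms(5-) by (auto simp: sym_of_def)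
  then show ?thesis using assms
    by simp (rule emb_fin4I[OF sym_of_commute sym_of_irrefl sym_of_commute sym_of_irrefl, where a=a and b=b and c=c and d=d], auto simp: sym_of_def)
qed

text \<open>The complement of a square consists of two disjoint edges, here \<open>a c\<close> and
  \<open>b d\<close>.\<close>

lemma has_co_SquareI:
  assumes "a \<in> V" "b \<in> V" "c \<in> V" "d \<in> V" "distinct [a, b, c, d]"
    "sym_of R a c" "sym_of R b d" "\<not> sym_of R a b" "\<not> sym_of R b c" "\<not> sym_of R c d" "\<not> sym_of R d a"
  shows "holds (Has_Co Square) R V"
  using assms
  by simp (rule emb_fin4I[OF sym_of_commute sym_of_irrefl co_of_commute co_of_irrefl, where a=a and b=b and c=c and d=d], auto simp: sym_of_def co_of_def)

lemma has_ClawI: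
  assumes "a \<in> V" "b \<in> V" "c \<in> V" "d \<in> V" "distinct [b, c, d]"
    "sym_of R a b" "sym_of R a c" "sym_of R a d" "\<not> sym_of R b c" "\<not> sym_of R b d" "\<not> sym_of R c d"
  shows "holds (Has Claw) R V"
proof -
  have "distinct [a, b, c, d]" using assms(5-8) by (auto simp: sym_of_def)
  then show ?thesis using assms
    by simp (rule emb_fin4I[OF sym_of_commute sym_of_irrefl sym_of_commute sym_of_irrefl, where a=a and b=b and c=c and d=d], auto simp: sym_of_def)
qed

text \<open>The complement of a claw is a triangle \<open>b c d\<close> with an isolated vertex
  \<open>a\<close>.\<close>

lemma has_co_ClawI:
  assumes "a \<in> V" "b \<in> V" "c \<in> V" "d \<in> V" "distinct [a, b, c, d]"
    "\<not> sym_of R a b" "\<not> sym_of R a c" "\<not> sym_of R a d" "sym_of R b c" "sym_of R b d" "sym_of R c d"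
  shows "holds (Has_Co Claw) R V"
  using assms
  by simp (rule emb_fin4I[OF sym_of_commute sym_of_irrefl co_of_commute co_of_irrefl, where a=a and b=b and c=c and d=d], auto simp: sym_of_def co_of_def)

lemma has_Path_DotI:
  assumes "a \<in> V" "b \<in> V" "c \<in> V" "d \<in> V" "e \<in> V" "distinct [a, b, c, d, e]"
    "sym_of R a b" "sym_of R b c" "sym_of R c d" "\<not> sym_of R a c" "\<not> sym_of R a d" "\<not> sym_of R b d"
    "\<not> sym_of R a e" "\<not> sym_of R b e" "\<not> sym_of R c e" "\<not> sym_of R d e"
  shows "holds (Has Path_Dot) R V"
  using assms
  by simp (rule emb_fin5I[OF sym_of_commute sym_of_irrefl sym_of_commute sym_of_irrefl, where a=a and b=b and c=c and d=d and e=e], auto simp: sym_of_def)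

lemma has_TriangleE:
  assumes "holds (Has Triangle) R V"
  obtains a b c where "a \<in> V" "b \<in> V" "c \<in> V" "sym_of R a b" "sym_of R a c" "sym_of R b c"
  using assms by (simp, elim emb_fin3E) (simp add: sym_of_def[of "edges _"])

lemma has_SquareE:
  assumes "holds (Has Square) R V"
  obtains a b c d where "a \<in> V" "b \<in> V" "c \<in> V" "d \<in> V" "a \<noteq> c" "b \<noteq> d"
    "sym_of R a b" "sym_of R b c" "sym_of R c d" "sym_of R a d" "\<not> sym_of R a c" "\<not> sym_of R b d"
  using assms by (simp, elim emb_fin4E) (simp add: sym_of_def[of "edges _"])

lemma has_co_SquareE:
  assumes "holds (Has_Co Square) R V"
  obtains a b c d where "a \<in> V" "b \<in> V" "c \<in> V" "d \<in> V" "a \<noteq> b" "b \<noteq> c" "c \<noteq> d" "a \<noteq> d"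
    "sym_of R a c" "sym_of R b d" "\<not> sym_of R a b" "\<not> sym_of R b c" "\<not> sym_of R c d" "\<not> sym_of R a d"
  using assms by (simp, elim emb_fin4E) (simp add: co_of_def)

lemma has_ClawE:
  assumes "holds (Has Claw) R V"
  obtains a b c d where "a \<in> V" "b \<in> V" "c \<in> V" "d \<in> V" "b \<noteq> c" "b \<noteq> d" "c \<noteq> d"
    "sym_of R a b" "sym_of R a c" "sym_of R a d" "\<not> sym_of R b c" "\<not> sym_of R b d" "\<not> sym_of R c d"
  using assms by (simp, elim emb_fin4E) (simp add: sym_of_def[of "edges _"])

text \<open>A path on four vertices is its own complement, so the pattern is a path
  \<open>b d a c\<close> with a vertex \<open>e\<close> joined to all of it.\<close>

lemma has_co_Path_DotE:
  assumes "holds (Has_Co Path_Dot) R V"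
  obtains a b c d e where "a \<in> V" "b \<in> V" "c \<in> V" "d \<in> V" "e \<in> V" "distinct [a, b, c, d, e]"
    "sym_of R b d" "sym_of R d a" "sym_of R a c" "\<not> sym_of R a b" "\<not> sym_of R b c" "\<not> sym_of R c d"
    "sym_of R a e" "sym_of R b e" "sym_of R c e" "sym_of R d e"
  using assms by (simp, elim emb_fin5E) (simp add: co_of_def sym_of_commute[of R])

definition "star_profile = [(Has Triangle, False), (Has_Co Triangle, True), (Has Square, False), (Has Claw, True)]"
definition "crown_profile = [(Has Triangle, False), (Has_Co Triangle, True), (Has Square, True), (Has_Co Square, True)]"
definition "spider_profile = [(Has Triangle, True), (Has_Co Triangle, True), (Has Claw, False), (Has_Co Claw, True)]"
definition "half_profile = [(Has Triangle, False), (Has_Co Triangle, True), (Has Square, True), (Has_Co Square, False)]"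
text \<open>The flag \<open>b\<close> on \<open>Threshold\<close> is the only entry in which the
  profile of a primed graph differs from that of its unprimed companion; the same holds for
  tails.\<close>

definition "hub_profile b = [(Has Triangle, True), (Has_Co Triangle, True), (Has Square, True), (Has Claw, True),
  (Has_Co Claw, True), (Has Threshold, b)]"
definition "tail_profile b = [(Has Triangle, True), (Has_Co Triangle, True), (Has Square, False), (Has_Co Square, False),
  (Has Claw, True), (Has_Co Claw, True), (Has Path_Dot, True), (Has_Co Path_Dot, False), (Has Threshold, b)]"
definition "path_profile = [(Has Triangle, False), (Has_Co Triangle, True), (Has Square, False), (Has Claw, False)]"

section \<open>The patterns contained in each graph\<close>

context index_set
begin

lemma obtain_sequence:
  obtains s :: "nat \<Rightarrow> 'k" where "\<And>n. s n \<in> K" "\<And>m n. s m \<sqsubset> s n \<longleftrightarrow> m < n" "\<And>m n. s m = s n \<longleftrightarrow> m = n"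
proof -
  obtain i0 where "i0 \<in> K" using obtain_other .
  then have "\<exists>s. \<forall>n::nat. s n \<in> K \<and> s n \<sqsubset> s (Suc n)"
    using dependent_nat_choice[of "\<lambda>_ i. i \<in> K" "\<lambda>_ i j. i \<sqsubset> j"] no_max by blast
  then obtain s where s: "\<And>n. s n \<in> K" "\<And>n. s n \<sqsubset> s (Suc n)" by blast
  have lt: "s m \<sqsubset> s n" if "m < n" for m n
    using that by (induction rule: less_Suc_induct) (use s less_trans in blast)+
  have "s m = s n \<longleftrightarrow> m = n" for m n using lt[of m n] lt[of n m] by (metis nat_neq_iff less_irrefl)
  moreover have "s m \<sqsubset> s n \<longleftrightarrow> m < n" for m n
    using lt[of m n] lt[of n m] by (metis nat_neq_iff less_irrefl less_asym)
  ultimately show thesis using that s(1) by blast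
qed

text \<open>Take the least index occurring in \<open>X\<close> and prefer its vertex in row
  \<open>VA\<close>, which precedes the one in row \<open>VB\<close>.\<close>

lemma before_least:
  assumes "X \<noteq> {}" "X \<subseteq> range VA \<union> range VB"
  shows "\<exists>x\<in>X. \<forall>y\<in>X. y \<noteq> x \<longrightarrow> before ls x y"
proof -
  define P where "P i \<longleftrightarrow> VA i \<in> X \<or> VB i \<in> X" for i
  define i where "i = ord.Least (\<sqsubseteq>) P"
  have "\<exists>i. P i" using assms unfolding P_def by blast
  then have i: "P i" unfolding i_def by (blast intro: LeastI)
  have le: "i \<sqsubseteq> j" if "P j" for j unfolding i_def by (rule Least_le[of P, OF that])
  have "\<exists>z. z \<in> X \<and> (\<forall>y\<in>X. y \<noteq> z \<longrightarrow> before ls z y)"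
  proof (cases "VA i \<in> X")
    case True
    have "before ls (VA i) y" if "y \<in> X" "y \<noteq> VA i" for y
      using that assms(2) le[of "case y of VA j \<Rightarrow> j | VB j \<Rightarrow> j"]
      by (cases y) (auto simp: P_def le_less not_less)
    then show ?thesis using True by blast
  next
    case False
    then have "VB i \<in> X" using i by (simp add: P_def)
    moreover have "before ls (VB i) y" if "y \<in> X" "y \<noteq> VB i" for y
      using that False assms(2) le[of "case y of VA j \<Rightarrow> j | VB j \<Rightarrow> j"]
      by (cases y) (auto simp: P_def le_less not_less)
    ultimately show ?thesis by blast
  qed
  then show ?thesis by blast
qed

text \<open>Beyond some position an injective sequence avoids the extra points; well-foundedness
  then provides a term preceding all later terms. This excludes infinite patterns that run downwards
  in the order.\<close>

lemma obtain_least_of_sequence: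
  fixes f :: "nat \<Rightarrow> 'k vx"
  assumes "inj f"
  obtains n where "\<And>m. m \<ge> n \<Longrightarrow> row (f m) \<in> {RA, RB}" "\<And>m. m > n \<Longrightarrow> before ls (f n) (f m)"
proof -
  have "finite (f -` {VC, VD})" using finite_vimageI[OF _ assms] by simp
  then obtain N where N: "\<forall>m\<in>f -` {VC, VD}. m < N" using finite_nat_set_iff_bounded by blast
  have AB: "f m \<in> range VA \<union> range VB" if "m \<ge> N" for m
  proof -
    have "f m \<notin> {VC, VD}" using N[rule_format, of m] that by fastforce
    then show ?thesis by (cases "f m") auto
  qed
  have "f ` {N..} \<subseteq> range VA \<union> range VB" using AB by auto
  then obtain x where x: "x \<in> f ` {N..}" "\<forall>y\<in>f ` {N..}. y \<noteq> x \<longrightarrow> before ls x y"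
    using before_least[of "f ` {N..}"] by blast
  then obtain n where n: "x = f n" "n \<ge> N" by auto
  show thesis
  proof
    show "row (f m) \<in> {RA, RB}" if "m \<ge> n" for m
      using AB[of m] that n by (cases "f m") auto
    show "before ls (f n) (f m)" if "m > n" for m
      using x(2) n that assms by (auto simp: inj_eq)
  qed
qed

text \<open>Here every vertex of the two rows sees the later vertices of the row \<open>VB\<close> and no later vertex of
  the row \<open>VA\<close>. The first vertex of a threshold sequence would put all later ones in one row.\<close>

lemma no_threshold:
  assumes "\<And>a b. a \<in> {RA, RB} \<Longrightarrow> b \<in> {RA, RB} \<Longrightarrow> (a, b, True) \<in> T \<or> (b, a, False) \<in> T \<longleftrightarrow> b = RB"
  shows "\<not> holds (Has Threshold) (ori (before ls) T) V"
proof
  let ?g = "sym_of (ori (before ls) T)"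
  assume "holds (Has Threshold) (ori (before ls) T) V"
  then obtain f :: "nat \<Rightarrow> 'k vx" where f: "inj f" "\<And>i j. sym_of (edges Threshold) i j = ?g (f i) (f j)"
    by (auto simp: emb_def)
  obtain n where n: "\<And>m. m \<ge> n \<Longrightarrow> row (f m) \<in> {RA, RB}" "\<And>m. m > n \<Longrightarrow> before ls (f n) (f m)"
    using obtain_least_of_sequence[OF f(1)] by blast
  have g: "?g x y \<longleftrightarrow> row y = RB" if "before ls x y" "row x \<in> {RA, RB}" "row y \<in> {RA, RB}" for x y
    using assms[OF that(2,3)] ori_before[OF that(1)] before_asym[OF that(1)] that(1) by (auto simp: sym_of_def)
  have "row (f m) = RB \<longleftrightarrow> even n" if "m > n" for m
    using g[OF n(2)[OF that] n(1) n(1)] f(2)[of n m] that by (auto simp: sym_of_def)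
  then have r: "row (f (n + 1)) = RB \<longleftrightarrow> even n" "row (f (n + 2)) = RB \<longleftrightarrow> even n" by simp_all
  have "?g (f (n + 1)) (f (n + 2)) \<longleftrightarrow> even n"
  proof (cases "before ls (f (n + 1)) (f (n + 2))")
    case True
    then show ?thesis using g[OF True n(1) n(1)] r by simp
  next
    case False
    then have "before ls (f (n + 2)) (f (n + 1))" using before_total[of "f (n + 1)" "f (n + 2)"] f(1) by (auto simp: inj_eq)
    then have "?g (f (n + 2)) (f (n + 1)) \<longleftrightarrow> even n" using g[OF _ n(1) n(1), of "n + 2" "n + 1"] r by simp
    then show ?thesis using sym_of_commute[of _ "f (n + 1)"] by simp
  qed
  \<comment> \<open>In the threshold pattern the parity of the smaller index \<open>n + 1\<close>
    decides, which contradicts the value read off the rows.\<close>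
  moreover have "?g (f (n + 1)) (f (n + 2)) \<longleftrightarrow> odd n"
    using f(2)[of "n + 1" "n + 2"] by (auto simp: sym_of_def)
  ultimately show False by blast
qed

text \<open>Alternate between the rows along an increasing sequence of indices: vertices of row
  \<open>VA\<close> see everything later, those of row \<open>VB\<close> see nothing later.\<close>

lemma has_threshold:
  assumes "(RA, RA, True) \<in> T" "(RA, RB, True) \<in> T" "(RB, RB, True) \<notin> T" "(RB, RB, False) \<notin> T"
    "(RB, RA, True) \<notin> T" "(RA, RB, False) \<notin> T"
  shows "holds (Has Threshold) (ori (before ls) T) (vset K E)"
proof -
  obtain s :: "nat \<Rightarrow> 'k" where s: "\<And>n. s n \<in> K" "\<And>m n. s m \<sqsubset> s n \<longleftrightarrow> m < n" "\<And>m n. s m = s n \<longleftrightarrow> m = n"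
    using obtain_sequence by blast
  define f where "f n = (if even n then VA (s n) else VB (s n))" for n :: nat
  have "sym_of (edges Threshold) i j = sym_of (ori (before ls) T) (f i) (f j)" for i j
    using assms by (cases "i < j"; cases "i = j") (auto simp: sym_of_def ori_def f_def s not_less dest: order.asym)
  moreover have "inj f" by (rule injI) (auto simp: f_def s split: if_splits)
  moreover have "range f \<subseteq> vset K E" by (auto simp: f_def s)
  ultimately show ?thesis by (auto simp: emb_def intro!: exI[of _ f])
qed

lemma star_has_profile: "has_profile (star_profile) (ori mate T_star) (vset K {VC})"
proof -
  let ?g = "ori mate T_star" and ?V = "vset K {VC}"
  obtain s :: "nat \<Rightarrow> 'k" where s: "\<And>n. s n \<in> K" "\<And>m n. s m \<sqsubset> s n \<longleftrightarrow> m < n" "\<And>m n. s m = s n \<longleftrightarrow> m = n"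
    using obtain_sequence by blast
  have "\<not> holds (Has Triangle) ?g ?V"
  proof
    assume "holds (Has Triangle) ?g ?V"
    then show False by (rule has_TriangleE) (rename_tac a b c, case_tac a; case_tac b; case_tac c; auto simp: adj not_less)
  qed
  moreover have "holds (Has_Co Triangle) ?g ?V"
    by (rule has_co_TriangleI[of "VA (s 0)" _ "VA (s 1)" "VA (s 2)"]) (auto simp: adj s)
  moreover have "\<not> holds (Has Square) ?g ?V"
  proof
    assume "holds (Has Square) ?g ?V"
    then show False by (rule has_SquareE) (rename_tac a b c d, case_tac a; case_tac c; case_tac b; case_tac d; auto simp: adj not_less)
  qed
  moreover have "holds (Has Claw) ?g ?V"
    by (rule has_ClawI[of VC _ "VA (s 0)" "VA (s 1)" "VA (s 2)"]) (auto simp: adj s)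
  ultimately show ?thesis unfolding star_profile_def by (simp del: holds.simps)
qed

lemma crown_has_profile: "has_profile (crown_profile) (ori mate T_crown) (vset K {})"
proof -
  let ?g = "ori mate T_crown" and ?V = "vset K {}"
  obtain s :: "nat \<Rightarrow> 'k" where s: "\<And>n. s n \<in> K" "\<And>m n. s m \<sqsubset> s n \<longleftrightarrow> m < n" "\<And>m n. s m = s n \<longleftrightarrow> m = n"
    using obtain_sequence by blast
  have "\<not> holds (Has Triangle) ?g ?V"
  proof
    assume "holds (Has Triangle) ?g ?V"
    then show False by (rule has_TriangleE) (rename_tac a b c, case_tac a; case_tac b; case_tac c; auto simp: adj not_less)
  qed
  moreover have "holds (Has_Co Triangle) ?g ?V"
    by (rule has_co_TriangleI[of "VA (s 0)" _ "VA (s 1)" "VA (s 2)"]) (auto simp: adj s)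
  \<comment> \<open>The indices 2 and 3 avoid 0 and 1, so no partners occur and all four edges are
    present. For the two disjoint edges afterwards the partners are the non-edges.\<close>
  moreover have "holds (Has Square) ?g ?V"
    by (rule has_SquareI[of "VA (s 0)" _ "VB (s 2)" "VA (s 1)" "VB (s 3)"]) (auto simp: adj s)
  moreover have "holds (Has_Co Square) ?g ?V"
    by (rule has_co_SquareI[of "VA (s 0)" _ "VA (s 1)" "VB (s 1)" "VB (s 0)"]) (auto simp: adj s)
  ultimately show ?thesis unfolding crown_profile_def by (simp del: holds.simps)
qed

text \<open>There is no claw because the neighbours of a clique vertex are the rest of the clique
  and a single leaf.\<close>

lemma spider_has_profile: "has_profile (spider_profile) (ori mate T_spider) (vset K {})"
proof -
  let ?g = "ori mate T_spider" and ?V = "vset K {}"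
  obtain s :: "nat \<Rightarrow> 'k" where s: "\<And>n. s n \<in> K" "\<And>m n. s m \<sqsubset> s n \<longleftrightarrow> m < n" "\<And>m n. s m = s n \<longleftrightarrow> m = n"
    using obtain_sequence by blast
  have "holds (Has Triangle) ?g ?V"
    by (rule has_TriangleI[of "VB (s 0)" _ "VB (s 1)" "VB (s 2)"]) (auto simp: adj s)
  moreover have "holds (Has_Co Triangle) ?g ?V"
    by (rule has_co_TriangleI[of "VA (s 0)" _ "VA (s 1)" "VA (s 2)"]) (auto simp: adj s)
  moreover have "\<not> holds (Has Claw) ?g ?V"
  proof
    assume "holds (Has Claw) ?g ?V"
    then show False by (rule has_ClawE) (rename_tac a b c d, case_tac a; case_tac b; case_tac c; case_tac d; auto simp: adj not_less)
  qed
  moreover have "holds (Has_Co Claw) ?g ?V"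
    by (rule has_co_ClawI[of "VA (s 3)" _ "VB (s 0)" "VB (s 1)" "VB (s 2)"]) (auto simp: adj s)
  ultimately show ?thesis unfolding spider_profile_def by (simp del: holds.simps)
qed

text \<open>Two disjoint edges, present in the crown, are excluded here by nested
  neighbourhoods.\<close>

lemma half_has_profile: "has_profile (half_profile) (ori (before ls) T_half) (vset K {})"
proof -
  let ?g = "ori (before ls) T_half" and ?V = "vset K {}"
  obtain s :: "nat \<Rightarrow> 'k" where s: "\<And>n. s n \<in> K" "\<And>m n. s m \<sqsubset> s n \<longleftrightarrow> m < n" "\<And>m n. s m = s n \<longleftrightarrow> m = n"
    using obtain_sequence by blast
  have "\<not> holds (Has Triangle) ?g ?V"
  proof
    assume "holds (Has Triangle) ?g ?V"
    then show False by (rule has_TriangleE) (rename_tac a b c, case_tac a; case_tac b; case_tac c; auto simp: adj not_less)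
  qed
  moreover have "holds (Has_Co Triangle) ?g ?V"
    by (rule has_co_TriangleI[of "VA (s 0)" _ "VA (s 1)" "VA (s 2)"]) (auto simp: adj s)
  moreover have "holds (Has Square) ?g ?V"
    by (rule has_SquareI[of "VA (s 0)" _ "VB (s 2)" "VA (s 1)" "VB (s 3)"]) (auto simp: adj s)
  moreover have "\<not> holds (Has_Co Square) ?g ?V"
  proof
    assume "holds (Has_Co Square) ?g ?V"
    then show False by (rule has_co_SquareE) (rename_tac a b c d, case_tac a; case_tac c; case_tac b; case_tac d; auto simp: adj not_less)
  qed
  ultimately show ?thesis unfolding half_profile_def by (simp del: holds.simps)
qed

lemma hub_has_profile: "has_profile (hub_profile False) (ori (before ls) T_hub) (vset K {VC})"
proof -
  let ?g = "ori (before ls) T_hub" and ?V = "vset K {VC}"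
  obtain s :: "nat \<Rightarrow> 'k" where s: "\<And>n. s n \<in> K" "\<And>m n. s m \<sqsubset> s n \<longleftrightarrow> m < n" "\<And>m n. s m = s n \<longleftrightarrow> m = n"
    using obtain_sequence by blast
  have "holds (Has Triangle) ?g ?V"
    by (rule has_TriangleI[of "VB (s 0)" _ "VB (s 1)" "VB (s 2)"]) (auto simp: adj s)
  moreover have "holds (Has_Co Triangle) ?g ?V"
    by (rule has_co_TriangleI[of "VA (s 0)" _ "VA (s 1)" "VA (s 2)"]) (auto simp: adj s)
  moreover have "holds (Has Square) ?g ?V"
    by (rule has_SquareI[of VC _ "VA (s 0)" "VB (s 1)" "VA (s 1)"]) (auto simp: adj s)
  moreover have "holds (Has Claw) ?g ?V"
    by (rule has_ClawI[of VC _ "VA (s 0)" "VA (s 1)" "VA (s 2)"]) (auto simp: adj s)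
  moreover have "holds (Has_Co Claw) ?g ?V"
    by (rule has_co_ClawI[of "VA (s 3)" _ "VB (s 0)" "VB (s 1)" "VB (s 2)"]) (auto simp: adj s)
  moreover have "holds (Has Threshold) ?g ?V = False"
    using no_threshold[of T_hub] by (auto simp: T_defs)
  ultimately show ?thesis unfolding hub_profile_def by (simp del: holds.simps)
qed

lemma hub'_has_profile: "has_profile (hub_profile True) (ori (before ls) T_hub') (vset K {VC})"
proof -
  let ?g = "ori (before ls) T_hub'" and ?V = "vset K {VC}"
  obtain s :: "nat \<Rightarrow> 'k" where s: "\<And>n. s n \<in> K" "\<And>m n. s m \<sqsubset> s n \<longleftrightarrow> m < n" "\<And>m n. s m = s n \<longleftrightarrow> m = n"
    using obtain_sequence by blast
  have "holds (Has Triangle) ?g ?V"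
    by (rule has_TriangleI[of "VA (s 0)" _ "VA (s 1)" "VA (s 2)"]) (auto simp: adj s)
  moreover have "holds (Has_Co Triangle) ?g ?V"
    by (rule has_co_TriangleI[of "VB (s 0)" _ "VB (s 1)" "VB (s 2)"]) (auto simp: adj s)
  moreover have "holds (Has Square) ?g ?V"
    by (rule has_SquareI[of VC _ "VB (s 1)" "VA (s 0)" "VB (s 2)"]) (auto simp: adj s)
  moreover have "holds (Has Claw) ?g ?V"
    by (rule has_ClawI[of VC _ "VB (s 0)" "VB (s 1)" "VB (s 2)"]) (auto simp: adj s)
  moreover have "holds (Has_Co Claw) ?g ?V"
    by (rule has_co_ClawI[of "VB (s 0)" _ "VA (s 1)" "VA (s 2)" "VA (s 3)"]) (auto simp: adj s)
  moreover have "holds (Has Threshold) ?g ?V = True"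
    using has_threshold[of T_hub'] by (auto simp: T_defs)
  ultimately show ?thesis unfolding hub_profile_def by (simp del: holds.simps)
qed

text \<open>Without \<open>VC\<close> the graph is a clique and an independent set with nested
  neighbourhoods, so it contains no square, no two disjoint edges and no path on four vertices.
  \<open>VC\<close> has \<open>VD\<close> as its only neighbour, and every edge inside the rows has
  an end adjacent to \<open>VD\<close>; hence the three absent patterns.\<close>

lemma tail_has_profile: "has_profile (tail_profile False) (ori (before ls) T_tail) (vset K {VC, VD})"
proof -
  let ?g = "ori (before ls) T_tail" and ?V = "vset K {VC, VD}"
  obtain s :: "nat \<Rightarrow> 'k" where s: "\<And>n. s n \<in> K" "\<And>m n. s m \<sqsubset> s n \<longleftrightarrow> m < n" "\<And>m n. s m = s n \<longleftrightarrow> m = n"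
    using obtain_sequence by blast
  have "holds (Has Triangle) ?g ?V"
    by (rule has_TriangleI[of "VB (s 0)" _ "VB (s 1)" "VB (s 2)"]) (auto simp: adj s)
  moreover have "holds (Has_Co Triangle) ?g ?V"
    by (rule has_co_TriangleI[of "VA (s 0)" _ "VA (s 1)" "VA (s 2)"]) (auto simp: adj s)
  moreover have "\<not> holds (Has Square) ?g ?V"
  proof
    assume "holds (Has Square) ?g ?V"
    then show False by (rule has_SquareE) (rename_tac a b c d, case_tac a; case_tac c; case_tac b; case_tac d; auto simp: adj not_less)
  qed
  moreover have "\<not> holds (Has_Co Square) ?g ?V"
  proof
    assume "holds (Has_Co Square) ?g ?V"
    then show False by (rule has_co_SquareE) (rename_tac a b c d, case_tac a; case_tac c; case_tac b; case_tac d; auto simp: adj not_less)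
  qed
  moreover have "holds (Has Claw) ?g ?V"
    by (rule has_ClawI[of "VB (s 2)" _ "VA (s 0)" "VA (s 1)" "VA (s 2)"]) (auto simp: adj s)
  moreover have "holds (Has_Co Claw) ?g ?V"
    by (rule has_co_ClawI[of "VA (s 3)" _ "VB (s 0)" "VB (s 1)" "VB (s 2)"]) (auto simp: adj s)
  \<comment> \<open>The path runs along the pendant edge into the rows; \<open>VA (s 1)\<close>
    misses \<open>VB (s 0)\<close> because its index is larger.\<close>
  moreover have "holds (Has Path_Dot) ?g ?V"
    by (rule has_Path_DotI[of VC _ VD "VB (s 0)" "VA (s 0)" "VA (s 1)"]) (auto simp: adj s)
  moreover have "\<not> holds (Has_Co Path_Dot) ?g ?V"
  proof
    assume "holds (Has_Co Path_Dot) ?g ?V"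
    then show False by (rule has_co_Path_DotE) (rename_tac a b c d e, case_tac e; case_tac a; (simp add: adj; fail)?; case_tac d; (simp add: adj; fail)?; case_tac c; (simp add: adj; fail)?; case_tac b; auto simp: adj not_less)
  qed
  moreover have "holds (Has Threshold) ?g ?V = False"
    using no_threshold[of T_tail] by (auto simp: T_defs)
  ultimately show ?thesis unfolding tail_profile_def by (simp del: holds.simps)
qed

text \<open>The reasons are those for \<open>tail_has_profile\<close>, with \<open>VD\<close> as the
  pendant vertex and row \<open>VA\<close> as the clique.\<close>

lemma tail'_has_profile: "has_profile (tail_profile True) (ori (before ls) T_tail') (vset K {VC, VD})"
proof -
  let ?g = "ori (before ls) T_tail'" and ?V = "vset K {VC, VD}"
  obtain s :: "nat \<Rightarrow> 'k" where s: "\<And>n. s n \<in> K" "\<And>m n. s m \<sqsubset> s n \<longleftrightarrow> m < n" "\<And>m n. s m = s n \<longleftrightarrow> m = n"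
    using obtain_sequence by blast
  have "holds (Has Triangle) ?g ?V"
    by (rule has_TriangleI[of "VA (s 0)" _ "VA (s 1)" "VA (s 2)"]) (auto simp: adj s)
  moreover have "holds (Has_Co Triangle) ?g ?V"
    by (rule has_co_TriangleI[of "VB (s 0)" _ "VB (s 1)" "VB (s 2)"]) (auto simp: adj s)
  moreover have "\<not> holds (Has Square) ?g ?V"
  proof
    assume "holds (Has Square) ?g ?V"
    then show False by (rule has_SquareE) (rename_tac a b c d, case_tac a; case_tac c; case_tac b; case_tac d; auto simp: adj not_less)
  qed
  moreover have "\<not> holds (Has_Co Square) ?g ?V"
  proof
    assume "holds (Has_Co Square) ?g ?V"
    then show False by (rule has_co_SquareE) (rename_tac a b c d, case_tac a; case_tac c; case_tac b; case_tac d; auto simp: adj not_less)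
  qed
  moreover have "holds (Has Claw) ?g ?V"
    by (rule has_ClawI[of "VA (s 0)" _ "VB (s 0)" "VB (s 1)" "VB (s 2)"]) (auto simp: adj s)
  moreover have "holds (Has_Co Claw) ?g ?V"
    by (rule has_co_ClawI[of "VB (s 0)" _ "VA (s 1)" "VA (s 2)" "VA (s 3)"]) (auto simp: adj s)
  moreover have "holds (Has Path_Dot) ?g ?V"
    by (rule has_Path_DotI[of VD _ VC "VA (s 1)" "VB (s 1)" "VB (s 0)"]) (auto simp: adj s)
  moreover have "\<not> holds (Has_Co Path_Dot) ?g ?V"
  proof
    assume "holds (Has_Co Path_Dot) ?g ?V"
    then show False by (rule has_co_Path_DotE) (rename_tac a b c d e, case_tac e; case_tac a; (simp add: adj; fail)?; case_tac d; (simp add: adj; fail)?; case_tac c; (simp add: adj; fail)?; case_tac b; auto simp: adj not_less)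
  qed
  moreover have "holds (Has Threshold) ?g ?V = True"
    using has_threshold[of T_tail'] by (auto simp: T_defs)
  ultimately show ?thesis unfolding tail_profile_def by (simp del: holds.simps)
qed

end

section \<open>Profiles under complementation\<close>

fun graph_feature :: "feature \<Rightarrow> bool" where
  "graph_feature (Has s) = True"
| "graph_feature (Has_Co s) = (s \<noteq> Threshold)"
| "graph_feature p = False"

lemma has_profile_sym_of_cong:
  assumes "sym_of R = sym_of Q" "\<forall>(p, b)\<in>set ps. graph_feature p" "has_profile ps R V"
  shows "has_profile ps Q V"
proof -
  have "holds p Q V = holds p R V" if "graph_feature p" for p
    using that assms(1) by (cases p) auto
  then show ?thesis using assms(2,3) by (fastforce simp: has_profile_def)
qed

lemma holds_cong:
  assumes "\<And>x y. x \<in> V \<Longrightarrow> y \<in> V \<Longrightarrow> R x y = Q x y"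
  shows "holds p R V = holds p Q V"
proof -
  have "emb R V Q V" "emb Q V R V"
    unfolding emb_def using assms by (intro exI[of _ id]; simp)+
  then show ?thesis using holds_mono by blast
qed

text \<open>\<open>Threshold\<close> is fixed, because dropping its first vertex turns it into its complement.\<close>

fun co_feature :: "feature \<Rightarrow> feature" where
  "co_feature (Has s) = (if s = Threshold then Has s else Has_Co s)"
| "co_feature (Has_Co s) = Has s"
| "co_feature p = p"

definition co_profile :: "profile \<Rightarrow> profile" where
  "co_profile ps = map (\<lambda>(p, b). (co_feature p, b)) ps"

lemma emb_co_threshold: "emb (co_of (edges Threshold)) UNIV (sym_of (edges Threshold)) UNIV"
  "emb (sym_of (edges Threshold)) UNIV (co_of (edges Threshold)) UNIV"
  unfolding emb_def by (rule exI[of _ Suc], auto simp: sym_of_def co_of_def)+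

lemma holds_co_feature:
  assumes "graph_feature p"
  shows "holds (co_feature p) (co_of R) V = holds p R V"
proof -
  have co2: "co_of (co_of Q) = sym_of Q" for Q :: "'b \<Rightarrow> 'b \<Rightarrow> bool"
    by (auto simp: fun_eq_iff sym_of_def co_of_def)
  have "emb (co_of R) V (sym_of (edges Threshold)) UNIV \<longleftrightarrow> emb (co_of R) V (co_of (edges Threshold)) UNIV"
    using emb_trans emb_co_threshold by blast
  then show ?thesis using assms emb_co_of_iff[of R V "edges _"] emb_co_of_iff[of R V "co_of (edges _)"]
    by (cases p) (auto simp: co2)
qed

lemma has_co_profile:
  assumes "\<forall>(p, b)\<in>set ps. graph_feature p" "has_profile ps R V"
  shows "has_profile (co_profile ps) (co_of R) V"
  using assms holds_co_feature[of _ R V] by (fastforce simp: has_profile_def co_profile_def)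

section \<open>Transitivity, and features that separate an order from its dual\<close>

definition strict_order :: "('a \<Rightarrow> 'a \<Rightarrow> bool) \<Rightarrow> bool" where
  "strict_order R \<longleftrightarrow> (\<forall>x y z. R x y \<longrightarrow> R y z \<longrightarrow> R x z) \<and> (\<forall>x. \<not> R x x)"

context index_set
begin

lemma strict_order_ori:
  assumes "\<And>x y z. ori \<rho> T x y \<Longrightarrow> ori \<rho> T y z \<Longrightarrow> x \<noteq> z \<and> (row x, row z, \<rho> x z) \<in> T"
  shows "strict_order (ori \<rho> T)"
  unfolding strict_order_def
proof (intro conjI allI impI)
  fix x y z assume "ori \<rho> T x y" "ori \<rho> T y z"
  then show "ori \<rho> T x z" using assms[of x y z] by (simp add: ori_def[of \<rho> T x z])
qed (simp add: ori_def)

text \<open>The truth values in the tables are chosen for this: they direct the edges so that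
  consecutive arrows compose.\<close>

lemma strict_orders:
  "strict_order (ori mate T_star)"
  "strict_order (ori mate T_crown)"
  "strict_order (ori (before ls) T_half)"
  "strict_order (ori (before ls) T_half_co)"
  "strict_order (ori (before ls) T_hub)"
  "strict_order (ori (before ls) T_hub')"
  "strict_order (ori (before ls) T_tail)"
  "strict_order (ori (before ls) T_tail_co)"
  "strict_order (ori (before ls) T_tail')"
  "strict_order (ori (before ls) T_tail'_co)"
  by (rule strict_order_ori, rename_tac x y z, case_tac x; case_tac y; case_tac z; auto simp: ori_def T_defs not_less)+

lemma three_above_star: "holds Three_Above (po_of (ori mate T_star)) (vset K {VC})"
proof -
  obtain s :: "nat \<Rightarrow> 'k" where s: "\<And>n. s n \<in> K" "\<And>m n. s m \<sqsubset> s n \<longleftrightarrow> m < n" "\<And>m n. s m = s n \<longleftrightarrow> m = n"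
    using obtain_sequence by blast
  define f where "f i = (if i = 0 then VC else VA (s i))" for i
  have "(i = j \<or> i = 0) = po_of (ori mate T_star) (f i) (f j)" for i j
    by (auto simp: po_of_def ori_def f_def T_defs s)
  moreover have "inj f" by (rule injI) (auto simp: f_def s split: if_splits)
  moreover have "range f \<subseteq> vset K {VC}" by (auto simp: f_def s)
  ultimately show ?thesis
    unfolding holds.simps emb_def by (intro exI[of _ f]) (auto intro: inj_on_subset)
qed

text \<open>In the dual only a vertex \<open>VA i\<close> has anything above it, namely the two
  elements \<open>VC\<close> and \<open>VB i\<close>.\<close>

lemma not_three_above_star: "\<not> holds Three_Above (od_of (ori mate T_star)) (vset K {VC})"
proof
  assume "holds Three_Above (od_of (ori mate T_star)) (vset K {VC})"
  then obtain f :: "nat \<Rightarrow> 'k vx" where f: "inj_on f {..<4::nat}" "\<forall>i\<in>{..<4}. \<forall>j\<in>{..<4}. (i = j \<or> i = 0) = od_of (ori mate T_star) (f i) (f j)"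
    unfolding holds.simps emb_def by blast
  have "ori mate T_star (f i) (f 0)" if "i \<in> {1, 2, 3}" for i
  proof -
    have i: "i < 4" "i \<noteq> 0" using that by auto
    then have "od_of (ori mate T_star) (f 0) (f i)" using bspec[OF bspec[OF f(2), of 0], of i] by simp
    moreover have "f 0 \<noteq> f i" using inj_on_eq_iff[OF f(1), of 0 i] i by simp
    ultimately show ?thesis by (simp add: od_of_def)
  qed
  then have o: "ori mate T_star (f 1) (f 0)" "ori mate T_star (f 2) (f 0)" "ori mate T_star (f 3) (f 0)" by auto
  have "f 1 \<noteq> f 2" "f 1 \<noteq> f 3" "f 2 \<noteq> f 3" using f(1) by (auto simp: inj_on_eq_iff)
  then show False
    using o by (cases "f 0"; cases "f 1"; cases "f 2"; cases "f 3") (auto simp: ori_def T_defs)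
qed

lemma half_up: "holds Half_Up (po_of (ori (before ls) T_half)) (vset K {})"
proof -
  obtain s :: "nat \<Rightarrow> 'k" where s: "\<And>n. s n \<in> K" "\<And>m n. s m \<sqsubset> s n \<longleftrightarrow> m < n" "\<And>m n. s m = s n \<longleftrightarrow> m = n"
    using obtain_sequence by blast
  define f where "f n = (if even n then VA (s n) else VB (s n))" for n :: nat
  have "(i = j \<or> even i \<and> odd j \<and> i < j) = po_of (ori (before ls) T_half) (f i) (f j)" for i j
    by (auto simp: po_of_def ori_def f_def T_defs s nat_less_le)
  moreover have "inj f" by (rule injI) (auto simp: f_def s split: if_splits)
  moreover have "range f \<subseteq> vset K {}" by (auto simp: f_def s)
  ultimately show ?thesis by (auto simp: emb_def intro!: exI[of _ f])
qed

text \<open>In the dual the row \<open>VB\<close> lies below. A copy would place its even points at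
  \<open>VB (J n)\<close> and its odd points at \<open>VA (I n)\<close> with \<open>I n\<close> at
  most \<open>J n\<close> but above \<open>J (Suc n)\<close>, so \<open>J\<close> would descend
  forever.\<close>

lemma not_half_up: "\<not> holds Half_Up (od_of (ori (before ls) T_half)) (vset K {})"
proof
  let ?o = "ori (before ls) T_half"
  assume "holds Half_Up (od_of ?o) (vset K {})"
  then obtain f :: "nat \<Rightarrow> 'k vx" where f: "inj f"
    "\<And>i j. (i = j \<or> even i \<and> odd j \<and> i < j) = od_of ?o (f i) (f j)"
    by (auto simp: emb_def)
  have o: "?o (f (2 * m + 1)) (f (2 * n)) \<longleftrightarrow> n \<le> m" for m n
  proof -
    have "f (2 * m + 1) \<noteq> f (2 * n)" using f(1) by (auto simp: inj_eq) presburger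
    then show ?thesis using f(2)[of "2 * n" "2 * m + 1"] by (auto simp: od_of_def)
  qed
  \<comment> \<open>The omitted constructors never occur at these positions, as \<open>ex\<close>
    shows.\<close>
  define I where "I m = (case f (2 * m + 1) of VA i \<Rightarrow> i)" for m
  define J where "J m = (case f (2 * m) of VB i \<Rightarrow> i)" for m
  have ex: "\<exists>i j. f (2 * m + 1) = VA i \<and> f (2 * m) = VB j" for m
    using o[of m m] by (cases "f (2 * m + 1)"; cases "f (2 * m)") (auto simp: ori_def T_defs)
  have IJ: "f (2 * m + 1) = VA (I m)" "f (2 * m) = VB (J m)" for m
    using ex[of m] by (auto simp: I_def J_def)
  have le: "I m \<sqsubseteq> J n \<longleftrightarrow> n \<le> m" for m n
    using o[of m n] unfolding IJ by (auto simp: ori_def T_defs not_less)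
  define P where "P i \<longleftrightarrow> i \<in> range J" for i
  have "P (ord.Least (\<sqsubseteq>) P)" by (rule LeastI[of P "J 0"]) (simp add: P_def)
  then obtain n where n: "ord.Least (\<sqsubseteq>) P = J n" by (auto simp: P_def)
  have "J n \<sqsubseteq> J (Suc n)" using Least_le[of P "J (Suc n)"] unfolding n by (simp add: P_def)
  moreover have "I n \<sqsubseteq> J n" "\<not> I n \<sqsubseteq> J (Suc n)" using le by auto
  ultimately show False using order_trans by blast
qed

lemma obtain_row_sequence:
  assumes "q \<in> {RA, RB}"
  obtains f :: "nat \<Rightarrow> 'k vx" where "inj f" "range f \<subseteq> vset K E" "\<And>n. row (f n) = q"
    "\<And>m n. before ls (f m) (f n) \<longleftrightarrow> m < n"
proof -
  obtain s :: "nat \<Rightarrow> 'k" where s: "\<And>n. s n \<in> K" "\<And>m n. s m \<sqsubset> s n \<longleftrightarrow> m < n" "\<And>m n. s m = s n \<longleftrightarrow> m = n"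
    using obtain_sequence by blast
  show thesis
    by (rule that[of "\<lambda>n. if q = RA then VA (s n) else VB (s n)"])
      (use assms in \<open>auto simp: s inj_def\<close>)
qed

lemma ascending_po:
  assumes "q \<in> {RA, RB}" "(q, q, True) \<in> T" "(q, q, False) \<notin> T"
  shows "holds Ascending (po_of (ori (before ls) T)) (vset K E)"
proof -
  obtain f :: "nat \<Rightarrow> 'k vx" where f: "inj f" "range f \<subseteq> vset K E" "\<And>n. row (f n) = q"
    "\<And>m n. before ls (f m) (f n) \<longleftrightarrow> m < n" using obtain_row_sequence[OF assms(1)] by blast
  have "(i \<le> j) = po_of (ori (before ls) T) (f i) (f j)" for i j
    using f(1) assms(2,3) by (cases "i < j") (auto simp: po_of_def ori_def f(3,4) inj_eq)
  then show ?thesis using f(1,2) by (auto simp: emb_def intro!: exI[of _ f])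
qed

lemma ascending_od:
  assumes "q \<in> {RA, RB}" "(q, q, False) \<in> T" "(q, q, True) \<notin> T"
  shows "holds Ascending (od_of (ori (before ls) T)) (vset K E)"
proof -
  obtain f :: "nat \<Rightarrow> 'k vx" where f: "inj f" "range f \<subseteq> vset K E" "\<And>n. row (f n) = q"
    "\<And>m n. before ls (f m) (f n) \<longleftrightarrow> m < n" using obtain_row_sequence[OF assms(1)] by blast
  have "(i \<le> j) = od_of (ori (before ls) T) (f i) (f j)" for i j
    using f(1) assms(2,3) by (cases "j < i") (auto simp: od_of_def ori_def f(3,4) inj_eq)
  then show ?thesis using f(1,2) by (auto simp: emb_def intro!: exI[of _ f])
qed

text \<open>Some term of the chain precedes all later ones in \<open>before\<close>. It would lie
  below its successor, which needs a table entry with \<open>True\<close> between the two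
  rows.\<close>

lemma not_ascending_po:
  assumes "\<And>a b. a \<in> {RA, RB} \<Longrightarrow> b \<in> {RA, RB} \<Longrightarrow> (a, b, True) \<notin> T"
  shows "\<not> holds Ascending (po_of (ori (before ls) T)) V"
proof
  assume "holds Ascending (po_of (ori (before ls) T)) V"
  then obtain f :: "nat \<Rightarrow> 'k vx" where f: "inj f" "\<And>i j. i \<le> j \<longleftrightarrow> po_of (ori (before ls) T) (f i) (f j)"
    by (auto simp: emb_def)
  obtain n where n: "\<And>m. m \<ge> n \<Longrightarrow> row (f m) \<in> {RA, RB}" "\<And>m. m > n \<Longrightarrow> before ls (f n) (f m)"
    using obtain_least_of_sequence[OF f(1)] by blast
  have "ori (before ls) T (f n) (f (Suc n))"
    using f(2)[of n "Suc n"] f(1) by (auto simp: po_of_def inj_eq)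
  then show False
    using assms[OF n(1) n(1), of n "Suc n"] n(2)[of "Suc n"] by (auto simp: ori_def)
qed

lemma not_ascending_od:
  assumes "\<And>a b. a \<in> {RA, RB} \<Longrightarrow> b \<in> {RA, RB} \<Longrightarrow> (a, b, False) \<notin> T"
  shows "\<not> holds Ascending (od_of (ori (before ls) T)) V"
proof
  assume "holds Ascending (od_of (ori (before ls) T)) V"
  then obtain f :: "nat \<Rightarrow> 'k vx" where f: "inj f" "\<And>i j. i \<le> j \<longleftrightarrow> od_of (ori (before ls) T) (f i) (f j)"
    by (auto simp: emb_def)
  obtain n where n: "\<And>m. m \<ge> n \<Longrightarrow> row (f m) \<in> {RA, RB}" "\<And>m. m > n \<Longrightarrow> before ls (f n) (f m)"
    using obtain_least_of_sequence[OF f(1)] by blast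
  have "ori (before ls) T (f (Suc n)) (f n)"
    using f(2)[of n "Suc n"] f(1) by (auto simp: od_of_def inj_eq)
  then show False
    using assms[OF n(1) n(1), of "Suc n" n] before_asym[OF n(2)[of "Suc n"]] by (auto simp: ori_def)
qed

text \<open>The row that is a chain decides: an entry \<open>(q, q, True)\<close> makes it ascend in
  the order, an entry \<open>(q, q, False)\<close> makes it ascend in the dual.\<close>

lemma ascending_features:
  "holds Ascending (po_of (ori (before ls) T_half_co)) (vset K {})"
  "\<not> holds Ascending (od_of (ori (before ls) T_half_co)) (vset K {})"
  "\<not> holds Ascending (po_of (ori (before ls) T_hub)) (vset K {VC})"
  "holds Ascending (od_of (ori (before ls) T_hub)) (vset K {VC})"
  "holds Ascending (po_of (ori (before ls) T_hub')) (vset K {VC})"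
  "\<not> holds Ascending (od_of (ori (before ls) T_hub')) (vset K {VC})"
  "\<not> holds Ascending (po_of (ori (before ls) T_tail)) (vset K {VC, VD})"
  "holds Ascending (od_of (ori (before ls) T_tail)) (vset K {VC, VD})"
  "\<not> holds Ascending (po_of (ori (before ls) T_tail_co)) (vset K {VC, VD})"
  "holds Ascending (od_of (ori (before ls) T_tail_co)) (vset K {VC, VD})"
  "holds Ascending (po_of (ori (before ls) T_tail')) (vset K {VC, VD})"
  "\<not> holds Ascending (od_of (ori (before ls) T_tail')) (vset K {VC, VD})"
  "holds Ascending (po_of (ori (before ls) T_tail'_co)) (vset K {VC, VD})"
  "\<not> holds Ascending (od_of (ori (before ls) T_tail'_co)) (vset K {VC, VD})"
  by (rule ascending_po[of RA] ascending_po[of RB] ascending_od[of RA] ascending_od[of RB]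
      not_ascending_po not_ascending_od; force simp: T_defs)+

end

section \<open>Infinite paths\<close>

text \<open>The infinite fence with the even numbers as minimal elements, which orients the one-way
  infinite path.\<close>

definition zigzag :: "nat \<Rightarrow> nat \<Rightarrow> bool" where
  "zigzag i j \<longleftrightarrow> even i \<and> (j = Suc i \<or> i = Suc j)"

definition jump :: "nat \<Rightarrow> nat \<Rightarrow> bool" where
  "jump i j \<longleftrightarrow> i + 2 \<le> j"

lemma sym_of_zigzag: "sym_of zigzag i j \<longleftrightarrow> j = Suc i \<or> i = Suc j"
  by (auto simp: sym_of_def zigzag_def)

lemma sym_of_jump: "sym_of jump = co_of zigzag"
  by (auto simp: fun_eq_iff sym_of_def co_of_def zigzag_def jump_def) presburger+

lemma strict_order_zigzag: "strict_order zigzag" and strict_order_jump: "strict_order jump"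
  by (auto simp: strict_order_def zigzag_def jump_def)

lemma indec_zigzag: "indec (sym_of zigzag) UNIV"
proof (rule indecI)
  have main: "UNIV \<subseteq> S" if S: "auton (sym_of zigzag) UNIV S" and xy: "x \<in> S" "y \<in> S" "x < y" for S x y
  proof -
    note cl = autonD[OF S UNIV_I]
    have up: "n \<in> S" if "y \<le> n" for n
      using that
    proof (induction n rule: dec_induct)
      case (step n)
      then show ?case using cl[of n x "Suc n"] xy by (auto simp: sym_of_zigzag)
    qed (rule xy(2))
    have "n \<in> S" if "n \<le> y" for n
      using that
    proof (induction n rule: inc_induct)
      case (step n)
      \<comment> \<open>\<open>y + 3\<close> is a member far enough above to be no neighbour of
        \<open>n\<close>, so \<open>n\<close> separates it from \<open>Suc n\<close>.\<close>
      then show ?case using cl[of "Suc n" "y + 3" n] up[of "y + 3"] by (auto simp: sym_of_zigzag)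
    qed (rule xy(2))
    then show ?thesis using up nat_le_linear by blast
  qed
  fix S x y assume "auton (sym_of zigzag) UNIV S" "x \<in> S" "y \<in> S" "x \<noteq> y"
  then show "UNIV \<subseteq> S" using main[of S x y] main[of S y x] by (cases "x < y") auto
qed

text \<open>A set with a gap at \<open>k\<close> has its part above \<open>k\<close> autonomous, so indecomposable infinite sets are
  final segments.\<close>

lemma self_embedding_shift:
  fixes R :: "nat \<Rightarrow> nat \<Rightarrow> bool"
  assumes blind: "\<And>v x y. v + 2 \<le> x \<Longrightarrow> v + 2 \<le> y \<Longrightarrow> R v x = R v y \<and> R x v = R y v"
    and shift: "\<And>x y m. R (x + 2 * m) (y + 2 * m) = R x y"
  shows "self_embedding R UNIV"
  unfolding self_embedding_def
proof (intro allI impI)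
  fix X :: "nat set" assume "|X| =o |UNIV :: nat set|" and X: "indec R X"
  then have inf: "infinite X" by (simp add: card_of_ordIso_finite)
  then obtain m where m: "m \<in> X" by (metis ex_in_conv finite.emptyI)
  have "k \<in> X" if "m < k" for k
  proof (rule ccontr)
    assume k: "k \<notin> X"
    let ?S = "{x\<in>X. k < x}"
    have "auton R X ?S"
      unfolding auton_def
    proof (intro conjI ballI)
      fix v x y assume "v \<in> X - ?S" "x \<in> ?S" "y \<in> ?S"
      then have "v < k" "k < x" "k < y" using k by (auto simp: not_less le_less)
      then show "R v x = R v y" "R x v = R y v" using blind[of v x y] by auto
    qed simp
    moreover have "infinite ?S"
    proof
      assume "finite ?S"
      then have "finite ({..k} \<union> ?S)" by simp
      moreover have "X \<subseteq> {..k} \<union> ?S" by auto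
      ultimately show False using inf finite_subset by blast
    qed
    ultimately have S: "?S = X" using X unfolding indec_def by (metis finite.emptyI finite.insertI)
    have "m \<in> ?S" unfolding S by (rule m)
    then show False using that by simp
  qed
  \<comment> \<open>The shift is even in order to preserve the parity that \<open>zigzag\<close>
    depends on, and it moves everything to \<open>m\<close> or beyond.\<close>
  then have "x + 2 * m \<in> X" for x using m by (cases "x + 2 * m = m") (auto simp: neq_iff)
  then show "emb R X R UNIV"
    unfolding emb_def using shift[of _ m] by (intro exI[of _ "\<lambda>x. x + 2 * m"]) (auto simp: inj_def)
qed

lemma self_embedding_zigzag: "self_embedding zigzag UNIV" and self_embedding_jump: "self_embedding jump UNIV"
  by (rule self_embedding_shift; auto simp: zigzag_def jump_def)+

lemma path_has_profile: "has_profile path_profile zigzag UNIV"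
proof -
  have "\<not> holds (Has Triangle) zigzag UNIV"
    by (rule notI, erule has_TriangleE) (auto simp: sym_of_zigzag)
  moreover have "holds (Has_Co Triangle) zigzag UNIV"
    by (rule has_co_TriangleI[of 0 _ 2 4]) (auto simp: sym_of_zigzag)
  moreover have "\<not> holds (Has Square) zigzag UNIV"
    by (rule notI, erule has_SquareE) (auto simp: sym_of_zigzag)
  moreover have "\<not> holds (Has Claw) zigzag UNIV"
    by (rule notI, erule has_ClawE) (auto simp: sym_of_zigzag)
  ultimately show ?thesis unfolding path_profile_def by (simp del: holds.simps)
qed

text \<open>Doubling makes distinct numbers differ by at least two.\<close>

lemma ascending_jump: "holds Ascending (po_of jump) UNIV"
  by (auto simp: emb_def po_of_def jump_def inj_def intro!: exI[of _ "\<lambda>i. 2 * i"])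

lemma not_ascending_jump: "\<not> holds Ascending (od_of jump) UNIV"
proof
  assume "holds Ascending (od_of jump) UNIV"
  then obtain f :: "nat \<Rightarrow> nat" where f: "inj f" "\<And>i j. i \<le> j \<longleftrightarrow> od_of jump (f i) (f j)"
    by (auto simp: emb_def)
  have "f (Suc n) < f n" for n
    using f(2)[of n "Suc n"] f(1) by (auto simp: od_of_def jump_def inj_eq)
  then show False using wf_no_infinite_down_chainE[OF wf_less, of f] by blast
qed

section \<open>Families of pairwise incomparable structures\<close>

text \<open>The locale needs a well-order on the whole type, while \<open>c\<close> orders only its
  field. The canonical well-order of the type contains \<open>c\<close> as an initial part; its
  proper segments come from those of \<open>c\<close>, which are smaller since \<open>c\<close> is a
  cardinal.\<close>

lemma exists_index_set:
  fixes c :: "'k rel"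
  assumes c: "Card_order c" "natLeq \<le>o c"
  shows "\<exists>(le :: 'k \<Rightarrow> 'k \<Rightarrow> bool) ls K. index_set le ls K \<and> |K| =o c"
proof -
  let ?u = "|UNIV :: 'k set|"
  have Fc: "|Field c| =o c" using c(1) card_of_Field_ordIso by blast
  have "c \<le>o ?u"
    using ordIso_ordLeq_trans[OF ordIso_symmetric[OF Fc] card_of_mono1[OF subset_UNIV]] .
  then obtain g where g: "embed c ?u g" by (auto simp: ordLeq_def)
  have Wc: "Well_order c" using c(1) by (simp add: card_order_on_def)
  have tot: "total_on (Field c) c" using Wc by (simp add: well_order_on_def linear_order_on_def)
  have Wu: "Well_order ?u" by (rule card_of_Well_order)
  have FU: "Field ?u = UNIV" by (rule Field_card_of)
  define le where "le x y \<longleftrightarrow> (x, y) \<in> ?u" for x y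
  define ls where "ls x y \<longleftrightarrow> (x, y) \<in> ?u \<and> x \<noteq> y" for x y
  have lin: "refl ?u" "trans ?u" "antisym ?u" "total ?u"
    using Wu unfolding well_order_on_def linear_order_on_def partial_order_on_def preorder_on_def FU by auto
  have rf: "(x, x) \<in> ?u" for x using lin(1) by (simp add: refl_on_def)
  have wf: "wf (?u - Id)" using Wu by (simp add: well_order_on_def)
  have wellorder: "class.wellorder le ls"
  proof
    show "ls x y \<longleftrightarrow> le x y \<and> \<not> le y x" for x y
      using lin(3) rf by (auto simp: le_def ls_def antisym_def)
    show "le x x" for x using rf by (simp add: le_def)
    show "le x y \<Longrightarrow> le y z \<Longrightarrow> le x z" for x y z using lin(2) by (auto simp: le_def trans_def)
    show "le x y \<Longrightarrow> le y x \<Longrightarrow> x = y" for x y using lin(3) by (auto simp: le_def antisym_def)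
    show "le x y \<or> le y x" for x y using lin(4) rf unfolding le_def total_on_def by (metis UNIV_I)
    show "P a" if step: "\<And>x. (\<And>y. ls y x \<Longrightarrow> P y) \<Longrightarrow> P x" for P a
    proof (induction a rule: wf_induct_rule[OF wf])
      case (1 x)
      show ?case by (rule step, rule 1) (simp add: ls_def)
    qed
  qed
  define K where "K = g ` Field c"
  have ginj: "inj_on g (Field c)" using embed_inj_on[OF Wc g] .
  have KF: "|Field c| =o |K|" unfolding K_def by (rule card_of_ordIsoI[OF bij_betw_imageI[OF ginj refl]])
  then have Kc: "|K| =o c" by (rule ordIso_transitive[OF ordIso_symmetric Fc])
  have "infinite (Field c)"
    using infinite_iff_natLeq_ordLeq ordLeq_ordIso_trans[OF c(2) ordIso_symmetric[OF Fc]] by blast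
  then have Kinf: "infinite K" using KF card_of_ordIso_finite by blast
  have "|{j\<in>K. ls j i}| <o |K|" if "i \<in> K" for i
  proof -
    obtain a where a: "a \<in> Field c" "i = g a" using \<open>i \<in> K\<close> by (auto simp: K_def)
    have "{j\<in>K. ls j i} \<subseteq> g ` underS c a"
    proof
      fix j assume "j \<in> {j\<in>K. ls j i}"
      then obtain b where b: "b \<in> Field c" "j = g b" "(g b, g a) \<in> ?u" "g b \<noteq> g a"
        using a by (auto simp: K_def ls_def)
      have "(b, a) \<in> c"
      proof (rule ccontr)
        assume "(b, a) \<notin> c"
        then have "(a, b) \<in> c"
          using tot a(1) b(1,2) b(4) unfolding total_on_def by metis
        then have "(g a, g b) \<in> ?u" using embed_compat[OF g] by (auto simp: compat_def)
        then show False using b(3,4) lin(3) by (auto simp: antisym_def)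
      qed
      then show "j \<in> g ` underS c a" using b by (auto simp: underS_def)
    qed
    then have "|{j\<in>K. ls j i}| \<le>o |underS c a|"
      by (rule ordLeq_transitive[OF card_of_mono1 card_of_image])
    moreover have "|underS c a| <o c" using card_of_underS[OF c(1) a(1)] .
    ultimately show ?thesis
      using Kc ordIso_symmetric ordLeq_ordLess_trans ordLess_ordIso_trans by blast
  qed
  then have "index_set le ls K"
    using wellorder Kinf by (intro index_set.intro index_set_axioms.intro) auto
  then show ?thesis using Kc by blast
qed

section \<open>Models of a profile and change of carrier\<close>

definition graph_model :: "'c rel \<Rightarrow> profile \<Rightarrow> ('a \<Rightarrow> 'a \<Rightarrow> bool) \<times> 'a set \<Rightarrow> bool" where
  "graph_model c ps = (\<lambda>(R, V). (\<forall>x y. R x y = R y x) \<and> (\<forall>x. \<not> R x x) \<and>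
     infinite V \<and> |V| =o c \<and> minimal R V \<and> has_profile ps R V)"

definition poset_model :: "'c rel \<Rightarrow> profile \<Rightarrow> ('a \<Rightarrow> 'a \<Rightarrow> bool) \<times> 'a set \<Rightarrow> bool" where
  "poset_model c ps = (\<lambda>(R, V). (\<forall>x. R x x) \<and> (\<forall>x y z. R x y \<longrightarrow> R y z \<longrightarrow> R x z) \<and>
     (\<forall>x\<in>V. \<forall>y\<in>V. R x y \<longrightarrow> R y x \<longrightarrow> x = y) \<and>
     infinite V \<and> |V| =o c \<and> minimal R V \<and> has_profile ps R V)"

lemma has_profile_mutual: "emb R V Q W \<Longrightarrow> emb Q W R V \<Longrightarrow> has_profile ps R V = has_profile ps Q W"
proof -
  assume e: "emb R V Q W" "emb Q W R V"
  have "holds p R V = holds p Q W" for p using holds_mono[OF e(1)] holds_mono[OF e(2)] by blast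
  then show ?thesis by (simp add: has_profile_def)
qed

lemma has_profile_pull: "inj_on h V \<Longrightarrow> has_profile ps (pull h V R) (h ` V) = has_profile ps R V"
  using has_profile_mutual emb_pull[OF _ subset_refl] emb_pull'[OF _ subset_refl] by blast

lemma obtain_bij_Field:
  assumes "|V| =o c" "Card_order c"
  obtains h where "inj_on h V" "h ` V = Field c"
proof -
  have "|V| =o |Field c|"
    using assms card_of_Field_ordIso ordIso_symmetric ordIso_transitive by blast
  then obtain h where "bij_betw h V (Field c)" using card_of_ordIso by blast
  then show thesis using that by (auto simp: bij_betw_def)
qed

text \<open>The models are built on \<open>vx\<close>, whereas the family must live on the type of
  the cardinal; a bijection onto \<open>Field c\<close> moves them.\<close>

lemma graph_model_transfer:
  fixes c :: "'k rel"
  assumes "Card_order c" "graph_model c ps M"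
  shows "\<exists>M' :: ('k \<Rightarrow> 'k \<Rightarrow> bool) \<times> 'k set. graph_model c ps M'"
proof -
  obtain R V where M: "M = (R, V)" by fastforce
  have m: "\<And>x y. R x y = R y x" "\<And>x. \<not> R x x" "infinite V" "|V| =o c" "minimal R V" "has_profile ps R V"
    using assms(2) unfolding M graph_model_def by auto
  obtain h where h: "inj_on h V" "h ` V = Field c" using obtain_bij_Field[OF m(4) assms(1)] .
  have "infinite (h ` V)" using m(3) finite_image_iff[OF h(1)] by blast
  then have "graph_model c ps (pull h V R, h ` V)"
    using minimal_pull[OF h(1) m(5)] has_profile_pull[OF h(1)] m(2,6) h(2) assms(1) card_of_Field_ordIso
    by (auto simp: graph_model_def pull_def m(1))
  then show ?thesis by blast
qed

lemma poset_model_transfer: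
  fixes c :: "'k rel"
  assumes "Card_order c" "poset_model c ps M"
  shows "\<exists>M' :: ('k \<Rightarrow> 'k \<Rightarrow> bool) \<times> 'k set. poset_model c ps M'"
proof -
  obtain R V where M: "M = (R, V)" by fastforce
  have m: "\<And>x. R x x" "\<And>x y z. R x y \<Longrightarrow> R y z \<Longrightarrow> R x z" "\<And>x y. x \<in> V \<Longrightarrow> y \<in> V \<Longrightarrow> R x y \<Longrightarrow> R y x \<Longrightarrow> x = y"
    "infinite V" "|V| =o c" "minimal R V" "has_profile ps R V"
    using assms(2) unfolding M poset_model_def by blast+
  obtain h where h: "inj_on h V" "h ` V = Field c" using obtain_bij_Field[OF m(5) assms(1)] .
  have anti: "x = y" if "x \<in> h ` V" "y \<in> h ` V" "pull h V R x y" "pull h V R y x" for x y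
    using m(3)[of "inv_into V h x" "inv_into V h y"] that
    by (auto simp: pull_def inv_into_f_f[OF h(1)])
  have refl: "pull h V R x x" and trans: "pull h V R x y \<Longrightarrow> pull h V R y z \<Longrightarrow> pull h V R x z" for x y z
    using m(1,2) unfolding pull_def by blast+
  have card: "infinite (h ` V)" "|h ` V| =o c"
    using m(4) finite_image_iff[OF h(1)] h(2) card_of_Field_ordIso[OF assms(1)] by auto
  have "poset_model c ps (pull h V R, h ` V)"
    unfolding poset_model_def prod.case
  proof (intro conjI allI ballI impI)
    show "minimal (pull h V R) (h ` V)" by (rule minimal_pull[OF h(1) m(6)])
    show "has_profile ps (pull h V R) (h ` V)" using has_profile_pull[OF h(1)] m(7) by blast
  qed (fact refl, erule (1) trans, erule (3) anti, fact card(1), fact card(2))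
  then show ?thesis by blast
qed

section \<open>Families from pairwise conflicting profiles\<close>

definition conflict :: "profile \<Rightarrow> profile \<Rightarrow> bool" where
  "conflict ps qs \<longleftrightarrow> (\<exists>(p, b)\<in>set ps. (p, \<not> b) \<in> set qs)"

lemma conflict_sym: "conflict ps qs \<Longrightarrow> conflict qs ps"
  unfolding conflict_def by force

text \<open>By minimality the embedding can be reversed, so both structures would satisfy the same
  profiles.\<close>

lemma conflict_not_emb:
  assumes "conflict ps qs" "minimal R V" "minimal Q W" "|V| =o |W|" "has_profile ps R V" "has_profile qs Q W"
  shows "\<not> emb R V Q W"
proof
  assume e: "emb R V Q W"
  then have "has_profile qs R V" using emb_sym_if_minimal[OF assms(2-4) e] has_profile_mutual assms(6) by blast
  then show False using assms(1,5) by (fastforce simp: conflict_def has_profile_def)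
qed

text \<open>Every structure embeds itself, so profiles in conflict belong to different structures
  and the family has as many members as the list.\<close>

lemma conflicting_family:
  assumes models: "\<And>ps. ps \<in> set L \<Longrightarrow> \<exists>M. model ps M"
    and model: "\<And>ps R V. model ps (R, V) \<Longrightarrow> minimal R V \<and> has_profile ps R V \<and> |V| =o c"
    and L: "sorted_wrt conflict L"
  shows "\<exists>F. card F = length L \<and> (\<forall>G\<in>F. \<exists>ps\<in>set L. \<exists>R V. G = struct V R \<and> model ps (R, V)) \<and>
    pairwise (\<lambda>G H. \<not> embeds G H) F"
proof -
  obtain M where M: "\<And>ps. ps \<in> set L \<Longrightarrow> model ps (M ps)" using models by metis
  define G where "G ps = struct (snd (M ps)) (fst (M ps))" for ps
  have m: "minimal (fst (M ps)) (snd (M ps))" "has_profile ps (fst (M ps)) (snd (M ps))" "|snd (M ps)| =o c"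
    if "ps \<in> set L" for ps
    using model[of ps "fst (M ps)" "snd (M ps)"] M[OF that] by auto
  have no: "\<not> embeds (G ps) (G qs)" if "ps \<in> set L" "qs \<in> set L" "conflict ps qs" for ps qs
    unfolding G_def embeds_struct
    using conflict_not_emb[OF that(3) m(1)[OF that(1)] m(1)[OF that(2)] _ m(2)[OF that(1)] m(2)[OF that(2)]]
      m(3)[OF that(1)] m(3)[OF that(2)] ordIso_symmetric ordIso_transitive by blast
  have refl: "embeds (G ps) (G ps)" for ps by (simp add: G_def embeds_struct emb_refl)
  have c: "conflict (L ! i) (L ! j)" if "i < length L" "j < length L" "i \<noteq> j" for i j
    using L that conflict_sym by (metis linorder_neqE_nat sorted_wrt_iff_nth_less)
  have "inj_on (\<lambda>i. G (L ! i)) {..<length L}"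
  proof (rule inj_onI, rule ccontr)
    fix i j assume "i \<in> {..<length L}" "j \<in> {..<length L}" "G (L ! i) = G (L ! j)" "i \<noteq> j"
    then show False using no[OF _ _ c[of i j]] refl[of "L ! i"] by auto
  qed
  then have "card ((\<lambda>i. G (L ! i)) ` {..<length L}) = length L" by (simp add: card_image)
  moreover have "pairwise (\<lambda>G H. \<not> embeds G H) ((\<lambda>i. G (L ! i)) ` {..<length L})"
  proof (rule pairwiseI)
    fix G1 G2 assume "G1 \<in> (\<lambda>i. G (L ! i)) ` {..<length L}" "G2 \<in> (\<lambda>i. G (L ! i)) ` {..<length L}" "G1 \<noteq> G2"
    then obtain i j where ij: "i < length L" "j < length L" "G1 = G (L ! i)" "G2 = G (L ! j)" "i \<noteq> j" by auto
    then show "\<not> embeds G1 G2" using no[OF _ _ c[of i j]] by simp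
  qed
  moreover have "\<forall>H\<in>(\<lambda>i. G (L ! i)) ` {..<length L}. \<exists>ps\<in>set L. \<exists>R V. H = struct V R \<and> model ps (R, V)"
  proof
    fix H assume "H \<in> (\<lambda>i. G (L ! i)) ` {..<length L}"
    then obtain i where "i < length L" "H = G (L ! i)" by auto
    then obtain ps where ps: "ps \<in> set L" "H = G ps" using nth_mem by blast
    then have "model ps (fst (M ps), snd (M ps))" using M by simp
    then show "\<exists>ps\<in>set L. \<exists>R V. H = struct V R \<and> model ps (R, V)"
      using ps unfolding G_def by blast
  qed
  ultimately show ?thesis by blast
qed

lemma graph_family:
  assumes "\<And>ps. ps \<in> set L \<Longrightarrow> \<exists>M :: ('a \<Rightarrow> 'a \<Rightarrow> bool) \<times> 'a set. graph_model c ps M" "sorted_wrt conflict L"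
  shows "\<exists>F :: 'a rel_struct set. card F = length L \<and> (\<forall>G\<in>F. minimal_prime_graph G \<and> |verts G| =o c) \<and>
    pairwise (\<lambda>G H. \<not> embeds G H) F"
proof -
  obtain F :: "'a rel_struct set" where F: "card F = length L" "pairwise (\<lambda>G H. \<not> embeds G H) F"
    "\<And>G. G \<in> F \<Longrightarrow> \<exists>ps\<in>set L. \<exists>R V. G = struct V R \<and> graph_model c ps (R, V)"
    using conflicting_family[of L "graph_model c" c, OF assms(1) _ assms(2)] by (auto simp: graph_model_def)
  have "minimal_prime_graph G \<and> |verts G| =o c" if G: "G \<in> F" for G
  proof -
    obtain ps R V where "G = struct V R" "graph_model c ps (R, V)" using F(3)[OF G] by blast
    then show ?thesis using minimal_prime_graph_struct[of R V] by (simp add: graph_model_def)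
  qed
  then show ?thesis using F(1,2) by blast
qed

lemma poset_family:
  assumes "\<And>ps. ps \<in> set L \<Longrightarrow> \<exists>M :: ('a \<Rightarrow> 'a \<Rightarrow> bool) \<times> 'a set. poset_model c ps M" "sorted_wrt conflict L"
  shows "\<exists>F :: 'a rel_struct set. card F = length L \<and> (\<forall>G\<in>F. minimal_prime_poset G \<and> |verts G| =o c) \<and>
    pairwise (\<lambda>G H. \<not> embeds G H) F"
proof -
  obtain F :: "'a rel_struct set" where F: "card F = length L" "pairwise (\<lambda>G H. \<not> embeds G H) F"
    "\<And>G. G \<in> F \<Longrightarrow> \<exists>ps\<in>set L. \<exists>R V. G = struct V R \<and> poset_model c ps (R, V)"
    using conflicting_family[of L "poset_model c" c, OF assms(1) _ assms(2)] by (auto simp: poset_model_def)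
  have "minimal_prime_poset G \<and> |verts G| =o c" if G: "G \<in> F" for G
  proof -
    obtain ps R V where *: "G = struct V R" "poset_model c ps (R, V)" using F(3)[OF G] by blast
    have "minimal_prime_poset (struct V R)"
      by (rule minimal_prime_poset_struct) (use *(2) in \<open>auto simp: poset_model_def\<close>)
    then show ?thesis using * by (simp add: poset_model_def)
  qed
  then show ?thesis using F(1,2) by blast
qed

section \<open>The lists of profiles and their realizations\<close>

definition graph_profiles :: "profile list" where
  "graph_profiles = [star_profile, co_profile star_profile, crown_profile, co_profile crown_profile,
    spider_profile, co_profile spider_profile, half_profile, co_profile half_profile,
    hub_profile False, hub_profile True, tail_profile False, co_profile (tail_profile False),
    tail_profile True, co_profile (tail_profile True)]"

text \<open>The crown stands alone because exchanging its rows is an isomorphism onto the dual.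
  Every other pair \<open>(ps, p)\<close> represents an order and its dual, exactly one of which has
  \<open>p\<close>.\<close>

definition poset_profiles :: "profile list" where
  "poset_profiles = crown_profile #
    concat (map (\<lambda>(ps, p). [ps @ [(p, True)], ps @ [(p, False)]])
      [(star_profile, Three_Above), (half_profile, Half_Up), (co_profile half_profile, Ascending),
       (hub_profile False, Ascending), (hub_profile True, Ascending),
       (tail_profile False, Ascending), (co_profile (tail_profile False), Ascending),
       (tail_profile True, Ascending), (co_profile (tail_profile True), Ascending)])"

definition path_graph_profiles :: "profile list" where
  "path_graph_profiles = [path_profile, co_profile path_profile]"

text \<open>The fence is listed once since a shift by one embeds it in its dual; the orientation of
  the complement differs from its dual by ascending chains.\<close>

definition path_poset_profiles :: "profile list" where
  "path_poset_profiles = [path_profile, co_profile path_profile @ [(Ascending, True)],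
    co_profile path_profile @ [(Ascending, False)]]"

lemmas base_profile_defs = star_profile_def crown_profile_def spider_profile_def half_profile_def
  hub_profile_def tail_profile_def path_profile_def

lemmas profile_defs = co_profile_def base_profile_defs graph_profiles_def poset_profiles_def
  path_graph_profiles_def path_poset_profiles_def

lemma conflicting_profiles:
  "sorted_wrt conflict graph_profiles" "sorted_wrt conflict poset_profiles"
  "sorted_wrt conflict (graph_profiles @ path_graph_profiles)"
  "sorted_wrt conflict (poset_profiles @ path_poset_profiles)"
  by code_simp+

lemma graph_models:
  assumes o: "self_embedding R V" "indec (sym_of R) V" "infinite V" "|V| =o c" "has_profile ps R V"
    and ps: "\<forall>(p, b)\<in>set ps. graph_feature p"
  shows "graph_model c ps (sym_of R, V)" "graph_model c (co_profile ps) (co_of R, V)"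
  using minimal_sym_of[OF o(1,2)] minimal_co_of[OF o(1,2)] o(3,4)
    has_profile_sym_of_cong[OF _ ps o(5), of "sym_of R"] has_co_profile[OF ps o(5)]
  by (auto simp: graph_model_def sym_of_def co_of_def)

text \<open>An order and its dual have the same comparability graph, so \<open>ps\<close> passes to
  both; \<open>qs\<close> is what distinguishes them.\<close>

lemma poset_models:
  assumes o: "self_embedding R V" "indec (sym_of R) V" "infinite V" "|V| =o c" "has_profile ps R V"
    and s: "strict_order R"
    and ps: "\<forall>(p, b)\<in>set ps. graph_feature p"
  shows "has_profile qs (po_of R) V \<Longrightarrow> poset_model c (ps @ qs) (po_of R, V)"
    "has_profile qs (od_of R) V \<Longrightarrow> poset_model c (ps @ qs) (od_of R, V)"
  using minimal_po_of[OF o(1,2)] minimal_od_of[OF o(1,2)] o(3,4) s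
    has_profile_sym_of_cong[OF _ ps o(5), of "po_of R"] has_profile_sym_of_cong[OF _ ps o(5), of "od_of R"]
  by (auto simp: poset_model_def po_of_def od_of_def strict_order_def)

lemma graph_feature_profiles:
  "\<forall>(p, b)\<in>set star_profile. graph_feature p" "\<forall>(p, b)\<in>set crown_profile. graph_feature p"
  "\<forall>(p, b)\<in>set spider_profile. graph_feature p" "\<forall>(p, b)\<in>set half_profile. graph_feature p"
  "\<forall>(p, b)\<in>set (hub_profile t). graph_feature p" "\<forall>(p, b)\<in>set (tail_profile t). graph_feature p"
  "\<forall>(p, b)\<in>set path_profile. graph_feature p"
  "\<forall>(p, b)\<in>set (co_profile half_profile). graph_feature p"
  "\<forall>(p, b)\<in>set (co_profile (tail_profile t)). graph_feature p"
  "\<forall>(p, b)\<in>set (co_profile path_profile). graph_feature p"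
  by (simp_all add: base_profile_defs co_profile_def)

context index_set
begin

text \<open>\<open>T'\<close> orients the complement of the graph of \<open>T\<close>. Primality and
  profile therefore come from \<open>T\<close> by complementation and need no new case
  analysis.\<close>

lemma co_order:
  assumes "self_embedding (ori \<rho> T) V" "indec (sym_of (ori \<rho> T)) V" "has_profile ps (ori \<rho> T) V"
    and ps: "\<forall>(p, b)\<in>set ps. graph_feature p" "\<forall>(p, b)\<in>set (co_profile ps). graph_feature p"
    and eq: "\<And>x y. x \<in> V \<Longrightarrow> y \<in> V \<Longrightarrow> sym_of (ori \<rho> T') x y = co_of (ori \<rho> T) x y"
  shows "indec (sym_of (ori \<rho> T')) V" "has_profile (co_profile ps) (ori \<rho> T') V"
proof -
  have "indec (co_of (ori \<rho> T)) V" using minimal_co_of[OF assms(1,2)] by (simp add: minimal_def)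
  then show "indec (sym_of (ori \<rho> T')) V"
    unfolding indec_def using auton_cong[of V, OF eq] by simp
  have "has_profile (co_profile ps) (co_of (ori \<rho> T)) V" using has_co_profile[OF ps(1) assms(3)] .
  then have "has_profile (co_profile ps) (sym_of (ori \<rho> T')) V"
    unfolding has_profile_def using holds_cong[of V, OF eq] by simp
  then show "has_profile (co_profile ps) (ori \<rho> T') V"
    by (rule has_profile_sym_of_cong[OF sym_of_idem(1) ps(2)])
qed

lemmas half_co_order = co_order[OF self_embeddings(4) indec_half half_has_profile graph_feature_profiles(4,8),
    of T_half_co, OF sym_of_half_co, OF _ _ refl]
lemmas tail_co_order = co_order[OF self_embeddings(8) indec_tail tail_has_profile graph_feature_profiles(6,9),
    of T_tail_co, OF sym_of_tail_co]
lemmas tail'_co_order = co_order[OF self_embeddings(10) indec_tail' tail'_has_profile graph_feature_profiles(6,9),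
    of T_tail'_co, OF sym_of_tail'_co]

lemma graph_profiles_models:
  assumes "ps \<in> set graph_profiles" "|K| =o c"
  shows "\<exists>M :: ('k vx \<Rightarrow> 'k vx \<Rightarrow> bool) \<times> 'k vx set. graph_model c ps M"
proof -
  have V: "infinite (vset K E)" "|vset K E| =o c" if "finite E" for E
    using infinite_vset[OF that] ordIso_transitive[OF card_vset[OF that] assms(2)] .
  note g = graph_models[OF self_embeddings(1) indec_star V star_has_profile graph_feature_profiles(1)]
    graph_models[OF self_embeddings(2) indec_crown V crown_has_profile graph_feature_profiles(2)]
    graph_models[OF self_embeddings(3) indec_spider V spider_has_profile graph_feature_profiles(3)]
    graph_models[OF self_embeddings(4) indec_half V half_has_profile graph_feature_profiles(4)]
    graph_models(1)[OF self_embeddings(6) indec_hub V hub_has_profile graph_feature_profiles(5)]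
    graph_models(1)[OF self_embeddings(7) indec_hub' V hub'_has_profile graph_feature_profiles(5)]
    graph_models[OF self_embeddings(8) indec_tail V tail_has_profile graph_feature_profiles(6)]
    graph_models[OF self_embeddings(10) indec_tail' V tail'_has_profile graph_feature_profiles(6)]
  show ?thesis
    using assms(1) unfolding graph_profiles_def set_simps insert_iff empty_iff
    by (elim disjE FalseE) (hypsubst, rule exI, rule g; simp)+
qed

lemma poset_profiles_models:
  assumes "ps \<in> set poset_profiles" "|K| =o c"
  shows "\<exists>M :: ('k vx \<Rightarrow> 'k vx \<Rightarrow> bool) \<times> 'k vx set. poset_model c ps M"
proof -
  have V: "infinite (vset K E)" "|vset K E| =o c" if "finite E" for E
    using infinite_vset[OF that] ordIso_transitive[OF card_vset[OF that] assms(2)] .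
  note g = poset_models[OF self_embeddings(1) indec_star V star_has_profile strict_orders(1) graph_feature_profiles(1)]
    poset_models(1)[OF self_embeddings(2) indec_crown V crown_has_profile strict_orders(2) graph_feature_profiles(2),
      of "[]", unfolded append_Nil2]
    poset_models[OF self_embeddings(4) indec_half V half_has_profile strict_orders(3) graph_feature_profiles(4)]
    poset_models[OF self_embeddings(5) half_co_order(1) V half_co_order(2) strict_orders(4) graph_feature_profiles(8)]
    poset_models[OF self_embeddings(6) indec_hub V hub_has_profile strict_orders(5) graph_feature_profiles(5)]
    poset_models[OF self_embeddings(7) indec_hub' V hub'_has_profile strict_orders(6) graph_feature_profiles(5)]
    poset_models[OF self_embeddings(8) indec_tail V tail_has_profile strict_orders(7) graph_feature_profiles(6)]
    poset_models[OF self_embeddings(9) tail_co_order(1) V tail_co_order(2) strict_orders(8) graph_feature_profiles(9)]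
    poset_models[OF self_embeddings(10) indec_tail' V tail'_has_profile strict_orders(9) graph_feature_profiles(6)]
    poset_models[OF self_embeddings(11) tail'_co_order(1) V tail'_co_order(2) strict_orders(10) graph_feature_profiles(9)]
  note f = three_above_star not_three_above_star half_up not_half_up ascending_features
  show ?thesis
    using assms(1) unfolding poset_profiles_def list.map concat.simps prod.case append.simps set_simps insert_iff empty_iff
    by (elim disjE FalseE) (hypsubst, rule exI, rule g; simp add: f del: holds.simps)+
qed

end

lemma path_graph_profiles_models:
  assumes "ps \<in> set path_graph_profiles"
  shows "\<exists>M :: (nat \<Rightarrow> nat \<Rightarrow> bool) \<times> nat set. graph_model natLeq ps M"
proof -
  have V: "infinite (UNIV :: nat set)" "|UNIV :: nat set| =o natLeq"
    by (simp_all add: card_of_nat)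
  note g = graph_models[OF self_embedding_zigzag indec_zigzag V path_has_profile graph_feature_profiles(7)]
  show ?thesis
    using assms unfolding path_graph_profiles_def set_simps insert_iff empty_iff
    by (elim disjE FalseE) (hypsubst, rule exI, rule g)+
qed

lemma path_poset_profiles_models:
  assumes "ps \<in> set path_poset_profiles"
  shows "\<exists>M :: (nat \<Rightarrow> nat \<Rightarrow> bool) \<times> nat set. poset_model natLeq ps M"
proof -
  have V: "infinite (UNIV :: nat set)" "|UNIV :: nat set| =o natLeq"
    by (simp_all add: card_of_nat)
  have i: "indec (sym_of jump) UNIV"
    using minimal_co_of[OF self_embedding_zigzag indec_zigzag] by (simp add: minimal_def sym_of_jump)
  have p: "has_profile (co_profile path_profile) jump UNIV"
    using has_co_profile[OF graph_feature_profiles(7) path_has_profile]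
    by (rule has_profile_sym_of_cong[OF _ graph_feature_profiles(10), rotated]) (simp add: sym_of_jump)
  note g = poset_models(1)[OF self_embedding_zigzag indec_zigzag V path_has_profile strict_order_zigzag graph_feature_profiles(7),
      of "[]", unfolded append_Nil2]
    poset_models[OF self_embedding_jump i V p strict_order_jump graph_feature_profiles(10)]
  show ?thesis
    using assms unfolding path_poset_profiles_def set_simps insert_iff empty_iff
    by (elim disjE FalseE)
      (hypsubst, rule exI, rule g; simp add: ascending_jump not_ascending_jump del: holds.simps)+
qed

lemma infinite_models:
  fixes c :: "'k rel"
  assumes c: "Card_order c" "natLeq \<le>o c"
  shows "ps \<in> set graph_profiles \<Longrightarrow> \<exists>M :: ('k \<Rightarrow> 'k \<Rightarrow> bool) \<times> 'k set. graph_model c ps M"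
    "ps \<in> set poset_profiles \<Longrightarrow> \<exists>M :: ('k \<Rightarrow> 'k \<Rightarrow> bool) \<times> 'k set. poset_model c ps M"
proof -
  obtain le ls and K :: "'k set" where K: "index_set le ls K" "|K| =o c"
    using exists_index_set[OF c] by blast
  interpret index_set le ls K by (rule K(1))
  show "\<exists>M :: ('k \<Rightarrow> 'k \<Rightarrow> bool) \<times> 'k set. graph_model c ps M" if "ps \<in> set graph_profiles"
    using graph_profiles_models[OF that K(2)] graph_model_transfer[OF c(1)] by blast
  show "\<exists>M :: ('k \<Rightarrow> 'k \<Rightarrow> bool) \<times> 'k set. poset_model c ps M" if "ps \<in> set poset_profiles"
    using poset_profiles_models[OF that K(2)] poset_model_transfer[OF c(1)] by blast
qed

lemma lengths: "length graph_profiles = 14" "length poset_profiles = 19"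
  "length (graph_profiles @ path_graph_profiles) = 16" "length (poset_profiles @ path_poset_profiles) = 22"
  by (simp_all add: profile_defs)

theorem theorem9:
  shows
    "(\<exists>F :: nat rel_struct set. card F \<ge> 16 \<and>
        (\<forall>G\<in>F. minimal_prime_graph G \<and> |verts G| =o natLeq) \<and>
        pairwise (\<lambda>G H. \<not> embeds G H) F) \<and>
     (\<exists>F :: nat rel_struct set. card F \<ge> 22 \<and>
        (\<forall>P\<in>F. minimal_prime_poset P \<and> |verts P| =o natLeq) \<and>
        pairwise (\<lambda>P Q. \<not> embeds P Q) F) \<and>
     (\<forall>\<kappa> :: 'k rel. Card_order \<kappa> \<and> natLeq <o \<kappa> \<longrightarrow>
        (\<exists>F :: 'k rel_struct set. card F \<ge> 14 \<and>
          (\<forall>G\<in>F. minimal_prime_graph G \<and> |verts G| =o \<kappa>) \<and>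
          pairwise (\<lambda>G H. \<not> embeds G H) F) \<and>
        (\<exists>F :: 'k rel_struct set. card F \<ge> 19 \<and>
          (\<forall>P\<in>F. minimal_prime_poset P \<and> |verts P| =o \<kappa>) \<and>
          pairwise (\<lambda>P Q. \<not> embeds P Q) F))"
proof (intro conjI allI impI)
  have nat: "Card_order natLeq" "natLeq \<le>o natLeq"
    using natLeq_Card_order natLeq_Well_order ordLeq_reflexive by blast+
  \<comment> \<open>The families available at every infinite cardinal are taken at
    \<open>natLeq\<close> and enlarged by the paths.\<close>
  have "\<exists>M :: (nat \<Rightarrow> nat \<Rightarrow> bool) \<times> nat set. graph_model natLeq ps M"
    if "ps \<in> set (graph_profiles @ path_graph_profiles)" for ps
    using that infinite_models(1)[OF nat] path_graph_profiles_models by auto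
  from graph_family[OF this conflicting_profiles(3)]
  show "\<exists>F :: nat rel_struct set. card F \<ge> 16 \<and>
        (\<forall>G\<in>F. minimal_prime_graph G \<and> |verts G| =o natLeq) \<and> pairwise (\<lambda>G H. \<not> embeds G H) F"
    unfolding lengths by (metis order_refl)
  have "\<exists>M :: (nat \<Rightarrow> nat \<Rightarrow> bool) \<times> nat set. poset_model natLeq ps M"
    if "ps \<in> set (poset_profiles @ path_poset_profiles)" for ps
    using that infinite_models(2)[OF nat] path_poset_profiles_models by auto
  from poset_family[OF this conflicting_profiles(4)]
  show "\<exists>F :: nat rel_struct set. card F \<ge> 22 \<and>
        (\<forall>P\<in>F. minimal_prime_poset P \<and> |verts P| =o natLeq) \<and> pairwise (\<lambda>P Q. \<not> embeds P Q) F"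
    unfolding lengths by (metis order_refl)
  fix \<kappa> :: "'k rel" assume \<kappa>: "Card_order \<kappa> \<and> natLeq <o \<kappa>"
  then have c: "Card_order \<kappa>" "natLeq \<le>o \<kappa>" using ordLess_imp_ordLeq by auto
  show "\<exists>F :: 'k rel_struct set. card F \<ge> 14 \<and>
          (\<forall>G\<in>F. minimal_prime_graph G \<and> |verts G| =o \<kappa>) \<and> pairwise (\<lambda>G H. \<not> embeds G H) F"
    using graph_family[OF infinite_models(1)[OF c] conflicting_profiles(1)] unfolding lengths by (metis order_refl)
  show "\<exists>F :: 'k rel_struct set. card F \<ge> 19 \<and>
          (\<forall>P\<in>F. minimal_prime_poset P \<and> |verts P| =o \<kappa>) \<and> pairwise (\<lambda>P Q. \<not> embeds P Q) F"
    using poset_family[OF infinite_models(2)[OF c] conflicting_profiles(2)] unfolding lengths by (metis order_refl)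
qed

end
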